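(* Let $\underline X_n=(X_1,\dots,X_n)$ be observations from a centered stationary Gaussian process with true spectral density $f_0(\lambda)=|\lambda|^{-2d_0}\tilde f_0(\lambda)$. Assume that there exist $t_0,M_0,m_0,L_0>0$ such that either $f_0\in\bar{\mathcal G}(t_0,M_0,m_0,L_0,\rho_0)$ with $0<\rho_0\le 1$, or $f_0\in\bar{\mathcal L}(t_0,M_0,m_0,L_0)$ (in which case put $\rho_0=1$). Let $t,m,M,L$ be positive reals, and let $\pi$ be a prior probability distribution on either $\bar{\mathcal G}(t,M,m,L,\rho)$ with $\rho>0$, or $\bar{\mathcal L}(t,M,m,L)$ (in which case put $\rho=1$). Suppose $t<(\rho\wedge\rho_0)/4$ and set $\gamma=\rho\wedge\rho_0\wedge\frac12$. Assume: (i) For every $\varepsilon>0$, $\pi(\mathcal B_\varepsilon)>0$, where $$\mathcal B_\varepsilon=\{f=|\lambda|^{-2d}\tilde f\in\bar{\mathcal F}_+(t,M,m):\ h(f_0,f)\le\varepsilon,\ 8(d_0-d)<\gamma-t\}.$$ (ii) For every sufficiently small $\varepsilon>0$ there exist $r>0$, sets $\mathcal F_n\subset\tilde{\mathcal F}_+$ with $\pi(\mathcal F_n^c)\le e^{-nr}$, and a (smallest possible) finite net $\mathcal H_n\subset\{f\in\bar{\mathcal G}(t,M,m,L,\rho): d(f,f_0)>\varepsilon/2\}$ (respectively $\mathcal H_n\subset\{f\in\bar{\mathcal L}(t,M,m,L): d(f,f_0)>\varepsilon/2\}$) such that, for $n$ large enough, for every $f=|x|^{-2d}\tilde f\in\mathcal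 F_n\cap A_\varepsilon^c$ there exists $f_i=|x|^{-2d_i}\tilde f_i\in\mathcal H_n$ with $f_i\ge f$, $4(d_i-d)\le\rho\wedge\frac12$, and - if $4|d-d_0|\le\gamma-t$: $\ \frac1{2\pi}\int_{-\pi}^{\pi}\frac{(f_i-f)(x)}{f_0(x)}\,dx\le \frac{h(f_0,f_i)}4$; - if $4(d-d_0)>\gamma-t$: $\ \frac1{2\pi}\int_{-\pi}^{\pi}\frac{(f_i-f)^2(x)}{f^2(x)}\,dx\le b(f_0,f_i)\,|\log\varepsilon|^{-1}$; - if $4(d_0-d)>\gamma-t$: $\ \frac1{2\pi}\int_{-\pi}^{\pi}\frac{(f_i-f)^2(x)}{f_0^2(x)}\,dx\le b(f_i,f_0)$ and $\frac1{2\pi}\int_{-\pi}^{\pi}\frac{(f_i-f)(x)}{f(x)}\,dx\le b(f_i,f_0)\,|\log\varepsilon|^{-1}$; and, denoting by $N_n$ the logarithm of the cardinality of the smallest possible such net $\mathcal H_n$, $N_n\le nc_1$ with $c_1\le\varepsilon|\log\varepsilon|^{-2}$. Let $\hat f^\pi(\lambda)=\exp\{E^\pi[\log f(\lambda)\mid\underline X_n]\}$. Then, as $n\to\infty$, $$\ell(f_0,\hat f^\pi)=\int_{-\pi}^{\pi}\big(\log f_0(\lambda)-\log\hat f^\pi(\lambda)\big)^2d\lambda\to0$$ almost surely under the law of the process with spectral density $f_0$.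
   Context: Spectral densities and likelihood: $\mathcal F=\{f \text{ symmetric on }[-\pi,\pi],\ \int|f|<\infty\}$, $\mathcal F_+=\{f\in\mathcal F: f\ge0\}$. For $f\in\mathcal F$, $T_n(f)$ is the $n\times n$ Toeplitz matrix with $(j,k)$ entry $\int_{-\pi}^{\pi}f(\lambda)e^{i(j-k)\lambda}d\lambda$. Under spectral density $f$, $\underline X_n$ has density $\varphi_f(\underline X_n)=(2\pi)^{-n/2}|T_n(f)|^{-1/2}\exp(-\underline X_n'T_n(f)^{-1}\underline X_n/2)$. The posterior is $P^\pi[B\mid\underline X_n]=\int_B\varphi_f(\underline X_n)d\pi(f)/\int\varphi_f(\underline X_n)d\pi(f)$, and $E^\pi[\cdot\mid\underline X_n]$ is posterior expectation. Function classes: $\tilde{\mathcal F}=\{f\in\mathcal F: f(\lambda)=|\lambda|^{-2d}\tilde f(\lambda),\ \tilde f \text{ continuous on }[-\pi,\pi],\ -\frac12<d<\frac12\}$, $\tilde{\mathcal F}_+=\{f\in\tilde{\mathcal F}: f\ge0\}$. For $-\frac12<d<\frac12$ and $m,M,L,\rho>0$: $\mathcal G(d,M,m,L,\rho)=\{f\in\tilde{\mathcal F}_+: f(\lambda)=|\lambda|^{-2d}\tilde f(\lambda),\ m\le\tilde f\le M,\ |\tilde f(x)-\tilde f(y)|\le L|x-y|^\rho\}$; $\mathcal L^\star(M,m,L)=\{h\ge0: 0<m\le h\le M,\ |h(x)-h(y)|\le L|x-y|(|x|\wedge|y|)^{-1}\}$; $\mathcal L(d,M,m,L)=\{f=|\lambda|^{-2d}\tilde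 f(\lambda): \tilde f\in\mathcal L^\star(M,m,L)\}$. $\bar{\mathcal G}(t,M,m,L,\rho)=\bigcup_{-1/2+t\le d\le1/2-t}\mathcal G(d,M,m,L,\rho)$, $\bar{\mathcal L}(t,M,m,L)=\bigcup_{-1/2+t\le d\le1/2-t}\mathcal L(d,M,m,L)$, and $\bar{\mathcal F}_+(t,M,m)=\bigcup_{-1/2+t\le d\le1/2-t}\{f\in\mathcal F_+: f(\lambda)=|\lambda|^{-2d}\tilde f(\lambda),\ 0<m\le\tilde f\le M\}$. For $f$ in one of these classes, $d$ denotes its exponent. Discrepancies: $KL_\infty(f_0;f)=\frac1\pi\int_{-\pi}^{\pi}\big[\frac{f_0}{f}-1-\log\frac{f_0}{f}\big]d\lambda$; $d(f_0,f)=\min\{KL_\infty(f_0;f),KL_\infty(f;f_0)\}$; $h(f_0,f)=\frac1{2\pi}\int_{-\pi}^{\pi}\big[\frac{f_0}{f}+\frac{f}{f_0}-2\big]d\lambda$; $b(f_1,f)=\frac1{2\pi}\int_{-\pi}^{\pi}(f_1/f-1)^2dx$. $A_\varepsilon=\{f\in\tilde{\mathcal F}_+: d(f,f_0)\le\varepsilon\}$. *)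

theory Defs
  imports
    "HOL-Probability.Probability"
    "Jordan_Normal_Form.Gauss_Jordan_Elimination"
    "Jordan_Normal_Form.Determinant"
begin

section \<open>Spectral densities\<close>

text \<open>
  A function on \<open>[-\<pi>, \<pi>]\<close> is represented by a total function \<open>real \<Rightarrow> real\<close> of which only the values
  on \<open>[-\<pi>, \<pi>] - {0}\<close> matter. The frequency \<open>0\<close> is left out because \<open>\<bar>v\<bar> powr (- 2 * d)\<close>
  is infinite there for \<open>d > 0\<close>, whereas \<open>0 powr a = 0\<close> in HOL.
\<close>

definition freqs :: "real set" where
  "freqs = {-pi..pi} - {0}"

definition sdens :: "(real \<Rightarrow> real) set" where
  "sdens = {f. (\<forall>v\<in>freqs. f (- v) = f v) \<and> set_integrable lborel {-pi..pi} f}"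

definition sdens_plus :: "(real \<Rightarrow> real) set" where
  "sdens_plus = {f \<in> sdens. \<forall>v\<in>freqs. 0 \<le> f v}"

definition long_mem_form :: "(real \<Rightarrow> real) \<Rightarrow> real \<Rightarrow> (real \<Rightarrow> real) \<Rightarrow> bool" where
  "long_mem_form f d g \<longleftrightarrow>
     -1/2 < d \<and> d < 1/2 \<and> (\<forall>v\<in>freqs. f v = \<bar>v\<bar> powr (- 2 * d) * g v)"

definition sdens_tilde :: "(real \<Rightarrow> real) set" where
  "sdens_tilde = {f \<in> sdens. \<exists>d g. continuous_on {-pi..pi} g \<and> long_mem_form f d g}"

definition sdens_tilde_plus :: "(real \<Rightarrow> real) set" where
  "sdens_tilde_plus = {f \<in> sdens_tilde. \<forall>v\<in>freqs. 0 \<le> f v}"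

definition G_class :: "real \<Rightarrow> real \<Rightarrow> real \<Rightarrow> real \<Rightarrow> real \<Rightarrow> (real \<Rightarrow> real) set" where
  "G_class d M m L \<rho> = {f \<in> sdens_tilde_plus. \<exists>g. long_mem_form f d g
     \<and> (\<forall>x\<in>{-pi..pi}. m \<le> g x \<and> g x \<le> M)
     \<and> (\<forall>x\<in>{-pi..pi}. \<forall>y\<in>{-pi..pi}. \<bar>g x - g y\<bar> \<le> L * \<bar>x - y\<bar> powr \<rho>)}"

text \<open>
  If \<open>x\<close> or \<open>y\<close> is \<open>0\<close>, the factor \<open>1 / min \<bar>x\<bar> \<bar>y\<bar>\<close> below stands for \<open>\<infinity>\<close> and there is no constraint.
\<close>

definition L_star :: "real \<Rightarrow> real \<Rightarrow> real \<Rightarrow> (real \<Rightarrow> real) set" where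
  "L_star M m L = {h. 0 < m \<and> (\<forall>x\<in>{-pi..pi}. m \<le> h x \<and> h x \<le> M)
     \<and> (\<forall>x\<in>freqs. \<forall>y\<in>freqs. \<bar>h x - h y\<bar> \<le> L * \<bar>x - y\<bar> / min \<bar>x\<bar> \<bar>y\<bar>)}"

definition L_class :: "real \<Rightarrow> real \<Rightarrow> real \<Rightarrow> real \<Rightarrow> (real \<Rightarrow> real) set" where
  "L_class d M m L = {f \<in> sdens_plus. \<exists>g. long_mem_form f d g \<and> g \<in> L_star M m L}"

definition G_bar :: "real \<Rightarrow> real \<Rightarrow> real \<Rightarrow> real \<Rightarrow> real \<Rightarrow> (real \<Rightarrow> real) set" where
  "G_bar t M m L \<rho> = (\<Union>d\<in>{-1/2 + t..1/2 - t}. G_class d M m L \<rho>)"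

definition L_bar :: "real \<Rightarrow> real \<Rightarrow> real \<Rightarrow> real \<Rightarrow> (real \<Rightarrow> real) set" where
  "L_bar t M m L = (\<Union>d\<in>{-1/2 + t..1/2 - t}. L_class d M m L)"

definition F_bar_plus :: "real \<Rightarrow> real \<Rightarrow> real \<Rightarrow> (real \<Rightarrow> real) set" where
  "F_bar_plus t M m = (\<Union>d\<in>{-1/2 + t..1/2 - t}. {f \<in> sdens_plus. \<exists>g. long_mem_form f d g
     \<and> 0 < m \<and> (\<forall>x\<in>{-pi..pi}. m \<le> g x \<and> g x \<le> M)})"

text \<open>
  The exponent of \<open>f\<close>. Being of the form \<open>\<bar>v\<bar> powr (- 2 * d) * g v\<close> with \<open>g\<close> continuous does not
  determine \<open>d\<close>: a larger \<open>d\<close> is always possible, with a factor \<open>g\<close> vanishing at \<open>0\<close>.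
  What determines \<open>d\<close> is that \<open>g\<close> is bounded and bounded away from \<open>0\<close>, as it is for the members of
  \<open>G_bar\<close>, \<open>L_bar\<close> and \<open>F_bar_plus\<close>.
\<close>

definition mem_exponent :: "(real \<Rightarrow> real) \<Rightarrow> real \<Rightarrow> bool" where
  "mem_exponent f d \<longleftrightarrow> (\<exists>g a b. long_mem_form f d g \<and> 0 < a
     \<and> (\<forall>\<^sub>F v in at 0. a \<le> g v \<and> g v \<le> b))"

lemma eventually_freqs: "\<forall>\<^sub>F x in at (0::real). x \<in> freqs"
  unfolding eventually_at freqs_def
  by (rule exI[of _ pi]) (auto simp: dist_real_def)

lemma mem_exponent_le:
  assumes "mem_exponent f d" "mem_exponent f d'"
  shows "d' \<le> d"
proof (rule ccontr)
  assume "\<not> d' \<le> d"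
  hence pos: "2 * (d' - d) > 0" by simp
  from assms(1) obtain g a b where g: "long_mem_form f d g" "0 < a"
    "\<forall>\<^sub>F x in at 0. a \<le> g x \<and> g x \<le> b"
    unfolding mem_exponent_def by blast
  from assms(2) obtain g' a' b' where g': "long_mem_form f d' g'" "0 < a'"
    "\<forall>\<^sub>F x in at 0. a' \<le> g' x \<and> g' x \<le> b'"
    unfolding mem_exponent_def by blast
  have ev: "\<forall>\<^sub>F x in at 0. a' \<le> \<bar>x\<bar> powr (2 * (d' - d)) * b"
    using g(3) g'(3) eventually_freqs
  proof eventually_elim
    case (elim x)
    have x: "\<bar>x\<bar> > 0" using elim(3) by (simp add: freqs_def)
    have eq: "\<bar>x\<bar> powr (- 2 * d) * g x = \<bar>x\<bar> powr (- 2 * d') * g' x"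
      using g(1) g'(1) elim(3) unfolding long_mem_form_def by metis
    have "g' x = \<bar>x\<bar> powr (2 * d') * (\<bar>x\<bar> powr (- 2 * d') * g' x)"
      using x by (simp add: powr_minus)
    also have "\<dots> = \<bar>x\<bar> powr (2 * d') * (\<bar>x\<bar> powr (- 2 * d) * g x)"
      by (simp only: eq)
    also have "\<dots> = \<bar>x\<bar> powr (2 * (d' - d)) * g x"
    proof -
      have "2 * (d' - d) = 2 * d' + - 2 * d" by simp
      thus ?thesis by (simp only: powr_add mult.assoc)
    qed
    also have "\<dots> \<le> \<bar>x\<bar> powr (2 * (d' - d)) * b"
      using elim by (intro mult_left_mono) auto
    finally show ?case using elim by linarith
  qed
  have "((\<lambda>x::real. \<bar>x\<bar> powr (2 * (d' - d)) * b) \<longlongrightarrow> 0 * b) (at 0)"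
  proof (intro tendsto_mult tendsto_const)
    have "((\<lambda>x::real. \<bar>x\<bar> powr (2 * (d' - d))) \<longlongrightarrow> \<bar>0\<bar> powr (2 * (d' - d))) (at 0)"
      using pos by (intro tendsto_powr' tendsto_intros) auto
    thus "((\<lambda>x::real. \<bar>x\<bar> powr (2 * (d' - d))) \<longlongrightarrow> 0) (at 0)" by simp
  qed
  from tendsto_lowerbound[OF this ev] have "a' \<le> 0" by simp
  with g'(2) show False by simp
qed

lemma mem_exponent_unique: "mem_exponent f d \<Longrightarrow> mem_exponent f d' \<Longrightarrow> d = d'"
  by (meson mem_exponent_le order_antisym)

lemma mem_exponentI:
  assumes "long_mem_form f d g" "0 < m" "\<forall>x\<in>{-pi..pi}. m \<le> g x \<and> g x \<le> M"
  shows "mem_exponent f d"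
  unfolding mem_exponent_def
proof (intro exI conjI)
  show "\<forall>\<^sub>F x in at 0. m \<le> g x \<and> g x \<le> M"
    using eventually_freqs by eventually_elim (use assms(3) in \<open>auto simp: freqs_def\<close>)
qed (use assms in auto)

lemma mem_exponent_G_class: "f \<in> G_class d M m L \<rho> \<Longrightarrow> 0 < m \<Longrightarrow> mem_exponent f d"
  unfolding G_class_def by (auto intro: mem_exponentI)

lemma mem_exponent_L_class: "f \<in> L_class d M m L \<Longrightarrow> mem_exponent f d"
  unfolding L_class_def L_star_def by (auto intro: mem_exponentI)


section \<open>Discrepancies\<close>

text \<open>
  All are \<open>ennreal\<close>-valued, since they can be infinite. In HOL \<open>x / 0 = 0\<close> and \<open>ln 0 = 0\<close>, so the
  value \<open>\<infinity>\<close> of an integrand at a zero of one of the two densities is put in by hand.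
\<close>

definition KL_inf :: "(real \<Rightarrow> real) \<Rightarrow> (real \<Rightarrow> real) \<Rightarrow> ennreal" where
  "KL_inf f0 f = ennreal (1 / pi) * (\<integral>\<^sup>+v\<in>{-pi..pi}.
     (if 0 < f0 v \<and> 0 < f v then ennreal (f0 v / f v - 1 - ln (f0 v / f v)) else \<infinity>) \<partial>lborel)"

definition d_disc :: "(real \<Rightarrow> real) \<Rightarrow> (real \<Rightarrow> real) \<Rightarrow> ennreal" where
  "d_disc f0 f = min (KL_inf f0 f) (KL_inf f f0)"

definition h_disc :: "(real \<Rightarrow> real) \<Rightarrow> (real \<Rightarrow> real) \<Rightarrow> ennreal" where
  "h_disc f0 f = ennreal (1 / (2 * pi)) * (\<integral>\<^sup>+v\<in>{-pi..pi}.
     (if 0 < f0 v \<and> 0 < f v then ennreal (f0 v / f v + f v / f0 v - 2) else \<infinity>) \<partial>lborel)"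

definition b_disc :: "(real \<Rightarrow> real) \<Rightarrow> (real \<Rightarrow> real) \<Rightarrow> ennreal" where
  "b_disc f1 f = ennreal (1 / (2 * pi)) * (\<integral>\<^sup>+x\<in>{-pi..pi}.
     (if 0 < f x then ennreal ((f1 x / f x - 1)\<^sup>2) else \<infinity>) \<partial>lborel)"

definition A_set :: "(real \<Rightarrow> real) \<Rightarrow> real \<Rightarrow> (real \<Rightarrow> real) set" where
  "A_set f0 \<epsilon> = {f \<in> sdens_tilde_plus. d_disc f f0 \<le> ennreal \<epsilon>}"

text \<open>
  \<open>mean_ratio u v\<close> is \<open>1/(2\<pi>) \<integral> u/v\<close> for nonnegative \<open>u\<close> and \<open>v\<close>; division in \<^typ>\<open>ennreal\<close> gives \<open>\<infinity>\<close>
  where \<open>v\<close> vanishes and \<open>u\<close> does not.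
\<close>

definition mean_ratio :: "(real \<Rightarrow> real) \<Rightarrow> (real \<Rightarrow> real) \<Rightarrow> ennreal" where
  "mean_ratio u v = ennreal (1 / (2 * pi)) *
     (\<integral>\<^sup>+x\<in>{-pi..pi}. ennreal (u x) / ennreal (v x) \<partial>lborel)"

definition log_loss :: "(real \<Rightarrow> real) \<Rightarrow> (real \<Rightarrow> real) \<Rightarrow> ennreal" where
  "log_loss f0 f = (\<integral>\<^sup>+v\<in>{-pi..pi}. ennreal ((ln (f0 v) - ln (f v))\<^sup>2) \<partial>lborel)"


section \<open>Gaussian likelihood and posterior\<close>

text \<open>
  The integral is real because \<open>f\<close> is symmetric. The function \<open>x :: nat \<Rightarrow> real\<close> represents the sample
  \<open>(X\<^sub>1, \<dots>, X\<^sub>n)\<close> as \<open>(x 0, \<dots>, x (n - 1))\<close>.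
\<close>

definition toeplitz :: "nat \<Rightarrow> (real \<Rightarrow> real) \<Rightarrow> real mat" where
  "toeplitz n f = Matrix.mat n n (\<lambda>(j, k).
     Re (set_lebesgue_integral lborel {-pi..pi}
           (\<lambda>v. complex_of_real (f v) * exp (\<i> * of_real ((real j - real k) * v)))))"

definition gauss_lik :: "nat \<Rightarrow> (real \<Rightarrow> real) \<Rightarrow> (nat \<Rightarrow> real) \<Rightarrow> real" where
  "gauss_lik n f x =
     (2 * pi) powr (- real n / 2) * Determinant.det (toeplitz n f) powr (- 1 / 2) *
     exp (- scalar_prod (Matrix.vec n x) (the (mat_inverse (toeplitz n f)) *\<^sub>v Matrix.vec n x) / 2)"

text \<open>
  \<open>gauss_lik n f\<close> is the density of the centered normal distribution with covariance matrix
  \<open>toeplitz n f\<close>, so centering, stationarity and joint normality are all part of this definition.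
\<close>

definition gaussian_process :: "'w measure \<Rightarrow> (nat \<Rightarrow> 'w \<Rightarrow> real) \<Rightarrow> (real \<Rightarrow> real) \<Rightarrow> bool" where
  "gaussian_process \<Omega> X f \<longleftrightarrow> prob_space \<Omega> \<and>
     (\<forall>n. distributed \<Omega> (Pi\<^sub>M {..<n} (\<lambda>_. lborel)) (\<lambda>\<omega>. \<lambda>i\<in>{..<n}. X i \<omega>)
            (\<lambda>x. ennreal (gauss_lik n f x)))"

text \<open>
  A distribution on a set \<open>\<C>\<close> of functions may live on any sigma-algebra on \<open>\<C>\<close> for which the
  evaluations are measurable.
\<close>

definition prior_on :: "(real \<Rightarrow> real) measure \<Rightarrow> (real \<Rightarrow> real) set \<Rightarrow> bool" where
  "prior_on P \<C> \<longleftrightarrow> prob_space P \<and> space P = \<C> \<and>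
     (\<forall>v\<in>freqs. (\<lambda>f. f v) \<in> borel_measurable P)"

definition posterior ::
    "(real \<Rightarrow> real) measure \<Rightarrow> nat \<Rightarrow> (nat \<Rightarrow> real) \<Rightarrow> (real \<Rightarrow> real) measure" where
  "posterior P n x =
     density P (\<lambda>f. ennreal (gauss_lik n f x / (\<integral>g. gauss_lik n g x \<partial>P)))"

definition post_est :: "(real \<Rightarrow> real) measure \<Rightarrow> nat \<Rightarrow> (nat \<Rightarrow> real) \<Rightarrow> real \<Rightarrow> real" where
  "post_est P n x v = exp (\<integral>f. ln (f v) \<partial>posterior P n x)"


section \<open>Conditions on the prior\<close>

definition B_set ::
    "(real \<Rightarrow> real) \<Rightarrow> real \<Rightarrow> real \<Rightarrow> real \<Rightarrow> real \<Rightarrow> real \<Rightarrow> real \<Rightarrow> (real \<Rightarrow> real) set" where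
  "B_set f0 d0 t M m \<gamma> \<epsilon> = {f \<in> F_bar_plus t M m.
     h_disc f0 f \<le> ennreal \<epsilon> \<and> (\<exists>d. mem_exponent f d \<and> 8 * (d0 - d) < \<gamma> - t)}"

definition is_net ::
    "(real \<Rightarrow> real) set \<Rightarrow> (real \<Rightarrow> real) \<Rightarrow> real \<Rightarrow> real \<Rightarrow> real \<Rightarrow> real \<Rightarrow> real
     \<Rightarrow> (real \<Rightarrow> real) set \<Rightarrow> (real \<Rightarrow> real) set \<Rightarrow> bool" where
  "is_net \<C> f0 d0 t \<rho> \<gamma> \<epsilon> F H \<longleftrightarrow>
     finite H \<and> H \<subseteq> {f \<in> \<C>. d_disc f f0 > ennreal (\<epsilon> / 2)} \<and>
     (\<forall>f \<in> F - A_set f0 \<epsilon>. \<forall>d. mem_exponent f d \<longrightarrow>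
        (\<exists>fi\<in>H. \<exists>di. mem_exponent fi di \<and> (\<forall>x\<in>freqs. f x \<le> fi x) \<and> 4 * (di - d) \<le> min \<rho> (1/2) \<and>
           (4 * \<bar>d - d0\<bar> \<le> \<gamma> - t \<longrightarrow>
              mean_ratio (\<lambda>x. fi x - f x) f0 \<le> h_disc f0 fi / 4) \<and>
           (4 * (d - d0) > \<gamma> - t \<longrightarrow>
              mean_ratio (\<lambda>x. (fi x - f x)\<^sup>2) (\<lambda>x. (f x)\<^sup>2) \<le> b_disc f0 fi * ennreal (1 / \<bar>ln \<epsilon>\<bar>)) \<and>
           (4 * (d0 - d) > \<gamma> - t \<longrightarrow>
              mean_ratio (\<lambda>x. (fi x - f x)\<^sup>2) (\<lambda>x. (f0 x)\<^sup>2) \<le> b_disc fi f0 \<and>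
              mean_ratio (\<lambda>x. fi x - f x) f \<le> b_disc fi f0 * ennreal (1 / \<bar>ln \<epsilon>\<bar>))))"

definition is_smallest_net ::
    "(real \<Rightarrow> real) set \<Rightarrow> (real \<Rightarrow> real) \<Rightarrow> real \<Rightarrow> real \<Rightarrow> real \<Rightarrow> real \<Rightarrow> real
     \<Rightarrow> (real \<Rightarrow> real) set \<Rightarrow> (real \<Rightarrow> real) set \<Rightarrow> bool" where
  "is_smallest_net \<C> f0 d0 t \<rho> \<gamma> \<epsilon> F H \<longleftrightarrow> is_net \<C> f0 d0 t \<rho> \<gamma> \<epsilon> F H \<and>
     (\<forall>H'. is_net \<C> f0 d0 t \<rho> \<gamma> \<epsilon> F H' \<longrightarrow> card H \<le> card H')"

end

theory Submission
  imports Defs "HOL-Real_Asymp.Real_Asymp"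
begin

text \<open>
  Schwartz' argument, with exponentially powerful tests that exploit the equicontinuity of the model
  away from the frequency \<open>0\<close>.

  Evidence: let \<open>S\<close> and \<open>T\<close> be the Toeplitz matrices of \<open>f0\<close> and \<open>f\<close>. The Kullback-Leibler divergence is
  governed by the traces of \<open>S * inverse T\<close> and \<open>T * inverse S\<close>. As \<open>4 * pi\<^sup>2 * inverse T\<close> is at most the
  Toeplitz matrix of \<open>1 / f\<close>, these are bounded by Fejer means, so that \<open>h_disc f0 f\<close> bounds the normalized
  divergence in the limit. A small \<open>h_disc f0 f\<close> forces the exponents to be close, whence
  \<open>S \<le> C * sqrt n * T\<close>, and an exponential moment of order \<open>1 / sqrt n\<close> of the log likelihood ratio gives
  summable tail probabilities. By Fubini and Fatou the normalized evidence decays more slowly than any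
  exponential.

  Tests: under long memory empirical covariances concentrate too slowly, but differencing the process
  multiplies the density by \<open>2 - 2 * cos v\<close>, which removes the singularity at \<open>0\<close>. Covariances of the
  differenced process concentrate exponentially fast, uniformly over the model, so the posterior
  concentrates on densities whose differenced covariances at finitely many lags are close to the true
  ones. By Fejer summation and equicontinuity these determine \<open>ln (f v)\<close> at each \<open>v \<noteq> 0\<close>; the loss
  follows by Jensen's inequality and dominated convergence.
\<close>

section \<open>Positive definite matrices\<close>

text \<open>Every probability bound comes from one computation: a Gaussian density times the
  exponential of a quadratic form integrates to the power -1/2 of a determinant, and
  \<open>ln (det A) \<le> trace A - n\<close> replaces determinants by traces. The analytic input is
  thus limited to limits superior of traces and to comparisons of quadratic forms; determinant
  asymptotics and eigenvalues do not enter. The obstacle to the evidence bound is that the tilted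
  matrix \<open>(1 + s) * inverse S - s * inverse T\<close> has to stay positive definite. When the
  exponent of \<open>f0\<close> exceeds that of \<open>f\<close>, no bound of S by a constant
  multiple of T holds for all n; hence s of order \<open>1 / sqrt n\<close> against a gap
  proportional to n, and a tail \<open>exp (- c * sqrt n)\<close>, summable though not exponential.
  It holds for one f at a time, from an index on that may depend on f, which is why Fubini and Fatou
  replace a uniform estimate. For the tests uniformity is essential: since
  \<open>2 - 2 * cos v \<le> v^2\<close>, the differenced densities lie below a bound depending on M
  alone, and the deviation rates depend on a density only through it.\<close>

definition ip :: "nat \<Rightarrow> (nat \<Rightarrow> real) \<Rightarrow> (nat \<Rightarrow> real) \<Rightarrow> real" where
  "ip n x y = (\<Sum>i<n. x i * y i)"

definition mv :: "nat \<Rightarrow> (nat \<Rightarrow> nat \<Rightarrow> real) \<Rightarrow> (nat \<Rightarrow> real) \<Rightarrow> nat \<Rightarrow> real" where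
  "mv n A x i = (\<Sum>j<n. A i j * x j)"

definition bf :: "nat \<Rightarrow> (nat \<Rightarrow> nat \<Rightarrow> real) \<Rightarrow> (nat \<Rightarrow> real) \<Rightarrow> (nat \<Rightarrow> real) \<Rightarrow> real" where
  "bf n A x y = (\<Sum>i<n. \<Sum>j<n. A i j * x i * y j)"

definition qf :: "nat \<Rightarrow> (nat \<Rightarrow> nat \<Rightarrow> real) \<Rightarrow> (nat \<Rightarrow> real) \<Rightarrow> real" where
  "qf n A x = bf n A x x"

definition fdet :: "nat \<Rightarrow> (nat \<Rightarrow> nat \<Rightarrow> real) \<Rightarrow> real" where
  "fdet n A = Determinant.det (Matrix.mat n n (\<lambda>(i, j). A i j))"

definition pos_def :: "nat \<Rightarrow> (nat \<Rightarrow> nat \<Rightarrow> real) \<Rightarrow> bool" where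
  "pos_def n A \<longleftrightarrow> (\<forall>i<n. \<forall>j<n. A i j = A j i) \<and>
     (\<forall>x. (\<exists>i<n. x i \<noteq> 0) \<longrightarrow> 0 < qf n A x)"

text \<open>For symmetric B this is the trace of the product AB; the entrywise form is visibly
  symmetric and bilinear. Matrices are functions on all pairs of naturals, of which only the entries
  below n count.\<close>

definition mtr :: "nat \<Rightarrow> (nat \<Rightarrow> nat \<Rightarrow> real) \<Rightarrow> (nat \<Rightarrow> nat \<Rightarrow> real) \<Rightarrow> real" where
  "mtr n A B = (\<Sum>i<n. \<Sum>j<n. A i j * B i j)"

text \<open>Schur complement of the last diagonal entry, written for symmetric A:
  \<open>A j n\<close> stands where the general formula has \<open>A n j\<close>.\<close>

definition schur :: "nat \<Rightarrow> (nat \<Rightarrow> nat \<Rightarrow> real) \<Rightarrow> nat \<Rightarrow> nat \<Rightarrow> real" where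
  "schur n A i j = A i j - A i n * A j n / A n n"

lemma pos_def_sym: "pos_def n A \<Longrightarrow> i < n \<Longrightarrow> j < n \<Longrightarrow> A i j = A j i"
  by (auto simp: pos_def_def)

lemma qf_pos: "pos_def n A \<Longrightarrow> i < n \<Longrightarrow> x i \<noteq> 0 \<Longrightarrow> 0 < qf n A x"
  by (auto simp: pos_def_def)

lemma qf_zero: "(\<And>i. i < n \<Longrightarrow> x i = 0) \<Longrightarrow> qf n A x = 0"
  by (simp add: qf_def bf_def)

lemma qf_nonneg: "pos_def n A \<Longrightarrow> 0 \<le> qf n A x"
  by (cases "\<exists>i<n. x i \<noteq> 0") (auto simp: qf_zero dest: qf_pos intro: less_imp_le)

lemma bf_ip: "bf n A x y = ip n x (mv n A y)"
  by (simp add: bf_def ip_def mv_def sum_distrib_left mult_ac)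

lemma ip_commute: "ip n x y = ip n y x"
  by (simp add: ip_def mult.commute)

lemma ip_cong: "(\<And>i. i < n \<Longrightarrow> y i = z i) \<Longrightarrow> ip n x y = ip n x z"
  by (simp add: ip_def)

lemma bf_commute:
  assumes "pos_def n A"
  shows "bf n A x y = bf n A y x"
proof -
  have "bf n A x y = (\<Sum>j<n. \<Sum>i<n. A i j * x i * y j)"
    unfolding bf_def by (rule sum.swap)
  also have "\<dots> = bf n A y x"
    unfolding bf_def by (intro sum.cong refl) (use assms in \<open>auto simp: pos_def_def\<close>)
  finally show ?thesis .
qed

section \<open>Schur complements and determinants\<close>

lemma pos_def_diag:
  assumes "pos_def n A" "i < n"
  shows "0 < A i i"
proof -
  have "qf n A (\<lambda>j. if j = i then 1 else 0) = (\<Sum>k<n. if k = i then A i i else 0)"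
    unfolding qf_def bf_def by (intro sum.cong refl) (use assms(2) in \<open>auto simp: if_distrib cong: if_cong\<close>)
  also have "\<dots> = A i i"
    using assms(2) by simp
  finally show ?thesis
    using qf_pos[OF assms, of "\<lambda>j. if j = i then 1 else 0"] by simp
qed

text \<open>Completing the square in the last coordinate; the Schur complement is what remains of
  the form in the first n coordinates. Determinant, Cholesky factor and Gaussian integral are all
  obtained by recursion along this elimination.\<close>

lemma qf_Suc:
  assumes sym: "\<forall>i<Suc n. \<forall>j<Suc n. A i j = A j i" and c: "A n n \<noteq> 0"
  shows "qf (Suc n) A x = qf n (schur n A) x + A n n * (x n + (\<Sum>i<n. A i n * x i) / A n n)\<^sup>2"
proof -
  define b where "b = (\<Sum>i<n. A i n * x i)"
  have b2: "b\<^sup>2 = (\<Sum>i<n. \<Sum>j<n. (A i n * A j n) * x i * x j)"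
    unfolding b_def power2_eq_square sum_product by (simp add: mult_ac)
  have s: "(\<Sum>j<n. A n j * x n * x j) = x n * b"
    unfolding b_def sum_distrib_left using sym by (intro sum.cong) auto
  have "qf (Suc n) A x = (\<Sum>i<n. (\<Sum>j<n. A i j * x i * x j) + A i n * x i * x n)
      + (x n * b + A n n * x n * x n)"
    unfolding qf_def bf_def by (simp add: s)
  also have "(\<Sum>i<n. (\<Sum>j<n. A i j * x i * x j) + A i n * x i * x n)
      = (\<Sum>i<n. \<Sum>j<n. A i j * x i * x j) + x n * b"
    unfolding b_def by (simp add: sum.distrib sum_distrib_left mult_ac)
  also have "(\<Sum>i<n. \<Sum>j<n. A i j * x i * x j) = qf n (schur n A) x + b\<^sup>2 / A n n"
    unfolding qf_def bf_def schur_def b2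
    by (simp add: sum_divide_distrib sum.distrib[symmetric] algebra_simps)
  finally show ?thesis
    unfolding b_def[symmetric] using c by (simp add: field_simps power2_eq_square)
qed

lemma qf_cong: "(\<And>i. i < n \<Longrightarrow> x i = y i) \<Longrightarrow> qf n A x = qf n A y"
  by (simp add: qf_def bf_def)

lemma pos_def_schur:
  assumes "pos_def (Suc n) A"
  shows "pos_def n (schur n A)"
  unfolding pos_def_def
proof (intro conjI allI impI)
  fix i j assume "i < n" "j < n"
  thus "schur n A i j = schur n A j i"
    using pos_def_sym[OF assms, of i j] by (simp add: schur_def)
next
  fix x :: "nat \<Rightarrow> real" assume x: "\<exists>i<n. x i \<noteq> 0"
  then obtain i where i: "i < n" "x i \<noteq> 0" by blast
  have c: "0 < A n n" using pos_def_diag[OF assms] by simp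
  \<comment> \<open>The last coordinate minimizes the form for the given first n coordinates, so
    that the square in \<open>qf_Suc\<close> vanishes.\<close>
  define y where "y = x(n := - (\<Sum>i<n. A i n * x i) / A n n)"
  have "0 < qf (Suc n) A y"
    using i by (intro qf_pos[OF assms, of i]) (auto simp: y_def)
  also have "\<dots> = qf n (schur n A) y + A n n * (y n + (\<Sum>i<n. A i n * y i) / A n n)\<^sup>2"
    using assms c by (intro qf_Suc) (auto simp: pos_def_def)
  also have "(\<Sum>i<n. A i n * y i) = (\<Sum>i<n. A i n * x i)"
    by (simp add: y_def)
  also have "qf n (schur n A) y = qf n (schur n A) x"
    by (intro qf_cong) (auto simp: y_def)
  finally show "0 < qf n (schur n A) x"
    using c by (simp add: y_def)
qed

text \<open>One step of block elimination: A = UV with U unit upper triangular and V block lower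
  triangular with diagonal blocks \<open>schur n A\<close> and \<open>A n n\<close>.\<close>

lemma fdet_schur:
  assumes sym: "\<forall>i<Suc n. \<forall>j<Suc n. A i j = A j i" and c: "A n n \<noteq> 0"
  shows "fdet (Suc n) A = A n n * fdet n (schur n A)"
proof -
  let ?S = "Matrix.mat n n (\<lambda>(i, j). schur n A i j)"
  let ?b = "Matrix.mat n 1 (\<lambda>(i, j). A i n / A n n)"
  let ?r = "Matrix.mat 1 n (\<lambda>(i, j). A n j)"
  let ?c = "Matrix.mat 1 1 (\<lambda>(i, j). A n n)"
  let ?U = "four_block_mat (1\<^sub>m n) ?b (0\<^sub>m 1 n) (1\<^sub>m 1)"
  let ?V = "four_block_mat ?S (0\<^sub>m n 1) ?r ?c"
  have UV: "?U * ?V = four_block_mat (1\<^sub>m n * ?S + ?b * ?r) (1\<^sub>m n * 0\<^sub>m n 1 + ?b * ?c)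
      (0\<^sub>m 1 n * ?S + 1\<^sub>m 1 * ?r) (0\<^sub>m 1 n * 0\<^sub>m n 1 + 1\<^sub>m 1 * ?c)"
    by (rule mult_four_block_mat) auto
  have "Matrix.mat (Suc n) (Suc n) (\<lambda>(i, j). A i j) = ?U * ?V"
    unfolding UV
  proof (rule eq_matI)
    fix i j
    assume "i < dim_row (four_block_mat (1\<^sub>m n * ?S + ?b * ?r) (1\<^sub>m n * 0\<^sub>m n 1 + ?b * ?c)
      (0\<^sub>m 1 n * ?S + 1\<^sub>m 1 * ?r) (0\<^sub>m 1 n * 0\<^sub>m n 1 + 1\<^sub>m 1 * ?c))"
      "j < dim_col (four_block_mat (1\<^sub>m n * ?S + ?b * ?r) (1\<^sub>m n * 0\<^sub>m n 1 + ?b * ?c)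
      (0\<^sub>m 1 n * ?S + 1\<^sub>m 1 * ?r) (0\<^sub>m 1 n * 0\<^sub>m n 1 + 1\<^sub>m 1 * ?c))"
    hence ij: "i < Suc n" "j < Suc n" by auto
    have "A n j = A j n" using sym ij by auto
    thus "Matrix.mat (Suc n) (Suc n) (\<lambda>(i, j). A i j) $$ (i, j) = four_block_mat (1\<^sub>m n * ?S + ?b * ?r) (1\<^sub>m n * 0\<^sub>m n 1 + ?b * ?c)
      (0\<^sub>m 1 n * ?S + 1\<^sub>m 1 * ?r) (0\<^sub>m 1 n * 0\<^sub>m n 1 + 1\<^sub>m 1 * ?c) $$ (i, j)"
      using ij c by (cases "i = n"; cases "j = n") (auto simp: scalar_prod_def schur_def)
  qed auto
  hence "fdet (Suc n) A = Determinant.det ?U * Determinant.det ?V"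
    unfolding fdet_def by (subst det_mult[symmetric, of _ "Suc n"]) auto
  also have "Determinant.det ?U = 1"
    by (subst det_four_block_mat_lower_left_zero[of _ n _ 1]) auto
  also have "Determinant.det ?V = fdet n (schur n A) * A n n"
    unfolding fdet_def
    by (subst det_four_block_mat_upper_right_zero[of _ n _ 1]) (auto simp: det_single)
  finally show ?thesis by simp
qed

lemma pos_def_fdet_Suc:
  assumes "pos_def (Suc n) A"
  shows "fdet (Suc n) A = A n n * fdet n (schur n A)"
  using assms pos_def_diag[OF assms, of n] by (intro fdet_schur) (auto simp: pos_def_def)

lemma fdet_0 [simp]: "fdet 0 A = 1"
  by (simp add: fdet_def)

lemma pos_def_fdet_pos: "pos_def n A \<Longrightarrow> 0 < fdet n A"
proof (induction n arbitrary: A)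
  case (Suc n)
  show ?case
    using Suc.IH[OF pos_def_schur[OF Suc.prems]] pos_def_diag[OF Suc.prems, of n]
    by (simp add: pos_def_fdet_Suc[OF Suc.prems])
qed simp

text \<open>The arithmetic-geometric mean inequality for eigenvalues, obtained without
  diagonalization: each pivot satisfies \<open>A n n \<le> exp (A n n - 1)\<close>, and passing to
  the Schur complement can only lower the remaining diagonal entries.\<close>

lemma pos_def_fdet_le: "pos_def n A \<Longrightarrow> fdet n A \<le> exp ((\<Sum>i<n. A i i) - real n)"
proof (induction n arbitrary: A)
  case (Suc n)
  have c: "0 < A n n" using pos_def_diag[OF Suc.prems] by simp
  have "fdet (Suc n) A \<le> exp (A n n - 1) * exp ((\<Sum>i<n. schur n A i i) - real n)"
    unfolding pos_def_fdet_Suc[OF Suc.prems]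
    using Suc.IH[OF pos_def_schur[OF Suc.prems]] pos_def_fdet_pos[OF pos_def_schur[OF Suc.prems]]
      exp_ge_add_one_self[of "A n n - 1"]
    by (intro mult_mono) auto
  also have "\<dots> \<le> exp (A n n - 1) * exp ((\<Sum>i<n. A i i) - real n)"
    using c by (intro mult_left_mono) (auto intro!: sum_mono simp: schur_def)
  also have "\<dots> = exp ((\<Sum>i<Suc n. A i i) - real (Suc n))"
    by (simp add: exp_add[symmetric] algebra_simps)
  finally show ?case .
qed simp

section \<open>Factorization into squares, traces and the Loewner order\<close>

lemma cholesky:
  assumes "pos_def n A"
  shows "\<exists>M. \<forall>i<n. \<forall>j<n. A i j = (\<Sum>k<n. M k i * M k j)"
  using assms
proof (induction n arbitrary: A)
  case (Suc n)
  have c: "0 < A n n" using pos_def_diag[OF Suc.prems] by simp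
  obtain M where M: "\<forall>i<n. \<forall>j<n. schur n A i j = (\<Sum>k<n. M k i * M k j)"
    using Suc.IH[OF pos_def_schur[OF Suc.prems]] by blast
  \<comment> \<open>Row n carries the pivot column divided by the root of the pivot; the rows below
    n factor the Schur complement and get a zero in column n. Thus A is the transpose of M' times
    M'.\<close>
  define M' where "M' = (\<lambda>k i. if k = n then A i n / sqrt (A n n) else if i = n then 0 else M k i)"
  have "A i j = (\<Sum>k<Suc n. M' k i * M' k j)" if ij: "i < Suc n" "j < Suc n" for i j
  proof -
    have "(\<Sum>k<Suc n. M' k i * M' k j) = (\<Sum>k<n. if i = n \<or> j = n then 0 else M k i * M k j)
        + A i n * A j n / A n n"
      using c by (auto simp: M'_def intro!: sum.cong)
    also have "\<dots> = A i j"
    proof (cases "i = n \<or> j = n")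
      case True
      thus ?thesis using c pos_def_sym[OF Suc.prems, of j n] ij by auto
    next
      case False
      hence "(\<Sum>k<n. M k i * M k j) = schur n A i j" using M ij by auto
      thus ?thesis using False by (simp add: schur_def)
    qed
    finally show ?thesis by simp
  qed
  thus ?case by blast
qed simp

lemma bf_squares:
  assumes "\<forall>i<n. \<forall>j<n. A i j = (\<Sum>k<N. M k i * M k j)"
  shows "bf n A x y = (\<Sum>k<N. ip n (M k) x * ip n (M k) y)"
proof -
  have "bf n A x y = (\<Sum>i<n. \<Sum>j<n. \<Sum>k<N. M k i * x i * (M k j * y j))"
    unfolding bf_def using assms
    by (intro sum.cong refl) (simp add: sum_distrib_left sum_distrib_right mult_ac)
  also have "\<dots> = (\<Sum>k<N. \<Sum>i<n. \<Sum>j<n. M k i * x i * (M k j * y j))"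
    by (subst sum.swap[of _ _ "{..<N}"]) (simp add: sum.swap[of _ _ "{..<N}"])
  also have "\<dots> = (\<Sum>k<N. ip n (M k) x * ip n (M k) y)"
    by (simp add: ip_def sum_product)
  finally show ?thesis .
qed

lemma mtr_squares:
  assumes "\<forall>i<n. \<forall>j<n. A i j = (\<Sum>k<N. M k i * M k j)"
  shows "mtr n A B = (\<Sum>k<N. qf n B (M k))"
proof -
  have "mtr n A B = (\<Sum>i<n. \<Sum>j<n. \<Sum>k<N. B i j * M k i * M k j)"
    unfolding mtr_def using assms
    by (intro sum.cong refl) (simp add: sum_distrib_left sum_distrib_right mult_ac)
  also have "\<dots> = (\<Sum>k<N. \<Sum>i<n. \<Sum>j<n. B i j * M k i * M k j)"
    by (subst sum.swap[of _ _ "{..<N}"]) (simp add: sum.swap[of _ _ "{..<N}"])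
  finally show ?thesis by (simp add: qf_def bf_def)
qed

text \<open>With A a sum of squares of linear forms with coefficient rows \<open>M k\<close>, the
  trace against A is the sum of the values of the other form at these rows, so inequalities between
  quadratic forms pass to traces.\<close>

lemma mtr_mono:
  assumes "pos_def n A" "\<And>x. qf n B x \<le> c * qf n C x"
  shows "mtr n A B \<le> c * mtr n A C"
proof -
  obtain M where M: "\<forall>i<n. \<forall>j<n. A i j = (\<Sum>k<n. M k i * M k j)"
    using cholesky[OF assms(1)] by blast
  show ?thesis
    unfolding mtr_squares[OF M] sum_distrib_left by (intro sum_mono assms(2))
qed

lemma bf_cauchy_schwarz:
  assumes "pos_def n A"
  shows "(bf n A x y)\<^sup>2 \<le> qf n A x * qf n A y"
proof -
  obtain M where M: "\<forall>i<n. \<forall>j<n. A i j = (\<Sum>k<n. M k i * M k j)"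
    using cholesky[OF assms] by blast
  show ?thesis
    unfolding qf_def bf_squares[OF M]
    using Cauchy_Schwarz_ineq_sum[of "\<lambda>k. ip n (M k) x" "\<lambda>k. ip n (M k) y" "{..<n}"]
    by (simp add: power2_eq_square)
qed

section \<open>Inverse matrices\<close>

definition finv :: "nat \<Rightarrow> (nat \<Rightarrow> nat \<Rightarrow> real) \<Rightarrow> nat \<Rightarrow> nat \<Rightarrow> real" where
  "finv n A i j = adj_mat (Matrix.mat n n (\<lambda>(i, j). A i j)) $$ (i, j) / fdet n A"

lemma finv_mat:
  assumes "fdet n A \<noteq> 0"
  shows "Matrix.mat n n (\<lambda>(i, j). A i j) * Matrix.mat n n (\<lambda>(i, j). finv n A i j) = 1\<^sub>m n"
    and "Matrix.mat n n (\<lambda>(i, j). finv n A i j) * Matrix.mat n n (\<lambda>(i, j). A i j) = 1\<^sub>m n"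
proof -
  let ?A = "Matrix.mat n n (\<lambda>(i, j). A i j)"
  let ?B = "Matrix.mat n n (\<lambda>(i, j). finv n A i j)"
  have A: "?A \<in> carrier_mat n n" by simp
  have B: "?B = (1 / fdet n A) \<cdot>\<^sub>m adj_mat ?A"
    using adj_mat(1)[OF A] by (intro eq_matI) (auto simp: finv_def)
  have one: "a \<cdot>\<^sub>m (b \<cdot>\<^sub>m 1\<^sub>m n) = (a * b) \<cdot>\<^sub>m 1\<^sub>m n" for a b :: real
    by (intro eq_matI) auto
  have one': "1 \<cdot>\<^sub>m 1\<^sub>m n = (1\<^sub>m n :: real mat)"
    by (intro eq_matI) auto
  show "?A * ?B = 1\<^sub>m n" "?B * ?A = 1\<^sub>m n"
    unfolding B using adj_mat[OF A] assms
    by (auto simp: mult_smult_distrib[OF A] mult_smult_assoc_mat[OF _ A] fdet_def one one')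
qed

lemma mv_mult:
  "mv n A (mv n B x) i = (\<Sum>j<n. (\<Sum>k<n. A i k * B k j) * x j)"
  unfolding mv_def sum_distrib_left sum_distrib_right
  by (subst sum.swap) (simp add: mult_ac)

lemma mat_mult_one:
  assumes "Matrix.mat n n (\<lambda>(i, j). A i j) * Matrix.mat n n (\<lambda>(i, j). B i j) = 1\<^sub>m n" "i < n" "j < n"
  shows "(\<Sum>k<n. A i k * B k j) = (if i = j then 1 else (0::real))"
proof -
  have "(\<Sum>k<n. A i k * B k j) =
      (Matrix.mat n n (\<lambda>(i, j). A i j) * Matrix.mat n n (\<lambda>(i, j). B i j)) $$ (i, j)"
    using assms(2,3) by (simp add: scalar_prod_def atLeast0LessThan)
  also have "\<dots> = (if i = j then 1 else 0)"
    unfolding assms(1) using assms(2,3) by simp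
  finally show ?thesis .
qed

text \<open>Asks only that A after B is the identity on the first n coordinates. Keeping the inverse
  abstract lets a lemma be applied to a matrix and its inverse in either role, without identifying
  \<open>finv n (finv n A)\<close> with A.\<close>

definition inv_pair :: "nat \<Rightarrow> (nat \<Rightarrow> nat \<Rightarrow> real) \<Rightarrow> (nat \<Rightarrow> nat \<Rightarrow> real) \<Rightarrow> bool" where
  "inv_pair n A B \<longleftrightarrow> (\<forall>x. \<forall>i<n. mv n A (mv n B x) i = x i)"

lemma inv_pairI:
  assumes "Matrix.mat n n (\<lambda>(i, j). A i j) * Matrix.mat n n (\<lambda>(i, j). B i j) = 1\<^sub>m n"
  shows "inv_pair n A B"
  unfolding inv_pair_def mv_mult
  using mat_mult_one[OF assms] by (auto simp: if_distrib[of "\<lambda>c. c * _"] cong: if_cong)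

lemma inv_pair_finv:
  assumes "pos_def n A"
  shows "inv_pair n A (finv n A)" "inv_pair n (finv n A) A"
  using finv_mat[of n A] pos_def_fdet_pos[OF assms] by (auto intro: inv_pairI)

lemma ip_pair: "inv_pair n A B \<Longrightarrow> ip n x (mv n A (mv n B y)) = ip n x y"
  by (auto simp: inv_pair_def intro: ip_cong)

lemma qf_inverse:
  assumes "pos_def n A" "inv_pair n A B"
  shows "bf n A (mv n B x) (mv n B y) = bf n B y x" "bf n A x (mv n B y) = ip n x y"
    "qf n A (mv n B x) = qf n B x"
  by (auto simp: qf_def bf_ip ip_pair[OF assms(2)] ip_commute[of n "mv n B _"])

lemma bf_unit:
  assumes "i < n" "j < n"
  shows "bf n A (\<lambda>k. if k = i then 1 else 0) (\<lambda>k. if k = j then 1 else 0) = A i j"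
proof -
  have "bf n A (\<lambda>k. if k = i then 1 else 0) (\<lambda>k. if k = j then 1 else 0)
      = (\<Sum>k<n. if k = i then A i j else 0)"
    unfolding bf_def by (intro sum.cong refl) (use assms in \<open>auto simp: if_distrib cong: if_cong\<close>)
  thus ?thesis using assms by simp
qed

lemma pos_def_inverse:
  assumes "pos_def n A" "inv_pair n A B"
  shows "pos_def n B"
  unfolding pos_def_def
proof (intro conjI allI impI)
  fix i j assume ij: "i < n" "j < n"
  let ?e = "\<lambda>i k. if k = i then 1 else (0::real)"
  have "bf n B (?e i) (?e j) = bf n B (?e j) (?e i)"
    using qf_inverse(1)[OF assms] bf_commute[OF assms(1)] by metis
  thus "B i j = B j i" using ij by (simp add: bf_unit)
next
  fix x :: "nat \<Rightarrow> real" assume "\<exists>i<n. x i \<noteq> 0"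
  then obtain i where i: "i < n" "x i \<noteq> 0" by blast
  have "\<exists>j<n. mv n B x j \<noteq> 0"
  proof (rule ccontr)
    assume "\<not> ?thesis"
    hence "mv n A (mv n B x) i = 0" by (simp add: mv_def[of n A])
    thus False using i assms(2) by (simp add: inv_pair_def)
  qed
  hence "0 < qf n A (mv n B x)" using assms(1) by (auto simp: pos_def_def)
  thus "0 < qf n B x" by (simp add: qf_inverse(3)[OF assms])
qed

lemma pos_def_finv: "pos_def n A \<Longrightarrow> pos_def n (finv n A)"
  using pos_def_inverse inv_pair_finv(1) by blast

lemma fdet_finv: "pos_def n A \<Longrightarrow> fdet n A * fdet n (finv n A) = 1"
  using finv_mat(1)[of n A] pos_def_fdet_pos[of n A] unfolding fdet_def
  by (subst det_mult[symmetric, of _ n]) auto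

lemma ip_sq_le:
  assumes "pos_def n A" "inv_pair n A B"
  shows "(ip n x y)\<^sup>2 \<le> qf n A x * qf n B y"
  using bf_cauchy_schwarz[OF assms(1), of x "mv n B y"]
  by (simp only: qf_inverse(2,3)[OF assms])

text \<open>Inversion reverses the Loewner order. Put y = Y'x. The product of y and x, the Y'-form
  of x and the Y-form of y are the same number q, and Cauchy-Schwarz for the pair X, X' gives
  \<open>q^2 \<le> (c * q) * qf n X' x\<close>.\<close>

lemma qf_inverse_antitone:
  assumes "pos_def n X" "inv_pair n X X'" "pos_def n Y" "inv_pair n Y Y'"
    and le: "\<And>z. qf n X z \<le> c * qf n Y z"
  shows "qf n Y' x \<le> c * qf n X' x"
proof (cases "qf n Y' x = 0")
  case True
  have "\<not> (\<exists>i<n. x i \<noteq> 0)"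
    using pos_def_inverse[OF assms(3,4)] True by (auto simp: pos_def_def)
  thus ?thesis by (simp add: qf_zero)
next
  case False
  hence pos: "0 < qf n Y' x"
    using qf_nonneg[OF pos_def_inverse[OF assms(3,4)], of x] by linarith
  have "(qf n Y' x)\<^sup>2 = (ip n (mv n Y' x) x)\<^sup>2"
    by (simp add: qf_def bf_ip ip_commute[of n x])
  also have "\<dots> \<le> qf n X (mv n Y' x) * qf n X' x"
    by (rule ip_sq_le[OF assms(1,2)])
  also have "\<dots> \<le> (c * qf n Y (mv n Y' x)) * qf n X' x"
    by (intro mult_right_mono le qf_nonneg pos_def_inverse[OF assms(1,2)])
  also have "qf n Y (mv n Y' x) = qf n Y' x"
    by (rule qf_inverse(3)[OF assms(3,4)])
  finally show ?thesis
    using pos by (simp add: power2_eq_square mult_ac)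
qed

text \<open>Writing the inverse of D as M^T M, the trace bound \<open>pos_def_fdet_le\<close>
  applies to M A M^T, whose determinant is det A / det D and whose trace is that of A times the
  inverse of D. All determinant estimates below come from here.\<close>

lemma fdet_ratio_le:
  assumes A: "pos_def n A" and D: "pos_def n D"
  shows "fdet n A \<le> fdet n D * exp (mtr n A (finv n D) - real n)"
proof -
  define E where "E = finv n D"
  have E: "pos_def n E" unfolding E_def by (rule pos_def_finv[OF D])
  obtain M where M: "\<forall>i<n. \<forall>j<n. E i j = (\<Sum>k<n. M k i * M k j)"
    using cholesky[OF E] by blast
  let ?m = "\<lambda>A. Matrix.mat n n (\<lambda>(i, j). A i j)"
  define A' where "A' = (\<lambda>k l. bf n A (M k) (M l))"
  have EM: "?m E = transpose_mat (?m M) * ?m M"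
    using M by (intro eq_matI) (auto simp: scalar_prod_def atLeast0LessThan)
  have detE: "fdet n E = (fdet n M)\<^sup>2"
    unfolding fdet_def EM by (subst det_mult[of _ n]) (auto simp: det_transpose[of _ n] power2_eq_square)
  have A'M: "?m A' = ?m M * ?m A * transpose_mat (?m M)"
  proof (rule eq_matI)
    fix i j assume "i < dim_row (?m M * ?m A * transpose_mat (?m M))"
      "j < dim_col (?m M * ?m A * transpose_mat (?m M))"
    hence ij: "i < n" "j < n" by auto
    have "(?m M * ?m A * transpose_mat (?m M)) $$ (i, j) = (\<Sum>l<n. (\<Sum>k<n. M i k * A k l) * M j l)"
      using ij by (simp add: scalar_prod_def atLeast0LessThan)
    also have "\<dots> = (\<Sum>k<n. \<Sum>l<n. A k l * M i k * M j l)"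
      unfolding sum_distrib_right by (subst sum.swap) (simp add: mult_ac)
    finally show "?m A' $$ (i, j) = (?m M * ?m A * transpose_mat (?m M)) $$ (i, j)"
      using ij by (simp add: A'_def bf_def)
  qed auto
  have "Determinant.det (?m M * ?m A * transpose_mat (?m M))
      = Determinant.det (?m M * ?m A) * Determinant.det (transpose_mat (?m M))"
    by (rule det_mult[of _ n]) auto
  also have "Determinant.det (?m M * ?m A) = Determinant.det (?m M) * Determinant.det (?m A)"
    by (rule det_mult[of _ n]) auto
  also have "Determinant.det (transpose_mat (?m M)) = Determinant.det (?m M)"
    by (rule det_transpose[of _ n]) auto
  finally have detA': "fdet n A' = fdet n A * fdet n E"
    unfolding detE unfolding fdet_def A'M by (simp add: power2_eq_square)
  have "fdet n M \<noteq> 0" using detE pos_def_fdet_pos[OF E] by auto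
  \<comment> \<open>M is nonsingular, so no nonzero combination of its rows vanishes; this transfers
    positive definiteness from A to \<open>A'\<close>.\<close>
  hence inj: "\<exists>l<n. (\<Sum>k<n. x k * M k l) \<noteq> 0" if "\<exists>i<n. x i \<noteq> 0" for x :: "nat \<Rightarrow> real"
  proof (rule contrapos_np)
    assume neg: "\<not> ?thesis"
    have "transpose_mat (?m M) *\<^sub>v Matrix.vec n x = 0\<^sub>v n"
      using neg by (intro eq_vecI) (auto simp: scalar_prod_def atLeast0LessThan mult.commute)
    moreover have "Matrix.vec n x \<noteq> 0\<^sub>v n"
      using that by (auto simp: vec_eq_iff)
    ultimately have "Determinant.det (transpose_mat (?m M)) = 0"
      by (subst det_0_iff_vec_prod_zero[of _ n]) (auto intro!: exI[of _ "Matrix.vec n x"])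
    thus "fdet n M = 0" by (simp add: fdet_def det_transpose[of _ n])
  qed
  have qA': "qf n A' x = qf n A (\<lambda>l. \<Sum>k<n. x k * M k l)" for x
  proof -
    have "qf n A (\<lambda>l. \<Sum>k<n. x k * M k l)
        = (\<Sum>i<n. \<Sum>j<n. \<Sum>k<n. \<Sum>l<n. A i j * (x k * M k i) * (x l * M l j))"
      by (simp add: qf_def bf_def sum_distrib_left sum_distrib_right mult_ac)
    also have "\<dots> = (\<Sum>i<n. \<Sum>k<n. \<Sum>j<n. \<Sum>l<n. A i j * (x k * M k i) * (x l * M l j))"
      by (intro sum.cong refl sum.swap)
    also have "\<dots> = (\<Sum>k<n. \<Sum>i<n. \<Sum>l<n. \<Sum>j<n. A i j * (x k * M k i) * (x l * M l j))"
      by (subst sum.swap) (intro sum.cong refl sum.swap)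
    also have "\<dots> = (\<Sum>k<n. \<Sum>l<n. \<Sum>i<n. \<Sum>j<n. A i j * (x k * M k i) * (x l * M l j))"
      by (intro sum.cong refl sum.swap)
    also have "\<dots> = qf n A' x"
      by (simp add: qf_def bf_def A'_def sum_distrib_left sum_distrib_right mult_ac)
    finally show ?thesis by simp
  qed
  have "pos_def n A'"
    unfolding pos_def_def qA'
    using inj A bf_commute[OF A] by (auto simp: A'_def pos_def_def)
  from pos_def_fdet_le[OF this]
  have "fdet n A * fdet n E \<le> exp ((\<Sum>k<n. A' k k) - real n)"
    by (simp add: detA')
  also have "(\<Sum>k<n. A' k k) = mtr n E A"
    by (simp add: mtr_squares[OF M] A'_def qf_def)
  also have "mtr n E A = mtr n A E"
    by (simp add: mtr_def mult.commute)
  finally have "fdet n D * (fdet n A * fdet n E) \<le> fdet n D * exp (mtr n A E - real n)"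
    using pos_def_fdet_pos[OF D] by (intro mult_left_mono) auto
  moreover have "fdet n D * (fdet n A * fdet n E) = fdet n A"
    using fdet_finv[OF D] unfolding E_def by (simp add: mult_ac)
  ultimately show ?thesis unfolding E_def by simp
qed

text \<open>The likelihood is stated with Gauss-Jordan elimination, whose result is opaque as a
  function of the entries; the adjugate formula in \<open>finv\<close> is rational in them, which
  later gives measurability in the density.\<close>

lemma mat_inverse_eq:
  assumes "pos_def n A"
  shows "the (mat_inverse (Matrix.mat n n (\<lambda>(i, j). A i j))) = Matrix.mat n n (\<lambda>(i, j). finv n A i j)"
proof -
  let ?m = "\<lambda>A. Matrix.mat n n (\<lambda>(i, j). A i j)"
  have A: "?m A \<in> carrier_mat n n" by simp
  note f = finv_mat[of n A]
  have nz: "fdet n A \<noteq> 0" using pos_def_fdet_pos[OF assms] by simp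
  obtain B where B: "mat_inverse (?m A) = Some B"
  proof (cases "mat_inverse (?m A)")
    case None
    from mat_inverse(1)[OF A this] show ?thesis
      using f[OF nz] by (auto simp: Units_def ring_mat_def)
  qed
  from mat_inverse(2)[OF A B] have "?m A * B = 1\<^sub>m n" "B * ?m A = 1\<^sub>m n" "B \<in> carrier_mat n n"
    by auto
  hence "B = B * (?m A * ?m (finv n A))"
    using f[OF nz] by simp
  also have "\<dots> = ?m (finv n A)"
    using \<open>B * ?m A = 1\<^sub>m n\<close> \<open>B \<in> carrier_mat n n\<close>
    by (subst assoc_mult_mat[symmetric, of _ n n _ n _ n]) auto
  finally show ?thesis using B by simp
qed

lemma scalar_prod_qf:
  "scalar_prod (Matrix.vec n x) (Matrix.mat n n (\<lambda>(i, j). B i j) *\<^sub>v Matrix.vec n x) = qf n B x"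
  by (simp add: scalar_prod_def qf_def bf_def atLeast0LessThan sum_distrib_left mult_ac)

section \<open>Gaussian integrals\<close>

abbreviation Ln :: "nat \<Rightarrow> (nat \<Rightarrow> real) measure" where
  "Ln n \<equiv> Pi\<^sub>M {..<n} (\<lambda>_. lborel)"

lemma nn_integral_gauss:
  assumes "0 < c"
  shows "(\<integral>\<^sup>+y. ennreal (exp (- (c * (y + b)\<^sup>2 / 2))) \<partial>lborel) = ennreal (sqrt (2 * pi / c))"
proof -
  define s where "s = 1 / sqrt c"
  have s: "0 < s" using assms by (simp add: s_def)
  interpret prob_space "density lborel (normal_density (- b) s)"
    by (rule prob_space_normal_density[OF s])
  have n1: "(\<integral>\<^sup>+y. ennreal (normal_density (- b) s y) \<partial>lborel) = 1"
    using emeasure_space_1 by (simp add: emeasure_density)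
  have "exp (- (c * (y + b)\<^sup>2 / 2)) = sqrt (2 * pi / c) * normal_density (- b) s y" for y
    using assms by (simp add: normal_density_def s_def power_divide real_sqrt_mult real_sqrt_divide field_simps)
  hence "(\<integral>\<^sup>+y. ennreal (exp (- (c * (y + b)\<^sup>2 / 2))) \<partial>lborel)
      = (\<integral>\<^sup>+y. ennreal (sqrt (2 * pi / c)) * ennreal (normal_density (- b) s y) \<partial>lborel)"
    using assms by (simp add: ennreal_mult)
  also have "\<dots> = ennreal (sqrt (2 * pi / c))"
    by (subst nn_integral_cmult) (auto simp: n1)
  finally show ?thesis .
qed

lemma measurable_qf [measurable]:
  "qf n A \<in> borel_measurable (Ln n)"
  unfolding qf_def bf_def
  by (intro borel_measurable_sum borel_measurable_times borel_measurable_const)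
     (auto intro: measurable_component_singleton[of _ _ "\<lambda>_. lborel", simplified])

text \<open>Integrating out the last coordinate, whose square is completed by \<open>qf_Suc\<close>,
  leaves the same integral for the Schur complement and a factor
  \<open>sqrt (2 * pi / A n n)\<close>, one pivot of the determinant.\<close>

lemma nn_integral_gauss_qf:
  assumes "pos_def n A"
  shows "(\<integral>\<^sup>+x. ennreal (exp (- qf n A x / 2)) \<partial>Ln n)
    = ennreal ((2 * pi) powr (real n / 2) * fdet n A powr (- 1 / 2))"
  using assms
proof (induction n arbitrary: A)
  case 0
  thus ?case by (simp add: PiM_empty nn_integral_count_space_finite qf_zero)
next
  case (Suc n)
  interpret product_sigma_finite "\<lambda>_::nat. lborel :: real measure"
    by standard
  have c: "0 < A n n" using pos_def_diag[OF Suc.prems] by simp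
  note S = pos_def_schur[OF Suc.prems]
  have q: "qf (Suc n) A (x(n := y)) = qf n (schur n A) x + A n n * (y + (\<Sum>i<n. A i n * x i) / A n n)\<^sup>2"
    for x y
  proof -
    have "qf n (schur n A) (x(n := y)) = qf n (schur n A) x"
      by (intro qf_cong) auto
    thus ?thesis
      using qf_Suc[of n A "x(n := y)"] Suc.prems c by (auto simp: pos_def_def)
  qed
  have "(\<integral>\<^sup>+x. ennreal (exp (- qf (Suc n) A x / 2)) \<partial>Pi\<^sub>M {..<Suc n} (\<lambda>_. lborel))
      = (\<integral>\<^sup>+x. (\<integral>\<^sup>+y. ennreal (exp (- qf (Suc n) A (x(n := y)) / 2)) \<partial>lborel) \<partial>Ln n)"
    unfolding lessThan_Suc
    by (rule product_nn_integral_insert) (auto simp flip: lessThan_Suc)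
  also have "\<dots> = (\<integral>\<^sup>+x. ennreal (exp (- qf n (schur n A) x / 2)) * ennreal (sqrt (2 * pi / A n n)) \<partial>Ln n)"
  proof (intro nn_integral_cong)
    fix x :: "nat \<Rightarrow> real"
    have "(\<integral>\<^sup>+y. ennreal (exp (- qf (Suc n) A (x(n := y)) / 2)) \<partial>lborel)
        = (\<integral>\<^sup>+y. ennreal (exp (- qf n (schur n A) x / 2))
            * ennreal (exp (- (A n n * (y + (\<Sum>i<n. A i n * x i) / A n n)\<^sup>2 / 2))) \<partial>lborel)"
      unfolding q by (simp add: ennreal_mult[symmetric] exp_add[symmetric] diff_divide_distrib)
    thus "(\<integral>\<^sup>+y. ennreal (exp (- qf (Suc n) A (x(n := y)) / 2)) \<partial>lborel)
        = ennreal (exp (- qf n (schur n A) x / 2)) * ennreal (sqrt (2 * pi / A n n))"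
      using c by (simp add: nn_integral_cmult nn_integral_gauss)
  qed
  also have "\<dots> = ennreal ((2 * pi) powr (real n / 2) * fdet n (schur n A) powr (- 1 / 2)) * ennreal (sqrt (2 * pi / A n n))"
    by (subst nn_integral_multc) (auto simp: Suc.IH[OF S, simplified])
  also have "\<dots> = ennreal ((2 * pi) powr (real (Suc n) / 2) * fdet (Suc n) A powr (- 1 / 2))"
  proof -
    have "sqrt (2 * pi / A n n) = (2 * pi) powr (1 / 2) * A n n powr (- 1 / 2)"
    proof -
      have "A n n powr (- (1 / 2)) = 1 / sqrt (A n n)"
        using c powr_minus_divide[of "A n n" "1 / 2"] powr_half_sqrt[of "A n n"] by simp
      thus ?thesis
        using powr_half_sqrt[of "2 * pi"] by (simp add: real_sqrt_divide)
    qed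
    thus ?thesis
      using c pos_def_fdet_pos[OF S]
      by (simp add: pos_def_fdet_Suc[OF Suc.prems] ennreal_mult[symmetric] powr_mult powr_add
          add_divide_distrib mult_ac)
  qed
  finally show ?case .
qed

section \<open>Tilted Gaussian densities\<close>

text \<open>The centered normal density with covariance T. Taking a matrix instead of a spectral
  density as argument keeps the tilting arguments free of Toeplitz structure.\<close>

definition gdens :: "nat \<Rightarrow> (nat \<Rightarrow> nat \<Rightarrow> real) \<Rightarrow> (nat \<Rightarrow> real) \<Rightarrow> real" where
  "gdens n T x = (2 * pi) powr (- real n / 2) * fdet n T powr (- 1 / 2) * exp (- qf n (finv n T) x / 2)"

lemma gdens_pos: "pos_def n T \<Longrightarrow> 0 < gdens n T x"
  using pos_def_fdet_pos[of n T] by (simp add: gdens_def)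

lemma measurable_gdens [measurable]:
  "gdens n T \<in> borel_measurable (Ln n)"
  unfolding gdens_def by measurable

lemma mtr_commute: "mtr n A B = mtr n B A"
  by (simp add: mtr_def mult.commute)

lemma mtr_inverse:
  assumes "pos_def n A" "inv_pair n A B"
  shows "mtr n A B = real n"
proof -
  note B = pos_def_inverse[OF assms]
  have "mv n A (mv n B (\<lambda>k. if k = i then 1 else 0)) i = 1" if "i < n" for i
    using assms(2) that by (auto simp: inv_pair_def)
  moreover have "mv n A (mv n B (\<lambda>k. if k = i then 1 else 0)) i = (\<Sum>j<n. A i j * B i j)" if "i < n" for i
    unfolding mv_def using that pos_def_sym[OF B] 
    by (intro sum.cong refl) (simp add: if_distrib cong: if_cong)
  ultimately show ?thesis
    unfolding mtr_def by simp
qed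

lemma qf_linear:
  "qf n (\<lambda>i j. a * A i j + b * B i j) x = a * qf n A x + b * qf n B x"
  by (simp add: qf_def bf_def algebra_simps sum.distrib sum_distrib_left)

lemma mtr_linear:
  "mtr n (\<lambda>i j. a * A i j + b * B i j) C = a * mtr n A C + b * mtr n B C"
  by (simp add: mtr_def algebra_simps sum.distrib sum_distrib_left)

lemma pos_def_linear:
  assumes "pos_def n A" "\<forall>i<n. \<forall>j<n. B i j = B j i" "0 < c"
    and "\<And>x. c * qf n A x \<le> a * qf n A x + b * qf n B x"
  shows "pos_def n (\<lambda>i j. a * A i j + b * B i j)"
  unfolding pos_def_def qf_linear
proof (intro conjI allI impI)
  fix x :: "nat \<Rightarrow> real" assume "\<exists>i<n. x i \<noteq> 0"
  hence "0 < c * qf n A x" using assms(1,3) by (auto simp: pos_def_def)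
  thus "0 < a * qf n A x + b * qf n B x" using assms(4)[of x] by linarith
qed (use assms in \<open>auto simp: pos_def_def\<close>)

text \<open>The exponential factor replaces the inverse of T in the exponent by D; what is left is
  the normalizing constant of a centered normal law with precision matrix D.\<close>

lemma nn_integral_gdens_tilt:
  assumes T: "pos_def n T" and D: "pos_def n D"
  shows "(\<integral>\<^sup>+x. ennreal (gdens n T x * exp ((qf n (finv n T) x - qf n D x) / 2)) \<partial>Ln n)
    = ennreal ((fdet n T * fdet n D) powr (- 1 / 2))"
proof -
  have eq: "gdens n T x * exp ((qf n (finv n T) x - qf n D x) / 2)
      = ((2 * pi) powr (- real n / 2) * fdet n T powr (- 1 / 2)) * exp (- qf n D x / 2)" for x
    by (simp add: gdens_def exp_add[symmetric] diff_divide_distrib)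
  have "(\<integral>\<^sup>+x. ennreal (gdens n T x * exp ((qf n (finv n T) x - qf n D x) / 2)) \<partial>Ln n)
      = (\<integral>\<^sup>+x. ennreal ((2 * pi) powr (- real n / 2) * fdet n T powr (- 1 / 2)) * ennreal (exp (- qf n D x / 2))
          \<partial>Ln n)"
    unfolding eq by (intro nn_integral_cong, subst ennreal_mult) auto
  also have "\<dots> = ennreal ((2 * pi) powr (- real n / 2) * fdet n T powr (- 1 / 2))
      * ennreal ((2 * pi) powr (real n / 2) * fdet n D powr (- 1 / 2))"
    by (subst nn_integral_cmult) (auto simp: nn_integral_gauss_qf[OF D, simplified])
  also have "\<dots> = ennreal ((fdet n T * fdet n D) powr (- 1 / 2))"
  proof -
    have "(2 * pi) powr (- real n / 2) * (2 * pi) powr (real n / 2) = 1"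
      by (simp add: powr_add[symmetric])
    hence "((2 * pi) powr (- real n / 2) * fdet n T powr (- 1 / 2)) * ((2 * pi) powr (real n / 2) * fdet n D powr (- 1 / 2))
        = (fdet n T * fdet n D) powr (- 1 / 2)"
      using pos_def_fdet_pos[OF T] pos_def_fdet_pos[OF D] by (simp add: powr_mult mult_ac)
    thus ?thesis
      by (subst ennreal_mult[symmetric]) auto
  qed
  finally show ?thesis .
qed

lemma nn_integral_gdens:
  assumes "pos_def n T"
  shows "(\<integral>\<^sup>+x. ennreal (gdens n T x) \<partial>Ln n) = 1"
  using nn_integral_gdens_tilt[OF assms pos_def_finv[OF assms]] fdet_finv[OF assms] by simp

text \<open>\<open>fdet_ratio_le\<close> for the inverse of T against D. The trace equals n when D
  is the inverse of T, and its excess over n can be controlled by comparing quadratic forms.\<close>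

lemma nn_integral_gdens_tilt_le:
  assumes T: "pos_def n T" and D: "pos_def n D"
  shows "(\<integral>\<^sup>+x. ennreal (gdens n T x * exp ((qf n (finv n T) x - qf n D x) / 2)) \<partial>Ln n)
    \<le> ennreal (exp ((mtr n (finv n T) (finv n D) - real n) / 2))"
  unfolding nn_integral_gdens_tilt[OF assms]
proof (rule ennreal_leI)
  define u where "u = mtr n (finv n T) (finv n D) - real n"
  have p: "0 < fdet n T" "0 < fdet n D" using assms by (auto intro: pos_def_fdet_pos)
  have "fdet n (finv n T) = 1 / fdet n T"
    using fdet_finv[OF T] p by (simp add: field_simps)
  with fdet_ratio_le[OF pos_def_finv[OF T] D] have "1 \<le> fdet n T * fdet n D * exp u"
    using p by (simp add: u_def field_simps)
  hence "exp (- u) \<le> fdet n T * fdet n D"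
    by (simp add: exp_minus field_simps)
  hence "(fdet n T * fdet n D) powr (- 1 / 2) \<le> exp (- u) powr (- 1 / 2)"
    by (intro powr_mono2') auto
  also have "\<dots> = exp (u / 2)"
    by (simp add: powr_def)
  finally show "(fdet n T * fdet n D) powr (- 1 / 2) \<le> exp (u / 2)" .
qed

lemma qf_squares:
  "qf n (\<lambda>i j. \<Sum>k<N. a k i * a k j) x = (\<Sum>k<N. (ip n (a k) x)\<^sup>2)"
  unfolding qf_def by (subst bf_squares[of n "\<lambda>i j. \<Sum>k<N. a k i * a k j" a N]) (auto simp: power2_eq_square)

text \<open>The tilt subtracts 2sA from the precision matrix, A being the sum of the outer products
  of the vectors \<open>a k\<close>. Since D times its inverse has trace n, the excess trace is
  exactly \<open>2 * s * mtr n A (finv n D)\<close>. The hypothesis on K keeps D above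
  \<open>1 - 2 * s * K\<close> times the inverse of T, hence its inverse below
  \<open>1 / (1 - 2 * s * K)\<close> times T.\<close>

lemma chernoff_upper:
  assumes T: "pos_def n T" and s: "0 < s" "2 * s * K < 1"
    and K: "\<And>x. (\<Sum>k<N. (ip n (a k) x)\<^sup>2) \<le> K * qf n (finv n T) x"
  shows "(\<integral>\<^sup>+x. ennreal (gdens n T x * exp (s * (\<Sum>k<N. (ip n (a k) x)\<^sup>2))) \<partial>Ln n)
    \<le> ennreal (exp (s * (\<Sum>k<N. qf n T (a k)) / (1 - 2 * s * K)))"
proof -
  define A where "A = (\<lambda>i j. \<Sum>k<N. a k i * a k j)"
  define D where "D = (\<lambda>i j. 1 * finv n T i j + (- 2 * s) * A i j)"
  define c where "c = 1 / (1 - 2 * s * K)"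
  have c: "0 < c" using s by (simp add: c_def)
  note B = pos_def_finv[OF T]
  have qD: "qf n D x = qf n (finv n T) x - 2 * s * (\<Sum>k<N. (ip n (a k) x)\<^sup>2)" for x
    unfolding D_def qf_linear by (simp add: A_def qf_squares)
  have le: "(1 - 2 * s * K) * qf n (finv n T) x \<le> qf n D x" for x
    using mult_left_mono[OF K[of x], of "2 * s"] s(1) by (simp add: qD algebra_simps)
  have D: "pos_def n D"
    unfolding D_def
    by (rule pos_def_linear[OF B _ _ le[unfolded D_def qf_linear]])
       (use s(2) in \<open>auto simp: A_def mult.commute\<close>)
  have "qf n (finv n T) z \<le> c * qf n D z" for z
    using le[of z] s(2) by (simp add: c_def field_simps)
  hence E: "qf n (finv n D) x \<le> c * qf n T x" for x
    by (intro qf_inverse_antitone[OF B inv_pair_finv(2)[OF T] D inv_pair_finv(1)[OF D]])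
  have "mtr n D (finv n D) = mtr n (finv n T) (finv n D) - 2 * s * mtr n A (finv n D)"
    using mtr_linear[of n 1 "finv n T" "- 2 * s" A "finv n D"] by (simp add: D_def)
  hence "mtr n (finv n T) (finv n D) - real n = 2 * s * mtr n A (finv n D)"
    using mtr_inverse[OF D inv_pair_finv(1)[OF D]] by simp
  also have "mtr n A (finv n D) = (\<Sum>k<N. qf n (finv n D) (a k))"
    by (rule mtr_squares) (simp add: A_def)
  also have "2 * s * \<dots> \<le> 2 * s * (\<Sum>k<N. c * qf n T (a k))"
    using s(1) by (intro mult_left_mono sum_mono E) auto
  finally have m: "(mtr n (finv n T) (finv n D) - real n) / 2 \<le> s * (\<Sum>k<N. qf n T (a k)) / (1 - 2 * s * K)"
    by (simp add: sum_distrib_left[symmetric] sum_divide_distrib[symmetric] c_def mult_ac)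
  have "(\<integral>\<^sup>+x. ennreal (gdens n T x * exp (s * (\<Sum>k<N. (ip n (a k) x)\<^sup>2))) \<partial>Ln n)
      \<le> ennreal (exp ((mtr n (finv n T) (finv n D) - real n) / 2))"
    using nn_integral_gdens_tilt_le[OF T D] by (simp add: qD mult.assoc)
  also have "\<dots> \<le> ennreal (exp (s * (\<Sum>k<N. qf n T (a k)) / (1 - 2 * s * K)))"
    using m by (intro ennreal_leI) simp
  finally show ?thesis .
qed

text \<open>The tilt with the opposite sign: D is positive definite for every s, and K now bounds it
  from above, so that its inverse keeps at least the share \<open>1 / (1 + 2 * s * K)\<close> of
  T.\<close>

lemma chernoff_lower:
  assumes T: "pos_def n T" and s: "0 < s" "0 \<le> K"
    and K: "\<And>x. (\<Sum>k<N. (ip n (a k) x)\<^sup>2) \<le> K * qf n (finv n T) x"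
  shows "(\<integral>\<^sup>+x. ennreal (gdens n T x * exp (- s * (\<Sum>k<N. (ip n (a k) x)\<^sup>2))) \<partial>Ln n)
    \<le> ennreal (exp (- s * (\<Sum>k<N. qf n T (a k)) / (1 + 2 * s * K)))"
proof -
  define A where "A = (\<lambda>i j. \<Sum>k<N. a k i * a k j)"
  define D where "D = (\<lambda>i j. 1 * finv n T i j + (2 * s) * A i j)"
  define c where "c = 1 + 2 * s * K"
  have c: "0 < c" using s by (simp add: c_def add_pos_nonneg)
  note B = pos_def_finv[OF T]
  have qD: "qf n D x = qf n (finv n T) x + 2 * s * (\<Sum>k<N. (ip n (a k) x)\<^sup>2)" for x
    unfolding D_def qf_linear by (simp add: A_def qf_squares)
  have le: "1 * qf n (finv n T) x \<le> qf n D x" for x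
    using s(1) by (auto simp: qD intro!: sum_nonneg mult_nonneg_nonneg)
  have D: "pos_def n D"
    unfolding D_def
    by (rule pos_def_linear[OF B _ _ le[unfolded D_def qf_linear]])
       (auto simp: A_def mult.commute)
  have "qf n D z \<le> c * qf n (finv n T) z" for z
    using mult_left_mono[OF K[of z], of "2 * s"] s(1) by (simp add: qD c_def algebra_simps)
  hence E: "qf n T x \<le> c * qf n (finv n D) x" for x
    by (intro qf_inverse_antitone[OF D inv_pair_finv(1)[OF D] B inv_pair_finv(2)[OF T]])
  have E': "1 / c * qf n T x \<le> qf n (finv n D) x" for x
    using E[of x] c by (simp add: field_simps)
  have "mtr n D (finv n D) = mtr n (finv n T) (finv n D) + 2 * s * mtr n A (finv n D)"
    using mtr_linear[of n 1 "finv n T" "2 * s" A "finv n D"] by (simp add: D_def)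
  hence "real n - mtr n (finv n T) (finv n D) = 2 * s * mtr n A (finv n D)"
    using mtr_inverse[OF D inv_pair_finv(1)[OF D]] by simp
  also have "mtr n A (finv n D) = (\<Sum>k<N. qf n (finv n D) (a k))"
    by (rule mtr_squares) (simp add: A_def)
  also have "2 * s * (\<Sum>k<N. 1 / c * qf n T (a k)) \<le> 2 * s * \<dots>"
    using s(1) by (intro mult_left_mono sum_mono E') auto
  finally have m: "(mtr n (finv n T) (finv n D) - real n) / 2 \<le> - s * (\<Sum>k<N. qf n T (a k)) / (1 + 2 * s * K)"
    by (simp add: sum_divide_distrib[symmetric] c_def)
  have "(\<integral>\<^sup>+x. ennreal (gdens n T x * exp (- s * (\<Sum>k<N. (ip n (a k) x)\<^sup>2))) \<partial>Ln n)
      \<le> ennreal (exp ((mtr n (finv n T) (finv n D) - real n) / 2))"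
    using nn_integral_gdens_tilt_le[OF T D] by (simp add: qD mult.assoc)
  also have "\<dots> \<le> ennreal (exp (- s * (\<Sum>k<N. qf n T (a k)) / (1 + 2 * s * K)))"
    using m by (intro ennreal_leI) simp
  finally show ?thesis .
qed

text \<open>The integrand is a constant times the tilt with
  \<open>D = (1 + s) * inverse T0 - s * inverse T\<close>, and \<open>le\<close> places D between
  \<open>1 - \<kappa>\<close> and \<open>1 + s\<close> times the inverse of \<open>T0\<close>. For
  small \<kappa> and s the exponent is close to s times the symmetrized Kullback-Leibler divergence
  of the two normal laws.\<close>

lemma nn_integral_gdens_ratio_powr:
  assumes T0: "pos_def n T0" and T: "pos_def n T" and s: "0 < s" and \<kappa>: "\<kappa> < 1"
    and le: "\<And>z. s * qf n T0 z \<le> \<kappa> * qf n T z"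
  shows "(\<integral>\<^sup>+x. ennreal (gdens n T0 x * (gdens n T0 x / gdens n T x) powr s) \<partial>Ln n)
    \<le> ennreal (exp (s / 2 * (mtr n T0 (finv n T) / (1 - \<kappa>) - real n / (1 + s) + mtr n T (finv n T0) - real n)))"
proof -
  let ?A = "finv n T0" and ?B = "finv n T"
  note A = pos_def_finv[OF T0] and B = pos_def_finv[OF T]
  define D where "D = (\<lambda>i j. (1 + s) * ?A i j + (- s) * ?B i j)"
  have qD: "qf n D x = (1 + s) * qf n ?A x - s * qf n ?B x" for x
    unfolding D_def qf_linear by simp
  have "qf n T0 z \<le> (\<kappa> / s) * qf n T z" for z
    using le[of z] s by (simp add: field_simps)
  hence "qf n ?B x \<le> (\<kappa> / s) * qf n ?A x" for x
    by (intro qf_inverse_antitone[OF T0 inv_pair_finv(1)[OF T0] T inv_pair_finv(1)[OF T]])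
  hence BA: "s * qf n ?B x \<le> \<kappa> * qf n ?A x" for x
    using s by (simp add: field_simps)
  have ge: "(1 - \<kappa>) * qf n ?A x \<le> qf n D x" for x
    using BA[of x] mult_nonneg_nonneg[OF less_imp_le[OF s] qf_nonneg[OF A, of x]]
    by (simp add: qD algebra_simps)
  have D: "pos_def n D"
    unfolding D_def
    by (rule pos_def_linear[OF A _ _ ge[unfolded D_def qf_linear]])
       (use \<kappa> B in \<open>auto simp: pos_def_def\<close>)
  let ?E = "finv n D"
  have "qf n ?A z \<le> (1 / (1 - \<kappa>)) * qf n D z" for z
    using ge[of z] \<kappa> by (simp add: field_simps)
  hence E1: "qf n ?E x \<le> (1 / (1 - \<kappa>)) * qf n T0 x" for x
    by (intro qf_inverse_antitone[OF A inv_pair_finv(2)[OF T0] D inv_pair_finv(1)[OF D]])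
  have "qf n D z \<le> (1 + s) * qf n ?A z" for z
    using mult_nonneg_nonneg[OF less_imp_le[OF s] qf_nonneg[OF B, of z]] by (simp add: qD)
  hence E2: "qf n T0 x \<le> (1 + s) * qf n ?E x" for x
    by (intro qf_inverse_antitone[OF D inv_pair_finv(1)[OF D] A inv_pair_finv(2)[OF T0]])
  have m1: "mtr n ?B ?E \<le> (1 / (1 - \<kappa>)) * mtr n ?B T0"
    by (rule mtr_mono[OF B E1])
  have "mtr n ?A T0 \<le> (1 + s) * mtr n ?A ?E"
    by (rule mtr_mono[OF A E2])
  hence m2: "real n / (1 + s) \<le> mtr n ?A ?E"
    using mtr_inverse[OF A inv_pair_finv(2)[OF T0]] s by (simp add: field_simps)
  \<comment> \<open>Because D times its inverse has trace n, the excess trace acquires a factor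
    s.\<close>
  have "mtr n D ?E = (1 + s) * mtr n ?A ?E - s * mtr n ?B ?E"
    using mtr_linear[of n "1 + s" ?A "- s" ?B ?E] by (simp add: D_def)
  hence "mtr n ?A ?E - real n = s * (mtr n ?B ?E - mtr n ?A ?E)"
    using mtr_inverse[OF D inv_pair_finv(1)[OF D]] by (simp add: algebra_simps)
  also have "\<dots> \<le> s * ((1 / (1 - \<kappa>)) * mtr n ?B T0 - real n / (1 + s))"
    using s m1 m2 by (intro mult_left_mono) auto
  finally have m: "mtr n ?A ?E - real n \<le> s * (mtr n T0 ?B / (1 - \<kappa>) - real n / (1 + s))"
    by (simp add: mtr_commute)
  have d: "0 < fdet n T0" "0 < fdet n T" using T0 T by (auto intro: pos_def_fdet_pos)
  \<comment> \<open>The contribution of the normalizing constants to the ratio raised to the power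
    s; it brings in the trace of T times the inverse of \<open>T0\<close>.\<close>
  define C where "C = (fdet n T / fdet n T0) powr (s / 2)"
  have "fdet n T / fdet n T0 \<le> exp (mtr n T ?A - real n)"
    using fdet_ratio_le[OF T T0] d by (simp add: field_simps)
  hence "C \<le> exp (mtr n T ?A - real n) powr (s / 2)"
    unfolding C_def using d s by (intro powr_mono2) auto
  hence C: "C \<le> exp (s / 2 * (mtr n T ?A - real n))"
    by (simp add: powr_def)
  have ratio: "gdens n T0 x / gdens n T x = (fdet n T / fdet n T0) powr (1 / 2) * exp ((qf n ?B x - qf n ?A x) / 2)" for x
  proof -
    have p: "(fdet n T / fdet n T0) powr (1 / 2) = fdet n T0 powr (- 1 / 2) / fdet n T powr (- 1 / 2)"
      using d powr_minus_divide[of _ "1 / 2 :: real"] by (simp add: powr_divide)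
    have e: "exp ((qf n ?B x - qf n ?A x) / 2) = exp (- qf n ?A x / 2) / exp (- qf n ?B x / 2)"
      by (simp add: exp_diff[symmetric] diff_divide_distrib)
    show ?thesis unfolding p e gdens_def by simp
  qed
  have "(gdens n T0 x / gdens n T x) powr s = C * exp (s * (qf n ?B x - qf n ?A x) / 2)" for x
    unfolding ratio C_def using d by (simp add: powr_mult powr_powr) (simp add: powr_def)
  hence eq: "gdens n T0 x * (gdens n T0 x / gdens n T x) powr s = C * (gdens n T0 x * exp ((qf n ?A x - qf n D x) / 2))" for x
    by (simp add: qD algebra_simps)
  have "(\<integral>\<^sup>+x. ennreal (gdens n T0 x * (gdens n T0 x / gdens n T x) powr s) \<partial>Ln n)
      = ennreal C * (\<integral>\<^sup>+x. ennreal (gdens n T0 x * exp ((qf n ?A x - qf n D x) / 2)) \<partial>Ln n)"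
    unfolding eq using gdens_pos[OF T0]
    by (subst nn_integral_cmult[symmetric]) (auto simp: ennreal_mult C_def less_imp_le)
  also have "\<dots> \<le> ennreal (exp (s / 2 * (mtr n T ?A - real n))) * ennreal (exp ((mtr n ?A ?E - real n) / 2))"
    by (intro mult_mono ennreal_leI C nn_integral_gdens_tilt_le[OF T0 D]) auto
  also have "\<dots> = ennreal (exp (s / 2 * (mtr n T ?A - real n) + (mtr n ?A ?E - real n) / 2))"
    by (simp add: ennreal_mult[symmetric] exp_add)
  also have "\<dots> \<le> ennreal (exp (s / 2 * (mtr n T0 ?B / (1 - \<kappa>) - real n / (1 + s) + mtr n T ?A - real n)))"
  proof (intro ennreal_leI iffD2[OF exp_le_cancel_iff])
    have gen: "s / 2 * (a - b + c - e) = s / 2 * (c - e) + s * (a - b) / 2" for a b c e :: real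
      by (simp add: field_simps)
    have eq: "s / 2 * (mtr n T0 ?B / (1 - \<kappa>) - real n / (1 + s) + mtr n T ?A - real n)
        = s / 2 * (mtr n T ?A - real n) + s * (mtr n T0 ?B / (1 - \<kappa>) - real n / (1 + s)) / 2"
      by (rule gen)
    show "s / 2 * (mtr n T ?A - real n) + (mtr n ?A ?E - real n) / 2
        \<le> s / 2 * (mtr n T0 ?B / (1 - \<kappa>) - real n / (1 + s) + mtr n T ?A - real n)"
      unfolding eq by (intro add_left_mono divide_right_mono m) simp
  qed
  finally show ?thesis .
qed

section \<open>Toeplitz forms\<close>

text \<open>Lebesgue measure on the frequencies with the origin removed, so that the formulas for
  the densities, which say nothing at 0, hold on the whole space instead of almost
  everywhere.\<close>

definition fm :: "real measure" where
  "fm = restrict_space lborel freqs"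

lemma freqs_sets [measurable]: "freqs \<in> sets borel"
  unfolding freqs_def by measurable

lemma space_fm [simp]: "space fm = freqs"
  by (simp add: fm_def space_restrict_space)

text \<open>The two integrands differ at one point. If one of them is not integrable, neither is the
  other, and both integrals take the default value 0.\<close>

lemma integral_fm:
  fixes f :: "real \<Rightarrow> 'a::{banach, second_countable_topology}"
  shows "integral\<^sup>L fm f = set_lebesgue_integral lborel {-pi..pi} f"
proof -
  have "integral\<^sup>L fm f = set_lebesgue_integral lborel freqs f"
    unfolding fm_def set_lebesgue_integral_def by (subst integral_restrict_space) auto
  also have "\<dots> = set_lebesgue_integral lborel {-pi..pi} f"
  proof -
    let ?g = "\<lambda>x. indicator freqs x *\<^sub>R f x" and ?h = "\<lambda>x. indicator {-pi..pi} x *\<^sub>R f x"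
    let ?d = "\<lambda>x::real. indicator {0} x *\<^sub>R f 0"
    have d: "has_bochner_integral lborel ?d 0"
      using has_bochner_integral_scaleR_left[OF has_bochner_integral_real_indicator[of "{0::real}" lborel], of "f 0"]
      by simp
    have h: "?h = (\<lambda>x. ?g x + ?d x)" and g: "?g = (\<lambda>x. ?h x - ?d x)"
      by (auto simp: fun_eq_iff freqs_def indicator_def)
    show ?thesis
    proof (cases "integrable lborel ?g")
      case True
      thus ?thesis
        unfolding set_lebesgue_integral_def h using d
        by (subst Bochner_Integration.integral_add) (auto simp: has_bochner_integral_iff)
    next
      case False
      moreover have "\<not> integrable lborel ?h"
        using False d unfolding g by (auto simp: has_bochner_integral_iff)
      ultimately show ?thesis
        unfolding set_lebesgue_integral_def by (simp add: not_integrable_integral_eq)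
    qed
  qed
  finally show ?thesis .
qed

lemma integrable_fm:
  fixes f :: "real \<Rightarrow> 'a::{banach, second_countable_topology}"
  assumes "set_integrable lborel {-pi..pi} f"
  shows "integrable fm f"
  using set_integrable_subset[OF assms, of freqs]
  by (auto simp: fm_def integrable_restrict_space set_integrable_def freqs_def)

lemma nn_integral_fm: "(\<integral>\<^sup>+v\<in>{-pi..pi}. g v \<partial>lborel) = (\<integral>\<^sup>+v. g v \<partial>fm)"
proof -
  have "(\<integral>\<^sup>+v. g v \<partial>fm) = (\<integral>\<^sup>+v. g v * indicator freqs v \<partial>lborel)"
    unfolding fm_def by (rule nn_integral_restrict_space) auto
  also have "\<dots> = (\<integral>\<^sup>+v\<in>{-pi..pi}. g v \<partial>lborel)"
  proof (rule nn_integral_cong_AE)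
    show "AE v in lborel. g v * indicator freqs v = g v * indicator {- pi..pi} v"
      using AE_lborel_singleton[of "0::real"]
      by eventually_elim (auto simp: freqs_def indicator_def)
  qed
  finally show ?thesis by simp
qed

lemma measurable_fm [measurable (raw)]:
  "f \<in> borel_measurable borel \<Longrightarrow> f \<in> borel_measurable fm"
  unfolding fm_def by (rule measurable_restrict_space1) simp

lemma measurable_fm_continuous:
  fixes f :: "real \<Rightarrow> real"
  assumes "continuous_on freqs f"
  shows "f \<in> borel_measurable fm"
proof -
  have "f \<in> borel_measurable (restrict_space borel freqs)"
    by (rule borel_measurable_continuous_on_restrict[OF assms])
  also have "borel_measurable (restrict_space borel freqs) = (borel_measurable fm :: (real \<Rightarrow> real) set)"
    unfolding fm_def by (intro measurable_cong_sets sets_restrict_space_cong) auto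
  finally show ?thesis .
qed

lemma finite_measure_fm: "finite_measure fm"
proof
  have "emeasure fm (space fm) = emeasure lborel freqs"
    by (simp add: fm_def emeasure_restrict_space space_restrict_space)
  also have "\<dots> \<le> emeasure lborel {-pi..pi}"
    by (rule emeasure_mono) (auto simp: freqs_def)
  also have "\<dots> < \<infinity>"
    by (simp add: emeasure_lborel_Icc)
  finally show "emeasure fm (space fm) \<noteq> \<infinity>" by simp
qed

interpretation fm: finite_measure fm
  by (rule finite_measure_fm)

lemma integrable_fm_bounded:
  fixes f :: "real \<Rightarrow> real"
  assumes "f \<in> borel_measurable fm" "\<And>v. v \<in> freqs \<Longrightarrow> \<bar>f v\<bar> \<le> B"
  shows "integrable fm f"
  using assms by (intro fm.integrable_const_bound[of _ B]) auto

lemma integrable_fm_mult: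
  fixes f g :: "real \<Rightarrow> real"
  assumes "integrable fm f" "g \<in> borel_measurable fm" "\<And>v. v \<in> freqs \<Longrightarrow> \<bar>g v\<bar> \<le> B"
  shows "integrable fm (\<lambda>v. f v * g v)"
proof (rule Bochner_Integration.integrable_bound)
  show "integrable fm (\<lambda>v. B * \<bar>f v\<bar>)" using assms(1) by auto
  show "AE v in fm. norm (f v * g v) \<le> norm (B * \<bar>f v\<bar>)"
  proof (intro AE_I2)
    fix v assume "v \<in> space fm"
    hence "\<bar>g v\<bar> \<le> B" using assms(3) by simp
    hence "\<bar>f v\<bar> * \<bar>g v\<bar> \<le> \<bar>f v\<bar> * B" "0 \<le> B"
      by (auto intro: mult_left_mono)
    thus "norm (f v * g v) \<le> norm (B * \<bar>f v\<bar>)" by (simp add: abs_mult mult.commute)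
  qed
qed (use assms in auto)

lemma integral_fm_cos:
  assumes "k \<in> \<int>"
  shows "(\<integral>v. cos (k * v) \<partial>fm) = (if k = 0 then 2 * pi else 0)"
proof (cases "k = 0")
  case True
  have "(\<integral>v. cos (k * v) \<partial>fm) = (\<integral>v. indicator {-pi..pi} v *\<^sub>R (1::real) \<partial>lborel)"
    using True by (subst integral_fm) (simp add: set_lebesgue_integral_def)
  thus ?thesis using True by simp
next
  case False
  have "(\<integral>v. cos (k * v) \<partial>fm) = (\<integral>v. cos (k * v) * indicator {-pi..pi} v \<partial>lborel)"
    by (simp add: integral_fm set_lebesgue_integral_def mult.commute)
  also have "\<dots> = sin (k * pi) / k - sin (k * (- pi)) / k"
    using False
    by (intro integral_FTC_Icc_real) (auto intro!: derivative_eq_intros continuous_intros)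
  finally have "(\<integral>v. cos (k * v) \<partial>fm) = 2 * sin (k * pi) / k" by simp
  moreover have "sin (k * pi) = 0"
    using assms unfolding sin_zero_iff_int2 by (auto elim!: Ints_cases)
  ultimately show ?thesis using False by simp
qed

section \<open>Toeplitz matrices and trigonometric polynomials\<close>

definition tp :: "(real \<Rightarrow> real) \<Rightarrow> nat \<Rightarrow> nat \<Rightarrow> real" where
  "tp f j k = (\<integral>v. f v * cos ((real j - real k) * v) \<partial>fm)"

lemma toeplitz_eq:
  assumes "integrable fm f"
  shows "toeplitz n f = Matrix.mat n n (\<lambda>(j, k). tp f j k)"
proof -
  have "Re (set_lebesgue_integral lborel {-pi..pi}
      (\<lambda>v. complex_of_real (f v) * exp (\<i> * of_real ((real j - real k) * v)))) = tp f j k" for j k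
  proof -
    have f: "integrable fm (\<lambda>v. complex_of_real (f v) * exp (\<i> * of_real ((real j - real k) * v)))"
    proof (rule Bochner_Integration.integrable_bound[OF assms])
      show "(\<lambda>v. complex_of_real (f v) * exp (\<i> * complex_of_real ((real j - real k) * v))) \<in> borel_measurable fm"
      proof (rule borel_measurable_times)
        show "(\<lambda>v. complex_of_real (f v)) \<in> borel_measurable fm"
          using assms by measurable
        show "(\<lambda>v. exp (\<i> * complex_of_real ((real j - real k) * v))) \<in> borel_measurable fm"
          by (intro measurable_fm borel_measurable_continuous_onI continuous_intros)
      qed
    qed (simp add: norm_mult)
    show ?thesis
      unfolding integral_fm[symmetric] tp_def integral_Re[OF f, symmetric]
      by (simp add: cis_conv_exp[symmetric] del: of_real_mult of_real_diff)
  qed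
  thus ?thesis unfolding toeplitz_def by simp
qed

lemma integrable_fm_cos:
  "integrable fm f \<Longrightarrow> integrable fm (\<lambda>v. f v * cos (c * v))"
  by (intro integrable_fm_mult[of _ _ 1] measurable_fm) auto

text \<open>Squared modulus of the trigonometric polynomial with coefficients x. It turns the
  quadratic form of a Toeplitz matrix into an integral against the density (\<open>qf_tp\<close>),
  so that inequalities between densities pass to matrices; for a filter x it is the power transfer
  function.\<close>

definition pw :: "nat \<Rightarrow> (nat \<Rightarrow> real) \<Rightarrow> real \<Rightarrow> real" where
  "pw n x v = (cmod (\<Sum>j<n. of_real (x j) * cis (real j * v)))\<^sup>2"

lemma Re_trig_poly:
  "Re ((\<Sum>j<n. of_real (x j) * cis (real j * v)) * cnj (\<Sum>j<n. of_real (y j) * cis (real j * v)))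
    = (\<Sum>j<n. \<Sum>k<n. x j * y k * cos ((real j - real k) * v))"
proof -
  have "(\<Sum>j<n. of_real (x j) * cis (real j * v)) * cnj (\<Sum>j<n. of_real (y j) * cis (real j * v))
      = (\<Sum>j<n. \<Sum>k<n. of_real (x j * y k) * cis ((real j - real k) * v))"
    unfolding cnj_sum sum_product
    by (intro sum.cong refl) (simp add: cis_cnj cis_mult algebra_simps)
  thus ?thesis by simp
qed

lemma pw_cos: "pw n x v = (\<Sum>j<n. \<Sum>k<n. x j * x k * cos ((real j - real k) * v))"
proof -
  have "pw n x v = Re ((\<Sum>j<n. of_real (x j) * cis (real j * v)) * cnj (\<Sum>j<n. of_real (x j) * cis (real j * v)))"
    unfolding pw_def complex_norm_square[symmetric] by simp
  thus ?thesis unfolding Re_trig_poly .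
qed

lemma pw_nonneg: "0 \<le> pw n x v"
  by (simp add: pw_def)

lemma pw_le: "pw n x v \<le> real n * (\<Sum>j<n. (x j)\<^sup>2)"
proof -
  have "cmod (\<Sum>j<n. of_real (x j) * cis (real j * v)) \<le> (\<Sum>j<n. 1 * \<bar>x j\<bar>)"
    by (rule order_trans[OF norm_sum]) (simp add: norm_mult)
  hence "pw n x v \<le> (\<Sum>j<n. 1 * \<bar>x j\<bar>)\<^sup>2"
    unfolding pw_def by (intro power_mono) auto
  also have "\<dots> \<le> (\<Sum>j<n. 1\<^sup>2) * (\<Sum>j<n. \<bar>x j\<bar>\<^sup>2)"
    by (rule Cauchy_Schwarz_ineq_sum)
  finally show ?thesis by simp
qed

lemma measurable_pw [measurable]: "pw n x \<in> borel_measurable fm"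
  unfolding pw_def by (intro measurable_fm borel_measurable_continuous_onI continuous_intros continuous_on_cis)

lemma pw_abs_le: "\<bar>pw n x v\<bar> \<le> real n * (\<Sum>j<n. (x j)\<^sup>2)"
  using pw_le[of n x v] pw_nonneg[of n x v] by linarith

lemma integrable_fm_pw: "integrable fm f \<Longrightarrow> integrable fm (\<lambda>v. f v * pw n x v)"
  using pw_abs_le by (intro integrable_fm_mult) auto

lemma bf_tp:
  assumes "integrable fm f"
  shows "bf n (tp f) x y = (\<integral>v. f v * (\<Sum>j<n. \<Sum>k<n. x j * y k * cos ((real j - real k) * v)) \<partial>fm)"
proof -
  have "(\<integral>v. f v * (\<Sum>j<n. \<Sum>k<n. x j * y k * cos ((real j - real k) * v)) \<partial>fm)
      = (\<integral>v. (\<Sum>j<n. \<Sum>k<n. x j * y k * (f v * cos ((real j - real k) * v))) \<partial>fm)"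
    by (simp add: sum_distrib_left mult_ac)
  also have "\<dots> = (\<Sum>j<n. \<Sum>k<n. x j * y k * tp f j k)"
    unfolding tp_def using integrable_fm_cos[OF assms]
    by (subst Bochner_Integration.integral_sum, force, intro sum.cong refl,
        subst Bochner_Integration.integral_sum) auto
  finally show ?thesis by (simp add: bf_def mult_ac)
qed

lemma qf_tp:
  assumes "integrable fm f"
  shows "qf n (tp f) x = (\<integral>v. f v * pw n x v \<partial>fm)"
  unfolding qf_def bf_tp[OF assms] pw_cos ..

lemma tp_sym: "tp f j k = tp f k j"
proof -
  have "cos ((real j - real k) * v) = cos ((real k - real j) * v)" for v
    by (metis cos_minus minus_diff_eq mult_minus_left)
  thus ?thesis by (simp add: tp_def)
qed

lemma tp_one: "tp (\<lambda>_. 1) j k = (if j = k then 2 * pi else 0)"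
  unfolding tp_def using integral_fm_cos[of "real j - real k"] by simp

lemma bf_tp_one: "bf n (tp (\<lambda>_. 1)) x y = 2 * pi * ip n x y"
proof -
  have "(\<Sum>j<n. tp (\<lambda>_. 1) i j * x i * y j) = (\<Sum>j<n. if j = i then 2 * pi * (x i * y i) else 0)" for i
    by (intro sum.cong) (auto simp: tp_one)
  thus ?thesis by (simp add: bf_def ip_def sum_distrib_left)
qed

lemma integral_pw: "(\<integral>v. pw n x v \<partial>fm) = 2 * pi * (\<Sum>j<n. (x j)\<^sup>2)"
  using qf_tp[of "\<lambda>_. 1" n x] bf_tp_one[of n x x] by (simp add: qf_def ip_def power2_eq_square)

lemma integrable_pw: "integrable fm (pw n x)"
  using integrable_fm_pw[of "\<lambda>_. 1" n x] by simp

text \<open>If the form vanishes, so does \<open>pw n x\<close> almost everywhere, and Parseval's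
  identity \<open>integral_pw\<close> makes x vanish.\<close>

lemma pos_def_tp:
  assumes "integrable fm f" "\<And>v. v \<in> freqs \<Longrightarrow> 0 < f v"
  shows "pos_def n (tp f)"
  unfolding pos_def_def
proof (intro conjI allI impI)
  fix x :: "nat \<Rightarrow> real" assume "\<exists>i<n. x i \<noteq> 0"
  then obtain i where i: "i < n" "x i \<noteq> 0" by blast
  have nn: "0 \<le> f v * pw n x v" if "v \<in> freqs" for v
    using assms(2)[OF that] pw_nonneg[of n x v] by simp
  have "0 \<le> qf n (tp f) x"
    unfolding qf_tp[OF assms(1)] using nn by (intro integral_nonneg_AE AE_I2) auto
  moreover have "qf n (tp f) x \<noteq> 0"
  proof
    assume "qf n (tp f) x = 0"
    hence "AE v in fm. f v * pw n x v = 0"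
      unfolding qf_tp[OF assms(1)] using nn integrable_fm_pw[OF assms(1)]
      by (subst (asm) integral_nonneg_eq_0_iff_AE) auto
    hence "AE v in fm. pw n x v = 0"
      using AE_space[of fm] by eventually_elim (auto dest: assms(2))
    hence "(\<integral>v. pw n x v \<partial>fm) = 0"
      by (rule integral_eq_zero_AE)
    hence "(\<Sum>j<n. (x j)\<^sup>2) = 0" by (simp add: integral_pw)
    thus False using i by (subst (asm) sum_nonneg_eq_0_iff) auto
  qed
  ultimately show "0 < qf n (tp f) x" by linarith
qed (simp add: tp_sym)

lemma gauss_lik_eq:
  assumes "integrable fm f" "\<And>v. v \<in> freqs \<Longrightarrow> 0 < f v"
  shows "gauss_lik n f x = gdens n (tp f) x"
  using mat_inverse_eq[OF pos_def_tp[OF assms], of n]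
  by (simp add: gauss_lik_def toeplitz_eq[OF assms(1)] scalar_prod_qf gdens_def fdet_def)

text \<open>The compression of an inverse dominates the inverse of the compression.\<close>

lemma finv_tp_le:
  assumes "integrable fm f" "\<And>v. v \<in> freqs \<Longrightarrow> 0 < f v" "integrable fm (\<lambda>v. 1 / f v)"
  shows "qf n (finv n (tp f)) x \<le> 1 / (4 * pi\<^sup>2) * qf n (tp (\<lambda>v. 1 / f v)) x"
proof -
  note T = pos_def_tp[OF assms(1,2), of n]
  \<comment> \<open>Both the product of u and x and the Toeplitz form of u equal the value Q to be
    bounded, and by Parseval \<open>4 * pi * Q\<close> is the integral of a product of two
    trigonometric polynomials.\<close>
  define u where "u = mv n (finv n (tp f)) x"
  let ?U = "\<lambda>x v. \<Sum>j<n. of_real (x j) * cis (real j * v)"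
  have ux: "ip n u x = qf n (finv n (tp f)) x"
    by (simp add: u_def qf_def bf_ip ip_commute)
  have uu: "qf n (tp f) u = qf n (finv n (tp f)) x"
    unfolding u_def by (rule qf_inverse(3)[OF T inv_pair_finv(1)[OF T]])
  have "4 * pi * ip n u x = (\<integral>v. 2 * Re (?U u v * cnj (?U x v)) \<partial>fm)"
    unfolding Re_trig_poly using bf_tp[of "\<lambda>_. 1" n u x] bf_tp_one[of n u x] by simp
  also have "\<dots> \<le> (\<integral>v. 2 * pi * (f v * pw n u v) + 1 / (2 * pi) * (1 / f v * pw n x v) \<partial>fm)"
  proof (rule integral_mono)
    have "integrable fm (\<lambda>v. 1 * (\<Sum>j<n. \<Sum>k<n. u j * x k * cos ((real j - real k) * v)))"
      by (auto intro!: Bochner_Integration.integrable_sum integrable_fm_cos[of "\<lambda>_. 1", simplified])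
    thus "integrable fm (\<lambda>v. 2 * Re (?U u v * cnj (?U x v)))"
      unfolding Re_trig_poly by simp
    show "integrable fm (\<lambda>v. 2 * pi * (f v * pw n u v) + 1 / (2 * pi) * (1 / f v * pw n x v))"
      using integrable_fm_pw[OF assms(1), of n u] integrable_fm_pw[OF assms(3), of n x]
      by (auto simp del: times_divide_eq_left times_divide_eq_right)
  next
    fix v assume "v \<in> space fm"
    hence f: "0 < f v" using assms(2) by simp
    have "2 * Re (?U u v * cnj (?U x v)) \<le> 2 * (cmod (?U u v) * cmod (?U x v))"
      using complex_Re_le_cmod[of "?U u v * cnj (?U x v)"] by (simp add: norm_mult del: cnj_sum)
    \<comment> \<open>The inequality \<open>2 * a * b \<le> c * a^2 + b^2 / c\<close>. The weight
      \<open>c = 2 * pi * f v\<close> makes the first term integrate to \<open>2 * pi * Q\<close>,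
      half of the left-hand side, so that it can be absorbed.\<close>
    also have "\<dots> \<le> (2 * pi * f v) * (cmod (?U u v))\<^sup>2 + (cmod (?U x v))\<^sup>2 / (2 * pi * f v)"
    proof -
      define a b c where "a = cmod (?U u v)" and "b = cmod (?U x v)" and "c = 2 * pi * f v"
      have c: "0 < c" using f by (simp add: c_def)
      have "0 \<le> (c * a - b)\<^sup>2 / c" using c by simp
      also have "(c * a - b)\<^sup>2 / c = c * a\<^sup>2 + b\<^sup>2 / c - 2 * (a * b)"
        using c by (simp add: power2_eq_square field_simps)
      finally show ?thesis unfolding a_def[symmetric] b_def[symmetric] c_def[symmetric] by simp
    qed
    finally show "2 * Re (?U u v * cnj (?U x v)) \<le> 2 * pi * (f v * pw n u v) + 1 / (2 * pi) * (1 / f v * pw n x v)"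
      using f by (simp add: pw_def field_simps)
  qed
  also have "\<dots> = 2 * pi * qf n (tp f) u + 1 / (2 * pi) * qf n (tp (\<lambda>v. 1 / f v)) x"
    unfolding qf_tp[OF assms(1)] qf_tp[OF assms(3)]
    using integrable_fm_pw[OF assms(1), of n u] integrable_fm_pw[OF assms(3), of n x]
    by (subst Bochner_Integration.integral_add)
       (auto simp del: times_divide_eq_left times_divide_eq_right)
  finally have "2 * pi * qf n (finv n (tp f)) x \<le> 1 / (2 * pi) * qf n (tp (\<lambda>v. 1 / f v)) x"
    unfolding uu ux by simp
  thus ?thesis by (simp add: field_simps power2_eq_square)
qed

section \<open>Fejer means\<close>

text \<open>Cesaro mean of the cosine series of v: collecting the pairs with
  \<open>j - k = h\<close> gives the weight \<open>1 - \<bar>h\<bar> / n\<close>. For even v this is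
  the classical Fejer mean. The double sum is the shape in which it arises from a trace in
  \<open>mtr_tp\<close>.\<close>

definition fej :: "nat \<Rightarrow> (real \<Rightarrow> real) \<Rightarrow> real \<Rightarrow> real" where
  "fej n v l = (\<Sum>j<n. \<Sum>k<n. cos ((real j - real k) * l) * tp v j k) / (2 * pi * real n)"

definition fker :: "nat \<Rightarrow> real \<Rightarrow> real \<Rightarrow> real" where
  "fker n l u = (\<Sum>j<n. \<Sum>k<n. cos ((real j - real k) * l) * cos ((real j - real k) * u)) / (2 * pi * real n)"

lemma fej_eq_integral:
  assumes "integrable fm v"
  shows "fej n v l = (\<integral>u. fker n l u * v u \<partial>fm)"
proof -
  have "(\<integral>u. (\<Sum>j<n. \<Sum>k<n. cos ((real j - real k) * l) * (v u * cos ((real j - real k) * u))) \<partial>fm)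
      = (\<Sum>j<n. \<Sum>k<n. cos ((real j - real k) * l) * tp v j k)"
    unfolding tp_def using integrable_fm_cos[OF assms]
    by (subst Bochner_Integration.integral_sum, force, intro sum.cong refl,
        subst Bochner_Integration.integral_sum) auto
  hence "fej n v l = (\<integral>u. (\<Sum>j<n. \<Sum>k<n. cos ((real j - real k) * l) * (v u * cos ((real j - real k) * u))) \<partial>fm) / (2 * pi * real n)"
    by (simp add: fej_def)
  also have "\<dots> = (\<integral>u. (\<Sum>j<n. \<Sum>k<n. cos ((real j - real k) * l) * (v u * cos ((real j - real k) * u))) / (2 * pi * real n) \<partial>fm)"
    by simp
  also have "\<dots> = (\<integral>u. fker n l u * v u \<partial>fm)"
    by (simp add: fker_def sum_distrib_left sum_distrib_right mult_ac)
  finally show ?thesis .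
qed

text \<open>The average of the Fejer kernel at \<open>l - u\<close> and \<open>l + u\<close>: only
  cosine coefficients enter, so u is seen up to sign. This is why distances below are measured
  between absolute values.\<close>

lemma fker_pw: "fker n l u = (pw n (\<lambda>_. 1) (l - u) + pw n (\<lambda>_. 1) (l + u)) / (4 * pi * real n)"
proof -
  have "2 * (\<Sum>j<n. \<Sum>k<n. cos ((real j - real k) * l) * cos ((real j - real k) * u))
      = pw n (\<lambda>_. 1) (l - u) + pw n (\<lambda>_. 1) (l + u)"
  proof -
    have "2 * (cos (c * l) * cos (c * u)) = cos (c * (l - u)) + cos (c * (l + u))" for c
      by (simp add: cos_add cos_diff distrib_left right_diff_distrib)
    thus ?thesis
      unfolding pw_cos by (simp add: sum_distrib_left sum.distrib[symmetric])
  qed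
  moreover have "S / (2 * pi * real n) = Q / (4 * pi * real n)" if "2 * S = Q" for S Q
    using that[symmetric] by simp
  ultimately show ?thesis unfolding fker_def by blast
qed

lemma fker_nonneg: "0 \<le> fker n l u"
  unfolding fker_pw by (simp add: pw_nonneg)

lemma measurable_fker [measurable]: "fker n l \<in> borel_measurable fm"
  unfolding fker_def
  by (intro borel_measurable_divide measurable_fm borel_measurable_continuous_onI continuous_intros)

lemma fker_le_n: "fker n l u \<le> real n"
proof -
  have "pw n (\<lambda>_. 1) x \<le> real n * real n" for x
    using pw_le[of n "\<lambda>_. 1" x] by simp
  hence "pw n (\<lambda>_. 1) (l - u) + pw n (\<lambda>_. 1) (l + u) \<le> 2 * (real n * real n)"
    by (smt (verit))
  hence "fker n l u \<le> 2 * (real n * real n) / (4 * pi * real n)"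
    unfolding fker_pw by (intro divide_right_mono) auto
  also have "\<dots> \<le> real n"
    using pi_gt3 by (cases "n = 0") (auto simp: field_simps)
  finally show ?thesis .
qed

lemma pw_one_le:
  assumes "cos x \<noteq> 1"
  shows "pw n (\<lambda>_. 1) x \<le> 2 / (1 - cos x)"
proof -
  have c: "0 < 1 - cos x" using assms cos_le_one[of x] by linarith
  have "of_real 1 * cis (real j * x) = cis x ^ j" for j
    unfolding Complex.DeMoivre by simp
  hence "(\<Sum>j<n. of_real 1 * cis (real j * x)) = (\<Sum>j<n. cis x ^ j)"
    by (intro sum.cong refl)
  hence "(1 - cis x) * (\<Sum>j<n. of_real 1 * cis (real j * x)) = 1 - cis x ^ n"
    by (simp add: one_diff_power_eq)
  hence "(cmod (1 - cis x))\<^sup>2 * pw n (\<lambda>_. 1) x = (cmod (1 - cis x ^ n))\<^sup>2"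
    unfolding pw_def by (metis norm_mult power_mult_distrib)
  also have "\<dots> \<le> 2\<^sup>2"
    using norm_triangle_ineq4[of 1 "cis x ^ n"] by (intro power_mono) (auto simp: norm_power)
  also have "(cmod (1 - cis x))\<^sup>2 = 2 * (1 - cos x)"
    unfolding cmod_power2 using sin_cos_squared_add[of x] by (simp add: power2_eq_square algebra_simps)
  finally show ?thesis using c by (simp add: field_simps)
qed

lemma cos_le_cos_band:
  assumes "0 \<le> \<delta>" "\<delta> \<le> x" "x \<le> 2 * pi - \<delta>"
  shows "cos x \<le> cos \<delta>"
proof (cases "x \<le> pi")
  case True
  thus ?thesis using assms by (intro cos_monotone_0_pi_le) auto
next
  case False
  have "cos x = cos (2 * pi - x)" by (simp add: cos_diff)
  also have "\<dots> \<le> cos \<delta>" using assms False by (intro cos_monotone_0_pi_le) auto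
  finally show ?thesis .
qed

text \<open>For u outside the band both \<open>l - u\<close> and \<open>l + u\<close> stay at
  distance at least \<delta> from the multiples of \<open>2 * pi\<close>, where the Fejer kernel
  peaks; in particular \<open>\<bar>l\<bar> + \<bar>u\<bar> \<le> 2 * pi - \<delta>\<close>.\<close>

lemma fker_le:
  assumes lu: "l \<in> freqs" "u \<in> freqs" and \<delta>: "0 < \<delta>" "\<delta> \<le> \<bar>\<bar>u\<bar> - \<bar>l\<bar>\<bar>"
  shows "fker n l u \<le> 1 / (pi * real n * (1 - cos \<delta>))"
proof -
  have b: "\<bar>l\<bar> \<le> pi" "\<bar>u\<bar> \<le> pi" using lu by (auto simp: freqs_def)
  have "\<delta> \<le> pi" using b \<delta> by linarith
  hence c: "0 < 1 - cos \<delta>" using cos_monotone_0_pi[of 0 \<delta>] \<delta> by simp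
  have *: "pw n (\<lambda>_. 1) x \<le> 2 / (1 - cos \<delta>)" if "\<delta> \<le> \<bar>x\<bar>" "\<bar>x\<bar> \<le> 2 * pi - \<delta>" for x
  proof -
    have "cos \<bar>x\<bar> \<le> cos \<delta>" using that \<delta> by (intro cos_le_cos_band) auto
    hence x: "cos x \<le> cos \<delta>" by simp
    have "pw n (\<lambda>_. 1) x \<le> 2 / (1 - cos x)" using x c by (intro pw_one_le) auto
    also have "\<dots> \<le> 2 / (1 - cos \<delta>)" using x c by (intro divide_left_mono) auto
    finally show ?thesis .
  qed
  have "pw n (\<lambda>_. 1) (l - u) + pw n (\<lambda>_. 1) (l + u) \<le> 2 / (1 - cos \<delta>) + 2 / (1 - cos \<delta>)"
    using \<delta>(2) b by (intro add_mono *) (auto split: abs_split)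
  hence "fker n l u \<le> (2 / (1 - cos \<delta>) + 2 / (1 - cos \<delta>)) / (4 * pi * real n)"
    unfolding fker_pw by (intro divide_right_mono) auto
  also have "\<dots> = 1 / (pi * real n * (1 - cos \<delta>))"
  proof -
    have "(2 / d + 2 / d) / (4 * pi * real n) = 1 / (pi * real n * d)" if "0 < d" for d
      using that by (cases "n = 0") (simp_all add: field_simps)
    thus ?thesis using c by blast
  qed
  finally show ?thesis .
qed

lemma integrable_fm_fker: "integrable fm v \<Longrightarrow> integrable fm (\<lambda>u. fker n l u * v u)"
  using integrable_fm_mult[of v "fker n l" "real n"] fker_le_n fker_nonneg
  by (simp add: mult.commute)

lemma fej_one: "0 < n \<Longrightarrow> fej n (\<lambda>_. 1) l = 1"
  by (simp add: fej_def tp_one if_distrib cong: if_cong)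

lemma integral_fker:
  assumes "0 < n"
  shows "(\<integral>u. fker n l u \<partial>fm) = 1"
  using fej_eq_integral[of "\<lambda>_. 1" n l] fej_one[OF assms, of l] by simp

lemma measure_fm: "measure fm freqs = 2 * pi"
  using integral_fm_cos[of 0] by simp

text \<open>Explicit in the bound K and the oscillation of w near l and -l, so that it applies
  uniformly to a class of functions. Off the band the integrand is at most 2K times the bound of
  \<open>fker_le\<close>, and the total length is \<open>2 * pi\<close>.\<close>

lemma fej_approx:
  assumes n: "0 < n" and w: "w \<in> borel_measurable fm" "\<And>u. u \<in> freqs \<Longrightarrow> \<bar>w u\<bar> \<le> K"
    and l: "l \<in> freqs" and \<delta>: "0 < \<delta>" "\<delta> \<le> pi" and \<eta>: "0 \<le> \<eta>"
    and near: "\<And>u. u \<in> freqs \<Longrightarrow> \<bar>\<bar>u\<bar> - \<bar>l\<bar>\<bar> < \<delta> \<Longrightarrow> \<bar>w u - w l\<bar> \<le> \<eta>"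
  shows "\<bar>fej n w l - w l\<bar> \<le> \<eta> + 4 * K / (real n * (1 - cos \<delta>))"
proof -
  have c: "0 < 1 - cos \<delta>" using cos_monotone_0_pi[of 0 \<delta>] \<delta> by simp
  have K: "0 \<le> K" using w(2)[OF l] by linarith
  have iw: "integrable fm w" by (rule integrable_fm_bounded[OF w])
  let ?B = "2 * K / (pi * real n * (1 - cos \<delta>))"
  have i1: "integrable fm (fker n l)"
    using integrable_fm_fker[of "\<lambda>_. 1"] by simp
  have i2: "integrable fm (\<lambda>u. fker n l u * (w u - w l))"
    using iw by (intro integrable_fm_fker) auto
  have "fej n w l - w l = (\<integral>u. fker n l u * w u \<partial>fm) - (\<integral>u. fker n l u * w l \<partial>fm)"
    by (simp add: fej_eq_integral[OF iw] integral_fker[OF n])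
  also have "\<dots> = (\<integral>u. fker n l u * (w u - w l) \<partial>fm)"
    using integrable_fm_fker[OF iw, of n l] i1
    by (subst Bochner_Integration.integral_diff[symmetric]) (auto simp: algebra_simps)
  finally have "\<bar>fej n w l - w l\<bar> \<le> (\<integral>u. \<bar>fker n l u * (w u - w l)\<bar> \<partial>fm)"
    using integral_abs_bound[of fm "\<lambda>u. fker n l u * (w u - w l)"] by simp
  also have "\<dots> \<le> (\<integral>u. fker n l u * \<eta> + ?B \<partial>fm)"
  proof (rule integral_mono)
    show "integrable fm (\<lambda>u. \<bar>fker n l u * (w u - w l)\<bar>)" using i2 by auto
    show "integrable fm (\<lambda>u. fker n l u * \<eta> + ?B)" using i1 by auto
  next
    fix u assume "u \<in> space fm"
    hence u: "u \<in> freqs" by simp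
    have B: "0 \<le> ?B" using K c by simp
    show "\<bar>fker n l u * (w u - w l)\<bar> \<le> fker n l u * \<eta> + ?B"
    proof (cases "\<bar>\<bar>u\<bar> - \<bar>l\<bar>\<bar> < \<delta>")
      case True
      have "\<bar>fker n l u * (w u - w l)\<bar> \<le> fker n l u * \<eta>"
        using near[OF u True] fker_nonneg[of n l u] by (auto simp: abs_mult intro: mult_left_mono)
      thus ?thesis using B by linarith
    next
      case False
      have "fker n l u * \<bar>w u - w l\<bar> \<le> 1 / (pi * real n * (1 - cos \<delta>)) * (2 * K)"
        using False w(2)[OF u] w(2)[OF l] fker_nonneg[of n l u] c \<delta>
        by (intro mult_mono fker_le[OF l u]) auto
      hence "\<bar>fker n l u * (w u - w l)\<bar> \<le> ?B"
        using fker_nonneg[of n l u] by (simp add: abs_mult mult_ac)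
      thus ?thesis using fker_nonneg[of n l u] \<eta> by (smt (verit) mult_nonneg_nonneg)
    qed
  qed
  also have "\<dots> = \<eta> + ?B * (2 * pi)"
    using i1 by (subst Bochner_Integration.integral_add) (auto simp: integral_fker[OF n] measure_fm)
  also have "?B * (2 * pi) = 4 * K / (real n * (1 - cos \<delta>))"
    using c n by (simp add: field_simps)
  finally show ?thesis .
qed

text \<open>The trace is a double sum of products of Fourier coefficients; writing one factor as an
  integral and pulling the sum inside leaves the Fejer mean of the other.\<close>

lemma mtr_tp:
  assumes "integrable fm u"
  shows "mtr n (tp u) (tp v) = 2 * pi * real n * (\<integral>l. u l * fej n v l \<partial>fm)"
proof (cases "n = 0")
  case False
  have "2 * pi * real n * (\<integral>l. u l * fej n v l \<partial>fm)
      = (\<integral>l. 2 * pi * real n * (u l * fej n v l) \<partial>fm)"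
    by simp
  also have "\<dots> = (\<integral>l. (\<Sum>j<n. \<Sum>k<n. tp v j k * (u l * cos ((real j - real k) * l))) \<partial>fm)"
  proof (rule Bochner_Integration.integral_cong[OF refl])
    fix l
    have "2 * pi * real n * fej n v l = (\<Sum>j<n. \<Sum>k<n. cos ((real j - real k) * l) * tp v j k)"
      using False by (simp add: fej_def)
    hence "2 * pi * real n * (u l * fej n v l) = u l * (\<Sum>j<n. \<Sum>k<n. cos ((real j - real k) * l) * tp v j k)"
      by (metis mult.left_commute)
    thus "2 * pi * real n * (u l * fej n v l) = (\<Sum>j<n. \<Sum>k<n. tp v j k * (u l * cos ((real j - real k) * l)))"
      by (simp add: sum_distrib_left mult_ac)
  qed
  also have "\<dots> = (\<Sum>j<n. \<Sum>k<n. tp v j k * tp u j k)"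
    unfolding tp_def[of u] using integrable_fm_cos[OF assms]
    by (subst Bochner_Integration.integral_sum, force, intro sum.cong refl,
        subst Bochner_Integration.integral_sum) auto
  finally show ?thesis by (simp add: mtr_def mult.commute)
qed (simp add: mtr_def)

lemma measurable_fej [measurable]: "fej n v \<in> borel_measurable fm"
  unfolding fej_def
  by (intro borel_measurable_divide measurable_fm borel_measurable_continuous_onI continuous_intros)

text \<open>Symmetry of the trace lets the Fejer mean act on the constant 1 instead of v.\<close>

lemma integral_fej:
  assumes "integrable fm v" "0 < n"
  shows "(\<integral>l. fej n v l \<partial>fm) = (\<integral>l. v l \<partial>fm)"
proof -
  have "2 * pi * real n * (\<integral>l. 1 * fej n v l \<partial>fm) = mtr n (tp (\<lambda>_. 1)) (tp v)"
    by (subst mtr_tp) auto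
  also have "\<dots> = mtr n (tp v) (tp (\<lambda>_. 1))"
    by (rule mtr_commute)
  also have "\<dots> = 2 * pi * real n * (\<integral>l. v l * fej n (\<lambda>_. 1) l \<partial>fm)"
    by (rule mtr_tp[OF assms(1)])
  finally show ?thesis using assms(2) by (simp add: fej_one)
qed

lemma fej_bound:
  assumes "w \<in> borel_measurable fm" "\<And>u. u \<in> freqs \<Longrightarrow> \<bar>w u\<bar> \<le> K" "0 < n"
  shows "\<bar>fej n w l\<bar> \<le> K"
proof -
  have iw: "integrable fm w" by (rule integrable_fm_bounded[OF assms(1,2)])
  have i1: "integrable fm (fker n l)"
    using integrable_fm_fker[of "\<lambda>_. 1"] by simp
  have "\<bar>fej n w l\<bar> \<le> (\<integral>u. \<bar>fker n l u * w u\<bar> \<partial>fm)"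
    unfolding fej_eq_integral[OF iw] by (rule integral_abs_bound)
  also have "\<dots> \<le> (\<integral>u. fker n l u * K \<partial>fm)"
  proof (rule integral_mono)
    show "integrable fm (\<lambda>u. \<bar>fker n l u * w u\<bar>)" using integrable_fm_fker[OF iw, of n l] by auto
    show "integrable fm (\<lambda>u. fker n l u * K)" using i1 by auto
  next
    fix u assume "u \<in> space fm"
    thus "\<bar>fker n l u * w u\<bar> \<le> fker n l u * K"
      using assms(2)[of u] fker_nonneg[of n l u] by (auto simp: abs_mult intro!: mult_left_mono)
  qed
  also have "\<dots> = K" by (simp add: integral_fker[OF assms(3)])
  finally show ?thesis .
qed

section \<open>Fejer means of functions with a pole at the origin\<close>

lemma measurable_abs_powr [measurable]: "(\<lambda>v. \<bar>v\<bar> powr a) \<in> borel_measurable fm"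
  by (intro measurable_fm) measurable

lemma integrable_powr:
  assumes "a < 1"
  shows "integrable fm (\<lambda>v. \<bar>v\<bar> powr (- a))"
proof -
  define g where "g = (\<lambda>v::real. if v \<in> {0..pi} then v powr (- a) else 0)"
  have g: "g \<in> borel_measurable borel"
    unfolding g_def by measurable
  have "((\<lambda>v. v powr (- a)) has_integral (pi powr (- a + 1) / (- a + 1))) {0..pi}"
    using assms by (intro has_integral_powr_from_0) auto
  hence "(g has_integral (pi powr (- a + 1) / (- a + 1))) UNIV"
    unfolding g_def by (subst has_integral_restrict_UNIV)
  from nn_integral_has_integral_lborel[OF g _ this]
  have ng: "(\<integral>\<^sup>+v. ennreal (g v) \<partial>lborel) < \<infinity>"
    by (simp add: g_def)
  have ng': "(\<integral>\<^sup>+v. ennreal (g (- v)) \<partial>lborel) < \<infinity>"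
    using ng nn_integral_real_affine[of "\<lambda>v. ennreal (g v)" "-1" 0] g by simp
  have "(\<integral>\<^sup>+v. ennreal (norm (\<bar>v\<bar> powr (- a))) \<partial>fm) = (\<integral>\<^sup>+v\<in>{-pi..pi}. ennreal (norm (\<bar>v\<bar> powr (- a))) \<partial>lborel)"
    by (simp add: nn_integral_fm)
  also have "\<dots> \<le> (\<integral>\<^sup>+v. ennreal (g v) + ennreal (g (- v)) \<partial>lborel)"
    by (intro nn_integral_mono) (auto simp: g_def indicator_def)
  also have "\<dots> = (\<integral>\<^sup>+v. ennreal (g v) \<partial>lborel) + (\<integral>\<^sup>+v. ennreal (g (- v)) \<partial>lborel)"
    using g by (intro nn_integral_add) auto
  also have "\<dots> < \<infinity>" using ng ng' by (simp add: less_top)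
  finally show ?thesis by (intro integrableI_bounded) auto
qed

lemma tp_add:
  assumes "integrable fm u" "integrable fm v"
  shows "tp (\<lambda>x. u x + v x) j k = tp u j k + tp v j k"
  unfolding tp_def using integrable_fm_cos[OF assms(1)] integrable_fm_cos[OF assms(2)]
  by (simp add: distrib_right)

lemma fej_add:
  assumes "integrable fm u" "integrable fm v"
  shows "fej n (\<lambda>x. u x + v x) l = fej n u l + fej n v l"
  by (simp add: fej_def tp_add[OF assms] distrib_left sum.distrib add_divide_distrib)

lemma pi_freqs: "pi \<in> freqs"
  by (simp add: freqs_def)

lemma fej_bound':
  assumes "w \<in> borel_measurable fm" "\<And>u. u \<in> freqs \<Longrightarrow> \<bar>w u\<bar> \<le> K"
  shows "\<bar>fej n w l\<bar> \<le> K"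
proof (cases "n = 0")
  case True
  thus ?thesis using assms(2)[OF pi_freqs] by (simp add: fej_def)
qed (use fej_bound[OF assms] in auto)

text \<open>Fejer means converge at continuity points, uniformly bounded, so that only the part of \<open>v\<close>
  close to \<open>0\<close> needs an argument: there \<open>\<bar>l\<bar> powr - a * \<bar>x\<bar> powr - b\<close> is at most
  \<open>\<bar>l\<bar> powr - (a + b) + \<bar>x\<bar> powr - (a + b)\<close>, and each summand integrates against the kernel.\<close>

lemma limsup_integral_fej:
  assumes u: "u \<in> borel_measurable fm" "\<And>l. l \<in> freqs \<Longrightarrow> 0 \<le> u l \<and> u l \<le> C * \<bar>l\<bar> powr (- a)"
    and v: "continuous_on freqs v" "\<And>l. l \<in> freqs \<Longrightarrow> 0 \<le> v l \<and> v l \<le> C * \<bar>l\<bar> powr (- b)"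
      "\<And>l. l \<in> freqs \<Longrightarrow> v (- l) = v l"
    and ab: "0 \<le> a" "0 \<le> b" "a + b < 1" and \<eta>: "0 < \<eta>"
  shows "\<forall>\<^sub>F n in sequentially. (\<integral>l. u l * fej n v l \<partial>fm) \<le> (\<integral>l. u l * v l \<partial>fm) + \<eta>"
proof -
  have vm: "v \<in> borel_measurable fm" by (rule measurable_fm_continuous[OF v(1)])
  have C: "0 \<le> C"
    using u(2)[OF pi_freqs] order_trans[of 0 "u pi" "C * pi powr (- a)"] by (auto simp: zero_le_mult_iff)
  define s where "s = a + b"
  \<comment> \<open>Half of the room left by \<open>a + b < 1\<close>: the power with exponent
    \<open>- (s + \<sigma>)\<close> is still integrable, with integral J, and on
    \<open>\<bar>x\<bar> < \<delta>\<close> the passage to it gains a factor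
    \<open>\<delta> powr \<sigma>\<close>.\<close>
  define \<sigma> where "\<sigma> = (1 - s) / 2"
  have \<sigma>: "0 < \<sigma>" "s + \<sigma> < 1" using ab by (auto simp: \<sigma>_def s_def field_simps)
  define J where "J = (\<integral>l. \<bar>l\<bar> powr (- (s + \<sigma>)) \<partial>fm)"
  have J: "0 \<le> J" unfolding J_def by simp
  \<comment> \<open>Chosen so that the part of v within \<delta> of the origin contributes at most
    \<open>\<eta> / 2\<close>, whatever n is.\<close>
  define \<delta> where "\<delta> = min pi ((\<eta> / (4 * (C * C * J + 1))) powr (1 / \<sigma>))"
  have pos1: "0 < C * C * J + 1" using C J by (simp add: add_nonneg_pos)
  have \<delta>: "0 < \<delta>" "\<delta> \<le> pi" using \<eta> pos1 by (auto simp: \<delta>_def)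
  have "\<delta> powr \<sigma> \<le> ((\<eta> / (4 * (C * C * J + 1))) powr (1 / \<sigma>)) powr \<sigma>"
    using \<delta> \<sigma> by (intro powr_mono2) (auto simp: \<delta>_def)
  also have "\<dots> = \<eta> / (4 * (C * C * J + 1))" using \<sigma> \<eta> pos1 by (simp add: powr_powr)
  finally have "\<delta> powr \<sigma> * (4 * (C * C * J + 1)) \<le> \<eta>" using pos1 by (simp add: field_simps)
  hence small: "2 * (C * C * (\<delta> powr \<sigma> * J)) \<le> \<eta> / 2"
    by (simp add: algebra_simps) (smt (verit) powr_ge_zero)
  \<comment> \<open>The cut makes w bounded at the price of a possible jump at \<delta> and
    -\<delta>, a null set that \<open>cv\<close> leaves out. The remainder r is estimated uniformly
    in n in \<open>R\<close>.\<close>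
  define w where "w = (\<lambda>x. if \<delta> \<le> \<bar>x\<bar> then v x else 0)"
  define r where "r = (\<lambda>x. if \<delta> \<le> \<bar>x\<bar> then 0 else v x)"
  define \<psi> where "\<psi> = (\<lambda>x::real. if \<delta> \<le> \<bar>x\<bar> then 0 else \<bar>x\<bar> powr (- s))"
  have [measurable]: "w \<in> borel_measurable fm" "r \<in> borel_measurable fm" "\<psi> \<in> borel_measurable fm"
    unfolding w_def r_def \<psi>_def using vm by (auto intro!: measurable_If measurable_fm)
  have vwr: "v = (\<lambda>x. w x + r x)" by (auto simp: w_def r_def fun_eq_iff)
  define K where "K = C * \<delta> powr (- b)"
  have w_le: "\<bar>w x\<bar> \<le> K" if "x \<in> freqs" for x
  proof (cases "\<delta> \<le> \<bar>x\<bar>")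
    case True
    have "v x \<le> C * \<bar>x\<bar> powr (- b)" using v(2)[OF that] by simp
    also have "\<dots> \<le> K" unfolding K_def using C True \<delta> ab by (intro mult_left_mono powr_mono2') auto
    finally show ?thesis using v(2)[OF that] True by (simp add: w_def)
  qed (use C in \<open>simp add: w_def K_def\<close>)
  have iw: "integrable fm w" by (rule integrable_fm_bounded[OF _ w_le]) auto
  have iu: "integrable fm u"
  proof (rule Bochner_Integration.integrable_bound)
    show "integrable fm (\<lambda>l. C * \<bar>l\<bar> powr (- a))" using ab by (intro integrable_mult_right integrable_powr) auto
    show "AE x in fm. norm (u x) \<le> norm (C * \<bar>x\<bar> powr (- a))"
      using u(2) C by (intro AE_I2) (fastforce simp: abs_mult)
  qed (rule u(1))
  have iv: "integrable fm v"
  proof (rule Bochner_Integration.integrable_bound)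
    show "integrable fm (\<lambda>l. C * \<bar>l\<bar> powr (- b))" using ab by (intro integrable_mult_right integrable_powr) auto
    show "AE x in fm. norm (v x) \<le> norm (C * \<bar>x\<bar> powr (- b))"
      using v(2) C by (intro AE_I2) (fastforce simp: abs_mult)
  qed (rule vm)
  have r_le: "0 \<le> r x \<and> r x \<le> v x" if "x \<in> freqs" for x
    using v(2)[OF that] by (simp add: r_def)
  have ir: "integrable fm r"
    using r_le by (intro Bochner_Integration.integrable_bound[OF iv]) (fastforce intro!: AE_I2)+
  have \<psi>_le: "0 \<le> \<psi> x \<and> \<psi> x \<le> \<delta> powr \<sigma> * \<bar>x\<bar> powr (- (s + \<sigma>))" if "x \<in> freqs" for x
  proof (cases "\<delta> \<le> \<bar>x\<bar>")
    case False
    have "\<bar>x\<bar> powr (\<sigma> + (- (s + \<sigma>))) = \<bar>x\<bar> powr \<sigma> * \<bar>x\<bar> powr (- (s + \<sigma>))"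
      by (rule powr_add)
    hence "\<bar>x\<bar> powr (- s) = \<bar>x\<bar> powr \<sigma> * \<bar>x\<bar> powr (- (s + \<sigma>))"
      by simp
    also have "\<dots> \<le> \<delta> powr \<sigma> * \<bar>x\<bar> powr (- (s + \<sigma>))"
      using False \<sigma> by (intro mult_right_mono powr_mono2) auto
    finally show ?thesis using False by (simp add: \<psi>_def)
  qed (simp add: \<psi>_def)
  have iJ: "integrable fm (\<lambda>x. \<delta> powr \<sigma> * \<bar>x\<bar> powr (- (s + \<sigma>)))"
    using \<sigma> by (intro integrable_mult_right integrable_powr) auto
  have i\<psi>: "integrable fm \<psi>"
    using \<psi>_le by (intro Bochner_Integration.integrable_bound[OF iJ]) (fastforce intro!: AE_I2)+
  have "(\<integral>x. \<psi> x \<partial>fm) \<le> (\<integral>x. \<delta> powr \<sigma> * \<bar>x\<bar> powr (- (s + \<sigma>)) \<partial>fm)"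
    using \<psi>_le by (intro integral_mono i\<psi> iJ) auto
  hence int\<psi>: "(\<integral>x. \<psi> x \<partial>fm) \<le> \<delta> powr \<sigma> * J" by (simp add: J_def)
  have ur: "u l * r x \<le> C * C * (\<psi> l + \<psi> x)" if lx: "l \<in> freqs" "x \<in> freqs" for l x
  proof (cases "\<delta> \<le> \<bar>x\<bar>")
    case True
    thus ?thesis using C lx \<psi>_le by (simp add: r_def)
  next
    case False
    have nz: "0 < \<bar>l\<bar>" "0 < \<bar>x\<bar>" using lx by (auto simp: freqs_def)
    have "u l * r x \<le> (C * \<bar>l\<bar> powr (- a)) * (C * \<bar>x\<bar> powr (- b))"
      using u(2)[OF lx(1)] v(2)[OF lx(2)] False C by (intro mult_mono) (auto simp: r_def)
    also have "\<dots> = C * C * (\<bar>l\<bar> powr (- a) * \<bar>x\<bar> powr (- b))" by simp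
    also have "\<bar>l\<bar> powr (- a) * \<bar>x\<bar> powr (- b) \<le> \<psi> l + \<psi> x"
    proof (cases "\<bar>l\<bar> < \<bar>x\<bar>")
      case True
      have "\<bar>l\<bar> powr (- a) * \<bar>x\<bar> powr (- b) \<le> \<bar>l\<bar> powr (- a) * \<bar>l\<bar> powr (- b)"
        using True nz ab by (intro mult_left_mono powr_mono2') auto
      also have "\<dots> = \<psi> l" using True False by (simp add: \<psi>_def s_def powr_add[symmetric])
      finally show ?thesis using \<psi>_le[OF lx(2)] by linarith
    next
      case l: False
      have "\<bar>l\<bar> powr (- a) * \<bar>x\<bar> powr (- b) \<le> \<bar>x\<bar> powr (- a) * \<bar>x\<bar> powr (- b)"
        using l nz ab by (intro mult_right_mono powr_mono2') auto
      also have "\<dots> = \<psi> x" using False by (simp add: \<psi>_def s_def powr_add[symmetric])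
      finally show ?thesis using \<psi>_le[OF lx(1)] by linarith
    qed
    finally show ?thesis using C by (simp add: mult_left_mono)
  qed
  have ifej: "integrable fm (fej n \<psi>)" for n
    unfolding fej_def
    by (intro integrable_fm_bounded[of _ "(\<Sum>j<n. \<Sum>k<n. \<bar>tp \<psi> j k\<bar>) / (2 * pi * real n)"] measurable_fej[unfolded fej_def])
       (auto intro!: divide_right_mono order_trans[OF sum_abs] sum_mono simp: abs_mult mult_left_le_one_le)
  have iC: "integrable fm (\<lambda>l. C * C * (\<psi> l + fej n \<psi> l))" for n
    using i\<psi> ifej by auto
  have iufej: "integrable fm (\<lambda>l. u l * fej n z l)" for n z
  proof (rule integrable_fm_mult[OF iu])
    show "\<bar>fej n z l\<bar> \<le> (\<Sum>j<n. \<Sum>k<n. \<bar>tp z j k\<bar>) / (2 * pi * real n)" for l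
      unfolding fej_def
      by (auto intro!: divide_right_mono order_trans[OF sum_abs] sum_mono simp: abs_mult mult_left_le_one_le)
  qed auto
  have R: "(\<integral>l. u l * fej n r l \<partial>fm) \<le> \<eta> / 2" if n: "0 < n" for n
  proof -
    have "(\<integral>l. u l * fej n r l \<partial>fm) \<le> (\<integral>l. C * C * (\<psi> l + fej n \<psi> l) \<partial>fm)"
    proof (rule integral_mono[OF iufej iC])
      fix l assume "l \<in> space fm"
      hence l: "l \<in> freqs" by simp
      have "u l * fej n r l = (\<integral>x. fker n l x * (u l * r x) \<partial>fm)"
        by (simp add: fej_eq_integral[OF ir] mult.left_commute)
      also have "\<dots> \<le> (\<integral>x. C * C * (\<psi> l * fker n l x + fker n l x * \<psi> x) \<partial>fm)"
      proof (rule integral_mono)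
        show "integrable fm (\<lambda>x. fker n l x * (u l * r x))" using ir by (intro integrable_fm_fker) auto
        show "integrable fm (\<lambda>x. C * C * (\<psi> l * fker n l x + fker n l x * \<psi> x))"
          using integrable_fm_fker[of "\<lambda>_. 1" n l] integrable_fm_fker[OF i\<psi>, of n l] by auto
      next
        fix x assume "x \<in> space fm"
        hence "fker n l x * (u l * r x) \<le> fker n l x * (C * C * (\<psi> l + \<psi> x))"
          using ur[OF l] fker_nonneg by (intro mult_left_mono) auto
        thus "fker n l x * (u l * r x) \<le> C * C * (\<psi> l * fker n l x + fker n l x * \<psi> x)"
          by (simp add: algebra_simps)
      qed
      also have "\<dots> = C * C * (\<psi> l + fej n \<psi> l)"
        using integrable_fm_fker[of "\<lambda>_. 1" n l] integrable_fm_fker[OF i\<psi>, of n l]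
        by (simp add: fej_eq_integral[OF i\<psi>] integral_fker[OF n])
      finally show "u l * fej n r l \<le> C * C * (\<psi> l + fej n \<psi> l)" .
    qed
    also have "\<dots> = C * C * ((\<integral>l. \<psi> l \<partial>fm) + (\<integral>l. fej n \<psi> l \<partial>fm))"
    proof -
      have "integrable fm (fej n \<psi>)" by (rule ifej)
      thus ?thesis using i\<psi> by simp
    qed
    \<comment> \<open>The Fejer mean preserves the integral, so both summands contribute
      equally.\<close>
    also have "\<dots> = 2 * (C * C * (\<integral>l. \<psi> l \<partial>fm))" by (simp add: integral_fej[OF i\<psi> n])
    also have "\<dots> \<le> 2 * (C * C * (\<delta> powr \<sigma> * J))"
      using int\<psi> C by (intro mult_left_mono) auto
    finally show ?thesis using small by linarith
  qed
  have cv: "(\<lambda>n. fej n w l) \<longlonglongrightarrow> w l" if l: "l \<in> freqs" "\<bar>l\<bar> \<noteq> \<delta>" for l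
  proof (rule LIMSEQ_I)
    fix e :: real assume e: "0 < e"
    have "\<exists>d>0. \<forall>x\<in>freqs. \<bar>\<bar>x\<bar> - \<bar>l\<bar>\<bar> < d \<longrightarrow> \<bar>w x - w l\<bar> \<le> e / 2"
    proof -
      have al: "\<bar>l\<bar> \<in> freqs" using l by (auto simp: freqs_def)
      have va: "v \<bar>x\<bar> = v x" if "x \<in> freqs" for x using v(3)[OF that] by (auto simp: abs_if)
      obtain d where d: "0 < d" "\<forall>x\<in>freqs. dist x \<bar>l\<bar> < d \<longrightarrow> dist (v x) (v \<bar>l\<bar>) < e / 2"
        using v(1) al e unfolding continuous_on_iff by (meson half_gt_zero)
      define d' where "d' = min d \<bar>\<bar>l\<bar> - \<delta>\<bar>"
      have "\<bar>w x - w l\<bar> \<le> e / 2" if x: "x \<in> freqs" "\<bar>\<bar>x\<bar> - \<bar>l\<bar>\<bar> < d'" for x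
      proof -
        have "\<bar>x\<bar> \<in> freqs" using x by (auto simp: freqs_def)
        hence "\<bar>v x - v l\<bar> < e / 2"
          using d(2) x va[OF x(1)] va[OF l(1)] by (auto simp: d'_def dist_real_def)
        moreover have "\<delta> \<le> \<bar>x\<bar> \<longleftrightarrow> \<delta> \<le> \<bar>l\<bar>" 
        proof -
          have "\<bar>\<bar>x\<bar> - \<bar>l\<bar>\<bar> < \<bar>\<bar>l\<bar> - \<delta>\<bar>" using x(2) by (simp add: d'_def)
          thus ?thesis by (smt (verit))
        qed
        ultimately show ?thesis using e by (simp add: w_def)
      qed
      moreover have "0 < d'" using d l by (simp add: d'_def)
      ultimately show ?thesis by blast
    qed
    then obtain d where d: "0 < d" "\<forall>x\<in>freqs. \<bar>\<bar>x\<bar> - \<bar>l\<bar>\<bar> < d \<longrightarrow> \<bar>w x - w l\<bar> \<le> e / 2" by blast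
    define d' where "d' = min d pi"
    have d': "0 < d'" "d' \<le> pi" using d by (auto simp: d'_def)
    have c: "0 < 1 - cos d'" using cos_monotone_0_pi[of 0 d'] d' by simp
    obtain N where N: "8 * K / (e * (1 - cos d')) < real N" using reals_Archimedean2 by blast
    have "norm (fej n w l - w l) < e" if n: "Suc N \<le> n" for n
    proof -
      have "\<bar>fej n w l - w l\<bar> \<le> e / 2 + 4 * K / (real n * (1 - cos d'))"
        using n d(2) e d' by (intro fej_approx w_le l) (auto simp: d'_def)
      also have "4 * K / (real n * (1 - cos d')) < e / 2"
      proof -
        have "8 * K / (e * (1 - cos d')) < real n" using N n by linarith
        thus ?thesis using c e n by (simp add: field_simps)
      qed
      finally show ?thesis by simp
    qed
    thus "\<exists>no. \<forall>n\<ge>no. norm (fej n w l - w l) < e" by blast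
  qed
  have lim: "(\<lambda>n. \<integral>l. u l * fej n w l \<partial>fm) \<longlonglongrightarrow> (\<integral>l. u l * w l \<partial>fm)"
  proof (rule integral_dominated_convergence)
    show "integrable fm (\<lambda>l. K * u l)" using iu by auto
    have "AE l in lborel. l \<noteq> \<delta> \<and> l \<noteq> - \<delta>"
      using AE_lborel_singleton[of \<delta>] AE_lborel_singleton[of "- \<delta>"] by eventually_elim auto
    hence "AE l in fm. l \<noteq> \<delta> \<and> l \<noteq> - \<delta>"
      unfolding fm_def by (subst AE_restrict_space_iff) (auto simp: freqs_def)
    thus "AE l in fm. (\<lambda>n. u l * fej n w l) \<longlonglongrightarrow> u l * w l"
      using AE_space[of fm]
    proof eventually_elim
      case (elim l)
      show ?case using elim by (intro tendsto_mult tendsto_const cv) (auto simp: abs_if split: if_splits)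
    qed
    show "AE l in fm. norm (u l * fej n w l) \<le> K * u l" for n
    proof (intro AE_I2)
      fix l assume "l \<in> space fm"
      hence "0 \<le> u l" using u(2) by simp
      thus "norm (u l * fej n w l) \<le> K * u l"
        using fej_bound'[of w K n l] w_le by (simp add: abs_mult mult.commute[of K] mult_left_mono)
    qed
  qed (use u(1) in auto)
  have iuw: "integrable fm (\<lambda>l. u l * w l)" using w_le by (intro integrable_fm_mult[OF iu]) auto
  have iuv: "integrable fm (\<lambda>l. u l * v l)"
  proof (rule Bochner_Integration.integrable_bound)
    show "integrable fm (\<lambda>l. C * C * \<bar>l\<bar> powr (- s))" using ab by (intro integrable_mult_right integrable_powr) (auto simp: s_def)
    show "AE x in fm. norm (u x * v x) \<le> norm (C * C * \<bar>x\<bar> powr (- s))"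
    proof (intro AE_I2)
      fix x assume "x \<in> space fm"
      hence x: "x \<in> freqs" by simp
      have "u x * v x \<le> (C * \<bar>x\<bar> powr (- a)) * (C * \<bar>x\<bar> powr (- b))"
        using u(2)[OF x] v(2)[OF x] C by (intro mult_mono) auto
      also have "\<dots> = C * C * \<bar>x\<bar> powr (- s)" by (simp add: s_def powr_add[symmetric])
      finally show "norm (u x * v x) \<le> norm (C * C * \<bar>x\<bar> powr (- s))"
        using u(2)[OF x] v(2)[OF x] C by (simp add: abs_mult)
    qed
  qed (use u vm in auto)
  have "(\<integral>l. u l * w l \<partial>fm) \<le> (\<integral>l. u l * v l \<partial>fm)"
    using u(2) v(2) by (intro integral_mono iuw iuv mult_left_mono) (auto simp: w_def)
  hence "(\<integral>l. u l * w l \<partial>fm) < (\<integral>l. u l * v l \<partial>fm) + \<eta> / 2" using \<eta> by linarith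
  hence "\<forall>\<^sub>F n in sequentially. (\<integral>l. u l * fej n w l \<partial>fm) < (\<integral>l. u l * v l \<partial>fm) + \<eta> / 2"
    by (rule order_tendstoD(2)[OF lim])
  thus ?thesis using eventually_gt_at_top[of 0]
  proof eventually_elim
    case (elim n)
    have "(\<integral>l. u l * fej n v l \<partial>fm) = (\<integral>l. u l * fej n w l + u l * fej n r l \<partial>fm)"
      by (subst vwr) (simp add: fej_add[OF iw ir] distrib_left)
    also have "\<dots> = (\<integral>l. u l * fej n w l \<partial>fm) + (\<integral>l. u l * fej n r l \<partial>fm)"
      by (intro Bochner_Integration.integral_add iufej)
    finally show ?case using elim(1) R[OF elim(2)] by linarith
  qed
qed

section \<open>Densities of power type\<close>

text \<open>The part of membership in either function class on which the trace and tail bounds rest.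
  The modulus of continuity is kept apart, and the exponent is an argument because it varies over
  the model while m and M do not.\<close>

definition reg :: "real \<Rightarrow> real \<Rightarrow> real \<Rightarrow> (real \<Rightarrow> real) \<Rightarrow> bool" where
  "reg m M d f \<longleftrightarrow> 0 < m \<and> -1/2 < d \<and> d < 1/2 \<and> continuous_on freqs f \<and>
     (\<forall>v\<in>freqs. f (- v) = f v \<and> m * \<bar>v\<bar> powr (- 2 * d) \<le> f v \<and> f v \<le> M * \<bar>v\<bar> powr (- 2 * d))"

lemma freqs_abs: "v \<in> freqs \<Longrightarrow> 0 < \<bar>v\<bar> \<and> \<bar>v\<bar> \<le> pi"
  by (auto simp: freqs_def)

lemma reg_pos: "reg m M d f \<Longrightarrow> v \<in> freqs \<Longrightarrow> 0 < f v"
  using freqs_abs[of v] by (force simp: reg_def intro: less_le_trans[of 0 "m * \<bar>v\<bar> powr (- 2 * d)"])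

lemma reg_le: "reg m M d f \<Longrightarrow> v \<in> freqs \<Longrightarrow> f v \<le> M * \<bar>v\<bar> powr (- 2 * d)"
  and reg_ge: "reg m M d f \<Longrightarrow> v \<in> freqs \<Longrightarrow> m * \<bar>v\<bar> powr (- 2 * d) \<le> f v"
  by (auto simp: reg_def)

lemma reg_const:
  assumes "reg m M d f"
  shows "0 < m" "m \<le> M" "0 < M"
proof -
  show "0 < m" using assms by (simp add: reg_def)
  have "m * \<bar>pi\<bar> powr (- 2 * d) \<le> M * \<bar>pi\<bar> powr (- 2 * d)"
    by (rule order_trans[OF reg_ge[OF assms pi_freqs] reg_le[OF assms pi_freqs]])
  thus "m \<le> M" by simp
  with \<open>0 < m\<close> show "0 < M" by linarith
qed

lemma reg_measurable: "reg m M d f \<Longrightarrow> f \<in> borel_measurable fm"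
  by (intro measurable_fm_continuous) (simp add: reg_def)

lemma reg_inverse:
  assumes "reg m M d f"
  shows "reg (1 / M) (1 / m) (- d) (\<lambda>v. 1 / f v)"
  unfolding reg_def
proof (intro conjI ballI)
  note c = reg_const[OF assms]
  show "0 < 1 / M" "- 1 / 2 < - d" "- d < 1 / 2" using c assms by (auto simp: reg_def)
  show "continuous_on freqs (\<lambda>v. 1 / f v)"
    using assms reg_pos[OF assms] by (intro continuous_intros) (force simp: reg_def)+
  fix v assume v: "v \<in> freqs"
  note p = reg_pos[OF assms v]
  have q: "0 < \<bar>v\<bar> powr (2 * d)" using freqs_abs[OF v] by simp
  show "1 / f (- v) = 1 / f v" using assms v by (simp add: reg_def)
  have "f v * \<bar>v\<bar> powr (2 * d) \<le> M * (\<bar>v\<bar> powr (- 2 * d) * \<bar>v\<bar> powr (2 * d))"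
    using reg_le[OF assms v] q by (simp add: mult.assoc[symmetric])
  hence "f v * \<bar>v\<bar> powr (2 * d) \<le> M"
    using freqs_abs[OF v] by (simp add: powr_add[symmetric])
  thus "1 / M * \<bar>v\<bar> powr (- 2 * - d) \<le> 1 / f v" using p c by (simp add: field_simps)
  have "m * (\<bar>v\<bar> powr (- 2 * d) * \<bar>v\<bar> powr (2 * d)) \<le> f v * \<bar>v\<bar> powr (2 * d)"
    using reg_ge[OF assms v] q by (simp add: mult.assoc[symmetric])
  hence "m \<le> f v * \<bar>v\<bar> powr (2 * d)"
    using freqs_abs[OF v] by (simp add: powr_add[symmetric])
  thus "1 / f v \<le> 1 / m * \<bar>v\<bar> powr (- 2 * - d)" using p c by (simp add: field_simps)
qed

text \<open>The source of the factors 16: \<open>\<bar>v\<bar> \<le> pi < 4\<close>, and the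
  exponents differ by at most 2. It lowers an exponent without a case distinction at
  \<open>\<bar>v\<bar> = 1\<close>.\<close>

lemma abs_powr_le:
  assumes "v \<in> freqs" "p \<le> q" "q \<le> p + 2"
  shows "\<bar>v\<bar> powr q \<le> 16 * \<bar>v\<bar> powr p"
proof -
  have "\<bar>v\<bar> powr q = \<bar>v\<bar> powr (q - p) * \<bar>v\<bar> powr p"
    by (simp add: powr_add[symmetric])
  also have "\<bar>v\<bar> powr (q - p) \<le> pi powr (q - p)"
    using freqs_abs[OF assms(1)] assms by (intro powr_mono2) auto
  also have "pi powr (q - p) \<le> 4 powr (q - p)"
    using pi_less_4 assms by (intro powr_mono2) auto
  also have "4 powr (q - p) \<le> (4::real) powr 2"
    using assms by (intro powr_mono) auto
  finally show ?thesis by (simp add: mult_right_mono)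
qed

lemma reg_upper:
  assumes "reg m M d f" "v \<in> freqs"
  shows "f v \<le> 16 * M * \<bar>v\<bar> powr (- (max (2 * d) 0))"
proof -
  have "f v \<le> M * \<bar>v\<bar> powr (- 2 * d)" by (rule reg_le[OF assms])
  also have "\<dots> \<le> M * (16 * \<bar>v\<bar> powr (- (max (2 * d) 0)))"
    using assms reg_const[OF assms(1)]
    by (intro mult_left_mono abs_powr_le) (auto simp: reg_def max_def)
  finally show ?thesis by simp
qed

lemma reg_integrable:
  assumes "reg m M d f"
  shows "integrable fm f"
proof (rule Bochner_Integration.integrable_bound)
  show "integrable fm (\<lambda>v. 16 * M * \<bar>v\<bar> powr (- (max (2 * d) 0)))"
    using assms by (intro integrable_mult_right integrable_powr) (auto simp: reg_def)
  show "AE v in fm. norm (f v) \<le> norm (16 * M * \<bar>v\<bar> powr (- (max (2 * d) 0)))"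
    using reg_upper[OF assms] reg_pos[OF assms] by (intro AE_I2) (fastforce intro: order_trans[OF _ abs_ge_self])
qed (rule reg_measurable[OF assms])

section \<open>Traces and extremal quadratic forms of Toeplitz matrices\<close>

lemma mtr_finv_limsup:
  assumes f: "reg m1 M1 d1 f" and g: "reg m2 M2 d2 g" and d: "d1 - d2 < 1/2" and \<eta>: "0 < \<eta>"
  shows "\<forall>\<^sub>F n in sequentially. mtr n (tp f) (finv n (tp g)) \<le> real n * ((\<integral>v. f v / g v \<partial>fm) / (2 * pi) + \<eta>)"
proof -
  note g' = reg_inverse[OF g]
  \<comment> \<open>A pole at the origin comes from f when its exponent is positive and from 1/g
    when that of g is negative. The maxima with 0 make both powers admissible for
    \<open>limsup_integral_fej\<close>; if both are positive, it is \<open>d1 - d2 < 1/2\<close>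
    that keeps their sum below 1.\<close>
  define C where "C = max (16 * M1) (16 * (1 / m2))"
  have "\<forall>\<^sub>F n in sequentially. (\<integral>l. f l * fej n (\<lambda>v. 1 / g v) l \<partial>fm) \<le> (\<integral>l. f l * (1 / g l) \<partial>fm) + \<eta>"
  proof (rule limsup_integral_fej[where C = C])
    show "f \<in> borel_measurable fm" by (rule reg_measurable[OF f])
    show "0 \<le> f l \<and> f l \<le> C * \<bar>l\<bar> powr (- max (2 * d1) 0)" if "l \<in> freqs" for l
    proof -
      have "f l \<le> 16 * M1 * \<bar>l\<bar> powr (- (max (2 * d1) 0))" by (rule reg_upper[OF f that])
      also have "\<dots> \<le> C * \<bar>l\<bar> powr (- (max (2 * d1) 0))" by (intro mult_right_mono) (auto simp: C_def)
      finally show ?thesis using reg_pos[OF f that] by simp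
    qed
    show "0 \<le> 1 / g l \<and> 1 / g l \<le> C * \<bar>l\<bar> powr (- max (2 * - d2) 0)" if "l \<in> freqs" for l
    proof -
      have "1 / g l \<le> 16 * (1 / m2) * \<bar>l\<bar> powr (- (max (2 * - d2) 0))" by (rule reg_upper[OF g' that])
      also have "\<dots> \<le> C * \<bar>l\<bar> powr (- (max (2 * - d2) 0))" by (intro mult_right_mono) (auto simp: C_def)
      finally show ?thesis using reg_pos[OF g that] by simp
    qed
    show "continuous_on freqs (\<lambda>v. 1 / g v)" "\<And>l. l \<in> freqs \<Longrightarrow> 1 / g (- l) = 1 / g l"
      using g' by (auto simp: reg_def)
    show "max (2 * d1) 0 + max (2 * - d2) 0 < 1" using d f g by (auto simp: reg_def max_def)
  qed (use \<eta> in auto)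
  thus ?thesis
  proof eventually_elim
    case (elim n)
    have "mtr n (tp f) (finv n (tp g)) \<le> 1 / (4 * pi\<^sup>2) * mtr n (tp f) (tp (\<lambda>v. 1 / g v))"
      using reg_integrable[OF f] reg_pos[OF f] reg_integrable[OF g] reg_pos[OF g] reg_integrable[OF g']
      by (intro mtr_mono pos_def_tp finv_tp_le)
    also have "\<dots> = real n / (2 * pi) * (\<integral>l. f l * fej n (\<lambda>v. 1 / g v) l \<partial>fm)"
      by (simp add: mtr_tp[OF reg_integrable[OF f]] power2_eq_square)
    also have "\<dots> \<le> real n / (2 * pi) * ((\<integral>l. f l * (1 / g l) \<partial>fm) + \<eta>)"
      using elim by (intro mult_left_mono) auto
    also have "\<dots> = real n * ((\<integral>v. f v / g v \<partial>fm) / (2 * pi) + \<eta> / (2 * pi))"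
      by (simp add: field_simps)
    also have "\<dots> \<le> real n * ((\<integral>v. f v / g v \<partial>fm) / (2 * pi) + \<eta>)"
      using \<eta> pi_gt3 by (intro mult_left_mono add_left_mono) (auto simp: field_simps)
    finally show ?case .
  qed
qed

text \<open>The density may vanish at the origin, but not faster than a multiple of \<bar>v\<bar>.
  On \<open>\<bar>v\<bar> \<le> 1 / n\<close>, where \<open>pw n x\<close> is at most n times the
  squared norm q of x, at most 2q of the total mass \<open>2 * pi * q\<close> is lost; elsewhere f
  is at least \<open>m / (16 * n)\<close>.\<close>

lemma qf_tp_lower:
  assumes f: "reg m M d f" and n: "0 < n"
  shows "m / (8 * real n) * (\<Sum>j<n. (x j)\<^sup>2) \<le> qf n (tp f) x"
proof -
  define q where "q = (\<Sum>j<n. (x j)\<^sup>2)"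
  define c where "c = m / (16 * real n)"
  define I where "I = (\<lambda>v::real. indicator {- (1 / real n)..1 / real n} v :: real)"
  have q: "0 \<le> q" by (auto simp: q_def intro: sum_nonneg)
  have m: "0 < m" by (rule reg_const[OF f])
  have [measurable]: "I \<in> borel_measurable fm" unfolding I_def by measurable
  have iI: "integrable fm I" by (rule integrable_fm_bounded[of _ 1]) (auto simp: I_def indicator_def)
  have "(\<integral>v. I v \<partial>fm) \<le> 2 / real n"
  proof -
    have "(\<integral>v. I v \<partial>fm) = measure fm ({- (1 / real n)..1 / real n} \<inter> freqs)"
      unfolding I_def using Bochner_Integration.integral_indicator[of fm "{- (1 / real n)..1 / real n}"] by simp
    also have "\<dots> = measure lborel ({- (1 / real n)..1 / real n} \<inter> freqs)"
      unfolding fm_def by (rule measure_restrict_space) auto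
    also have "\<dots> \<le> measure lborel {- (1 / real n)..1 / real n}"
      by (rule measure_mono_fmeasurable) (auto simp: fmeasurable_def emeasure_lborel_Icc_eq)
    also have "\<dots> = 2 / real n" by simp
    finally show ?thesis .
  qed
  hence I2: "(\<integral>v. real n * q * I v \<partial>fm) \<le> 2 * q"
    using mult_left_mono[of "\<integral>v. I v \<partial>fm" "2 / real n" "real n * q"] q n by simp
  have "c * (2 * q) \<le> c * (2 * pi * q - 2 * q)"
    using m n q pi_gt3 by (intro mult_left_mono) (auto simp: c_def algebra_simps intro!: mult_right_mono[of 2 pi q, simplified])
  also have "\<dots> \<le> c * ((\<integral>v. pw n x v \<partial>fm) - (\<integral>v. real n * q * I v \<partial>fm))"
    using I2 m by (intro mult_left_mono) (auto simp: integral_pw q_def c_def)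
  also have "\<dots> = (\<integral>v. c * (pw n x v - real n * q * I v) \<partial>fm)"
    using iI integrable_pw[of n x] by simp
  also have "\<dots> \<le> (\<integral>v. f v * pw n x v \<partial>fm)"
  proof (rule integral_mono)
    show "integrable fm (\<lambda>v. c * (pw n x v - real n * q * I v))"
      using iI integrable_pw[of n x] by auto
    show "integrable fm (\<lambda>v. f v * pw n x v)"
      by (rule integrable_fm_pw[OF reg_integrable[OF f]])
  next
    fix v assume "v \<in> space fm"
    hence v: "v \<in> freqs" by simp
    note fp = reg_pos[OF f v]
    show "c * (pw n x v - real n * q * I v) \<le> f v * pw n x v"
    proof (cases "\<bar>v\<bar> \<le> 1 / real n")
      case True
      hence "I v = 1" by (simp add: I_def indicator_def abs_le_iff)
      hence "pw n x v - real n * q * I v \<le> 0"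
        using pw_le[of n x v] by (simp add: q_def)
      moreover have "0 \<le> c" using m by (simp add: c_def)
      ultimately have "c * (pw n x v - real n * q * I v) \<le> 0"
        by (intro mult_nonneg_nonpos)
      thus ?thesis using fp pw_nonneg[of n x v] by (simp add: order_trans[OF _ mult_nonneg_nonneg])
    next
      case False
      hence I0: "I v = 0" by (auto simp: I_def indicator_def abs_le_iff)
      have "\<bar>v\<bar> powr 1 \<le> 16 * \<bar>v\<bar> powr (- 2 * d)"
        using f by (intro abs_powr_le v) (auto simp: reg_def)
      hence "1 / real n \<le> 16 * \<bar>v\<bar> powr (- 2 * d)" using False freqs_abs[OF v] by simp
      hence "m * (1 / real n) \<le> m * (16 * \<bar>v\<bar> powr (- 2 * d))" using m by (intro mult_left_mono) auto
      hence "c \<le> m * \<bar>v\<bar> powr (- 2 * d)" using n by (simp add: c_def field_simps)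
      hence "c \<le> f v" using reg_ge[OF f v] by linarith
      thus ?thesis using pw_nonneg[of n x v] I0 by (simp add: mult_right_mono)
    qed
  qed
  finally show ?thesis
    unfolding qf_tp[OF reg_integrable[OF f]] q_def[symmetric] by (simp add: c_def)
qed

text \<open>The ratio of the densities may blow up at the origin, so the frequencies are split at r.
  Outside, the ratio is at most a constant times \<open>r powr (- 2 * h)\<close>; inside,
  \<open>f0\<close> has little mass, which is absorbed by the lower bound of order
  \<open>1 / n\<close> for the form of f.\<close>

lemma qf_tp_le_sqrt:
  assumes f0: "reg m0 M0 d0 f0" and f: "reg m M d f" and close: "\<bar>d0 - d\<bar> \<le> (1 - 2 * d0) / 16"
  shows "\<exists>\<Lambda>>0. \<forall>n>0. \<forall>x. qf n (tp f0) x \<le> \<Lambda> * sqrt (real n) * qf n (tp f) x"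
proof -
  define \<sigma> where "\<sigma> = (1 - 2 * d0) / 2"
  define e where "e = d0 - d"
  define h where "h = \<sigma> / 8"
  have dd: "-1/2 < d0" "d0 < 1/2" using f0 by (auto simp: reg_def)
  have \<sigma>: "0 < \<sigma>" "2 * d0 + \<sigma> < 1" "\<sigma> < 1" using dd by (auto simp: \<sigma>_def field_simps)
  have e: "\<bar>e\<bar> \<le> h" "0 < h" "h \<le> 1/8" using close \<sigma> by (auto simp: e_def h_def \<sigma>_def)
  define J where "J = (\<integral>v. \<bar>v\<bar> powr (- (2 * d0 + \<sigma>)) \<partial>fm)"
  have J: "0 \<le> J" by (simp add: J_def)
  define A where "A = 16 * M0 / m"
  note c0 = reg_const[OF f0] and c = reg_const[OF f]
  have A: "0 < A" using c0 c by (simp add: A_def)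
  define \<Lambda> where "\<Lambda> = A + 8 * M0 * J / m"
  have \<Lambda>: "0 < \<Lambda>" using A J c0 c by (simp add: \<Lambda>_def add_pos_nonneg)
  have "qf n (tp f0) x \<le> \<Lambda> * sqrt (real n) * qf n (tp f) x" if n: "0 < n" for n x
  proof -
    define q where "q = (\<Sum>j<n. (x j)\<^sup>2)"
    have q: "0 \<le> q" by (auto simp: q_def intro: sum_nonneg)
    \<comment> \<open>Balances the two parts: \<open>r powr \<sigma> = 1 / n^2\<close> offsets the
      factor n in \<open>pw_le\<close> and the n lost through \<open>qf_tp_lower\<close>, while
      \<open>r powr (- 2 * h)\<close> with \<open>h = \<sigma> / 8\<close> is exactly
      \<open>sqrt n\<close>. The hypothesis \<open>close\<close> bounds the difference of the
      exponents by this h.\<close>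
    define r where "r = real n powr (- (2 / \<sigma>))"
    have r: "0 < r" "r \<le> 1" using n \<sigma> powr_mono2'[of "- (2 / \<sigma>)" 1 "real n"] by (auto simp: r_def)
    have "r powr \<sigma> = real n powr (- 2)"
      using \<sigma> n by (simp add: r_def powr_powr)
    also have "\<dots> = 1 / (real n)\<^sup>2"
      using n powr_minus_divide[of "real n" 2] by simp
    finally have r\<sigma>: "r powr \<sigma> = 1 / (real n)\<^sup>2" .
    have rh: "r powr (- 2 * h) = sqrt (real n)"
      using \<sigma> n by (simp add: r_def powr_powr h_def powr_half_sqrt)
    have pt: "f0 v \<le> A * sqrt (real n) * f v + M0 * r powr \<sigma> * \<bar>v\<bar> powr (- (2 * d0 + \<sigma>))" if v: "v \<in> freqs" for v
    proof (cases "r \<le> \<bar>v\<bar>")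
      case True
      have "\<bar>v\<bar> powr (- 2 * e) \<le> 16 * r powr (- 2 * h)"
      proof (cases "0 \<le> e")
        case True
        have "\<bar>v\<bar> powr (- 2 * e) \<le> r powr (- 2 * e)"
          using \<open>r \<le> \<bar>v\<bar>\<close> r True by (intro powr_mono2') auto
        also have "\<dots> \<le> r powr (- 2 * h)"
          using r e by (intro powr_mono') auto
        finally show ?thesis using powr_ge_zero[of r "- 2 * h"] by linarith
      next
        case False
        have "\<bar>v\<bar> powr (- 2 * e) \<le> 16 * \<bar>v\<bar> powr 0"
          using False e by (intro abs_powr_le v) auto
        also have "\<bar>v\<bar> powr 0 = r powr 0" using freqs_abs[OF v] r by simp
        also have "r powr 0 \<le> r powr (- 2 * h)"
          using r e by (intro powr_mono') auto
        finally show ?thesis by simp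
      qed
      have "f0 v \<le> M0 * \<bar>v\<bar> powr (- 2 * d0)" by (rule reg_le[OF f0 v])
      also have "\<bar>v\<bar> powr (- 2 * d0) = \<bar>v\<bar> powr (- 2 * e) * \<bar>v\<bar> powr (- 2 * d)"
        by (simp add: powr_add[symmetric] e_def)
      also have "M0 * \<dots> \<le> M0 * ((16 * r powr (- 2 * h)) * (f v / m))"
        using \<open>\<bar>v\<bar> powr (- 2 * e) \<le> _\<close> reg_ge[OF f v] c c0
        by (intro mult_left_mono mult_mono) (auto simp: field_simps)
      also have "\<dots> = A * sqrt (real n) * f v" unfolding rh by (simp add: A_def)
      finally show ?thesis using c0 by (simp add: add_increasing2)
    next
      case False
      have "f0 v \<le> M0 * \<bar>v\<bar> powr (- 2 * d0)" by (rule reg_le[OF f0 v])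
      also have "\<bar>v\<bar> powr (- 2 * d0) = \<bar>v\<bar> powr (\<sigma> + (- (2 * d0 + \<sigma>)))" by simp
      also have "\<dots> = \<bar>v\<bar> powr \<sigma> * \<bar>v\<bar> powr (- (2 * d0 + \<sigma>))" by (rule powr_add)
      also have "\<dots> \<le> r powr \<sigma> * \<bar>v\<bar> powr (- (2 * d0 + \<sigma>))"
        using False \<sigma> by (intro mult_right_mono powr_mono2) auto
      finally have "f0 v \<le> M0 * r powr \<sigma> * \<bar>v\<bar> powr (- (2 * d0 + \<sigma>))" using c0 by (simp add: mult_ac)
      thus ?thesis using A reg_pos[OF f v] by (simp add: add_increasing)
    qed
    have iJ: "integrable fm (\<lambda>v. \<bar>v\<bar> powr (- (2 * d0 + \<sigma>)))"
      using \<sigma> by (intro integrable_powr)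
    note if0 = integrable_fm_pw[OF reg_integrable[OF f0], of n x] and iff = integrable_fm_pw[OF reg_integrable[OF f], of n x]
    have "qf n (tp f0) x = (\<integral>v. f0 v * pw n x v \<partial>fm)" by (rule qf_tp[OF reg_integrable[OF f0]])
    also have "\<dots> \<le> (\<integral>v. A * sqrt (real n) * (f v * pw n x v) + M0 * r powr \<sigma> * (real n * q) * \<bar>v\<bar> powr (- (2 * d0 + \<sigma>)) \<partial>fm)"
    proof (rule integral_mono[OF if0])
      show "integrable fm (\<lambda>v. A * sqrt (real n) * (f v * pw n x v) + M0 * r powr \<sigma> * (real n * q) * \<bar>v\<bar> powr (- (2 * d0 + \<sigma>)))"
        using iff iJ by auto
    next
      fix v assume "v \<in> space fm"
      hence v: "v \<in> freqs" by simp
      have "f0 v * pw n x v \<le> (A * sqrt (real n) * f v + M0 * r powr \<sigma> * \<bar>v\<bar> powr (- (2 * d0 + \<sigma>))) * pw n x v"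
        using pt[OF v] pw_nonneg by (intro mult_right_mono)
      also have "\<dots> = A * sqrt (real n) * (f v * pw n x v) + M0 * r powr \<sigma> * \<bar>v\<bar> powr (- (2 * d0 + \<sigma>)) * pw n x v"
        by (simp add: algebra_simps)
      also have "\<dots> \<le> A * sqrt (real n) * (f v * pw n x v) + M0 * r powr \<sigma> * \<bar>v\<bar> powr (- (2 * d0 + \<sigma>)) * (real n * q)"
        using pw_le[of n x v] c0 by (intro add_left_mono mult_left_mono) (auto simp: q_def)
      finally show "f0 v * pw n x v \<le> A * sqrt (real n) * (f v * pw n x v) + M0 * r powr \<sigma> * (real n * q) * \<bar>v\<bar> powr (- (2 * d0 + \<sigma>))"
        by (simp add: mult_ac)
    qed
    also have "\<dots> = A * sqrt (real n) * qf n (tp f) x + M0 * r powr \<sigma> * (real n * q) * J"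
      using iff iJ by (simp add: qf_tp[OF reg_integrable[OF f]] J_def)
    also have "M0 * r powr \<sigma> * (real n * q) * J = M0 * J / real n * q"
      unfolding r\<sigma> using n by (simp add: power2_eq_square)
    also have "M0 * J / real n * q \<le> 8 * M0 * J / m * sqrt (real n) * qf n (tp f) x"
    proof -
      have "q \<le> 8 * real n / m * qf n (tp f) x"
        using qf_tp_lower[OF f n, of x] c n by (simp add: q_def field_simps)
      hence "M0 * J / real n * q \<le> M0 * J / real n * (8 * real n / m * qf n (tp f) x)"
        using c0 J by (intro mult_left_mono) auto
      also have "\<dots> = 8 * M0 * J / m * 1 * qf n (tp f) x" using n by (simp add: field_simps)
      also have "\<dots> \<le> 8 * M0 * J / m * sqrt (real n) * qf n (tp f) x"
        using n c c0 J qf_nonneg[OF pos_def_tp[OF reg_integrable[OF f] reg_pos[OF f]], of n x]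
        by (intro mult_right_mono mult_left_mono) auto
      finally show ?thesis .
    qed
    finally show ?thesis by (simp add: \<Lambda>_def algebra_simps)
  qed
  thus ?thesis using \<Lambda> by blast
qed

section \<open>Likelihood ratios close to the true density\<close>

lemma ratio_powr_bounds:
  assumes f: "reg m1 M1 d1 f" and g: "reg m2 M2 d2 g" and v: "v \<in> freqs"
  shows "f v / g v \<le> M1 / m2 * \<bar>v\<bar> powr (- 2 * (d1 - d2))"
    and "m1 / M2 * \<bar>v\<bar> powr (- 2 * (d1 - d2)) \<le> f v / g v"
proof -
  have e: "\<bar>v\<bar> powr (- 2 * (d1 - d2)) = \<bar>v\<bar> powr (- 2 * d1) * \<bar>v\<bar> powr (2 * d2)"
    by (simp add: powr_add[symmetric] algebra_simps)
  have g': "1 / g v \<le> 1 / m2 * \<bar>v\<bar> powr (2 * d2)" "1 / M2 * \<bar>v\<bar> powr (2 * d2) \<le> 1 / g v"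
    using reg_le[OF reg_inverse[OF g] v] reg_ge[OF reg_inverse[OF g] v] by simp_all
  note p = reg_pos[OF f v] reg_pos[OF g v] reg_const[OF f] reg_const[OF g]
  have "f v * (1 / g v) \<le> (M1 * \<bar>v\<bar> powr (- 2 * d1)) * (1 / m2 * \<bar>v\<bar> powr (2 * d2))"
    using reg_le[OF f v] g' p by (intro mult_mono) auto
  thus "f v / g v \<le> M1 / m2 * \<bar>v\<bar> powr (- 2 * (d1 - d2))" unfolding e by (simp add: mult_ac)
  have "(m1 * \<bar>v\<bar> powr (- 2 * d1)) * (1 / M2 * \<bar>v\<bar> powr (2 * d2)) \<le> f v * (1 / g v)"
    using reg_ge[OF f v] g' p by (intro mult_mono) auto
  thus "m1 / M2 * \<bar>v\<bar> powr (- 2 * (d1 - d2)) \<le> f v / g v" unfolding e by (simp add: mult_ac)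
qed

lemma integrable_ratio:
  assumes f: "reg m1 M1 d1 f" and g: "reg m2 M2 d2 g" and d: "d1 - d2 < 1/2"
  shows "integrable fm (\<lambda>v. f v / g v)"
proof (rule Bochner_Integration.integrable_bound)
  show "integrable fm (\<lambda>v. M1 / m2 * \<bar>v\<bar> powr (- (2 * (d1 - d2))))"
    using d by (intro integrable_mult_right integrable_powr) auto
  show "AE v in fm. norm (f v / g v) \<le> norm (M1 / m2 * \<bar>v\<bar> powr (- (2 * (d1 - d2))))"
  proof (intro AE_I2)
    fix v assume "v \<in> space fm"
    hence v: "v \<in> freqs" by simp
    have "norm (f v / g v) = f v / g v"
      using reg_pos[OF f v] reg_pos[OF g v] by simp
    also have "\<dots> \<le> M1 / m2 * \<bar>v\<bar> powr (- (2 * (d1 - d2)))"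
      using ratio_powr_bounds(1)[OF f g v] unfolding minus_mult_left .
    also have "\<dots> \<le> norm (M1 / m2 * \<bar>v\<bar> powr (- (2 * (d1 - d2))))"
      unfolding real_norm_def by (rule abs_ge_self)
    finally show "norm (f v / g v) \<le> norm (M1 / m2 * \<bar>v\<bar> powr (- (2 * (d1 - d2))))" .
  qed
qed (use reg_measurable[OF f] reg_measurable[OF g] in auto)

lemma h_disc_fm:
  assumes f: "reg m1 M1 d1 f" and g: "reg m2 M2 d2 g"
  shows "h_disc f g = ennreal (1 / (2 * pi)) * (\<integral>\<^sup>+v. ennreal (f v / g v + g v / f v - 2) \<partial>fm)"
  unfolding h_disc_def nn_integral_fm
  using reg_pos[OF f] reg_pos[OF g] by (intro arg_cong2[where f = "(*)"] refl nn_integral_cong) auto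

lemma sum_ratio_ge_2:
  assumes "0 < x" "0 < (y::real)"
  shows "2 \<le> x / y + y / x"
proof -
  have "0 \<le> (x - y)\<^sup>2 / (x * y)" using assms by simp
  also have "\<dots> = x / y + y / x - 2" using assms by (simp add: power2_eq_square field_simps)
  finally show ?thesis by simp
qed

lemma h_disc_le_real:
  assumes f: "reg m1 M1 d1 f" and g: "reg m2 M2 d2 g" and d: "\<bar>d1 - d2\<bar> < 1/2"
    and h: "h_disc f g \<le> ennreal \<epsilon>" "0 \<le> \<epsilon>"
  shows "(\<integral>v. f v / g v \<partial>fm) / (2 * pi) + (\<integral>v. g v / f v \<partial>fm) / (2 * pi) - 2 \<le> \<epsilon>"
proof -
  have "d1 - d2 < 1/2" "d2 - d1 < 1/2" using d by linarith+
  hence i: "integrable fm (\<lambda>v. f v / g v)" "integrable fm (\<lambda>v. g v / f v)"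
    by (auto intro!: integrable_ratio[OF f g] integrable_ratio[OF g f])
  have nn: "0 \<le> f v / g v + g v / f v - 2" if "v \<in> freqs" for v
    using sum_ratio_ge_2[of "f v" "g v"] reg_pos[OF f that] reg_pos[OF g that] by simp
  define S where "S = (\<integral>v. f v / g v + g v / f v - 2 \<partial>fm)"
  have S: "S = (\<integral>v. f v / g v \<partial>fm) + (\<integral>v. g v / f v \<partial>fm) - 2 * (2 * pi)"
    unfolding S_def using i by (simp add: measure_fm)
  have S0: "0 \<le> S" unfolding S_def using nn by (intro integral_nonneg_AE AE_I2) auto
  have "(\<integral>\<^sup>+v. ennreal (f v / g v + g v / f v - 2) \<partial>fm) = ennreal S"
    unfolding S_def using i nn by (intro nn_integral_eq_integral) (auto intro!: AE_I2)
  hence "ennreal (1 / (2 * pi) * S) \<le> ennreal \<epsilon>"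
    using h(1) S0 by (subst ennreal_mult) (auto simp: h_disc_fm[OF f g])
  hence "1 / (2 * pi) * S \<le> \<epsilon>" using h(2) by (simp add: ennreal_le_iff)
  thus ?thesis unfolding S by (simp add: field_simps)
qed

text \<open>If the exponents differ by at least \<eta>, one of the two ratios is at least
  \<open>c * \<bar>v\<bar> powr (- 2 * \<eta>)\<close> near the origin, hence at least 3 for
  \<open>\<bar>v\<bar> \<le> \<rho>\<close>, and the integrand of \<open>h_disc\<close> is at least
  1 on an interval of length \<open>\<rho> / 2\<close>. This makes \<open>h_disc\<close> at least
  twice the chosen threshold, which depends on the densities only through c.\<close>

lemma exponent_close:
  assumes c: "0 < c" and \<eta>: "0 < \<eta>"
  shows "\<exists>\<tau>>0. \<forall>f g m1 M1 d1 m2 M2 d2. reg m1 M1 d1 f \<longrightarrow> reg m2 M2 d2 g \<longrightarrow> c \<le> m1 / M2 \<longrightarrow> c \<le> m2 / M1 \<longrightarrow>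
    h_disc f g \<le> ennreal \<tau> \<longrightarrow> \<bar>d1 - d2\<bar> < \<eta>"
proof -
  define \<rho> where "\<rho> = min 1 ((c / 3) powr (1 / (2 * \<eta>)))"
  have \<rho>: "0 < \<rho>" "\<rho> \<le> 1" using c by (auto simp: \<rho>_def)
  have "\<rho> powr (2 * \<eta>) \<le> ((c / 3) powr (1 / (2 * \<eta>))) powr (2 * \<eta>)"
    using \<rho> \<eta> by (intro powr_mono2) (auto simp: \<rho>_def)
  also have "\<dots> = c / 3" using c \<eta> by (simp add: powr_powr)
  finally have "3 \<le> c * \<rho> powr (- 2 * \<eta>)"
    using \<rho> by (simp add: powr_minus field_simps)
  have big: "3 \<le> c * \<bar>v\<bar> powr (- 2 * e)" if "v \<in> freqs" "\<bar>v\<bar> \<le> \<rho>" "\<eta> \<le> e" for v e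
  proof -
    note p = freqs_abs[OF that(1)]
    have "c * \<rho> powr (- 2 * \<eta>) \<le> c * \<bar>v\<bar> powr (- 2 * \<eta>)"
      using that p c \<eta> by (intro mult_left_mono powr_mono2') auto
    also have "\<dots> \<le> c * \<bar>v\<bar> powr (- 2 * e)"
      using that p c \<rho> by (intro mult_left_mono[OF powr_mono']) auto
    finally show ?thesis using \<open>3 \<le> c * \<rho> powr (- 2 * \<eta>)\<close> by linarith
  qed
  have "\<bar>d1 - d2\<bar> < \<eta>" if f: "reg m1 M1 d1 f" and g: "reg m2 M2 d2 g" and cc: "c \<le> m1 / M2" "c \<le> m2 / M1"
    and h: "h_disc f g \<le> ennreal (\<rho> / (8 * pi))" for f g m1 M1 d1 m2 M2 d2
  proof (rule ccontr)
    assume neg: "\<not> ?thesis"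
    have ge: "1 \<le> f v / g v + g v / f v - 2" if v: "v \<in> freqs" "\<bar>v\<bar> \<le> \<rho>" for v
    proof -
      have pos: "0 < f v / g v" "0 < g v / f v" using reg_pos[OF f v(1)] reg_pos[OF g v(1)] by auto
      have "3 \<le> f v / g v \<or> 3 \<le> g v / f v"
      proof (cases "\<eta> \<le> d1 - d2")
        case True
        have "3 \<le> c * \<bar>v\<bar> powr (- 2 * (d1 - d2))" by (rule big[OF v True])
        also have "\<dots> \<le> m1 / M2 * \<bar>v\<bar> powr (- 2 * (d1 - d2))" using cc by (intro mult_right_mono) auto
        also have "\<dots> \<le> f v / g v" by (rule ratio_powr_bounds(2)[OF f g v(1)])
        finally show ?thesis by simp
      next
        case False
        hence l: "\<eta> \<le> d2 - d1" using neg by linarith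
        have "3 \<le> c * \<bar>v\<bar> powr (- 2 * (d2 - d1))" by (rule big[OF v l])
        also have "\<dots> \<le> m2 / M1 * \<bar>v\<bar> powr (- 2 * (d2 - d1))" using cc by (intro mult_right_mono) auto
        also have "\<dots> \<le> g v / f v" by (rule ratio_powr_bounds(2)[OF g f v(1)])
        finally show ?thesis by simp
      qed
      thus ?thesis using pos by linarith
    qed
    have sub: "{\<rho> / 2..\<rho>} \<subseteq> freqs" using \<rho> pi_gt3 by (auto simp: freqs_def)
    have "ennreal (\<rho> / 2) = emeasure lborel {\<rho> / 2..\<rho>}"
      using \<rho> by (simp add: emeasure_lborel_Icc)
    also have "\<dots> = emeasure fm {\<rho> / 2..\<rho>}"
      unfolding fm_def using sub by (subst emeasure_restrict_space) auto
    also have "\<dots> = (\<integral>\<^sup>+v. indicator {\<rho> / 2..\<rho>} v \<partial>fm)"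
      using sub by (intro nn_integral_indicator[symmetric]) (auto simp: fm_def sets_restrict_space image_iff intro!: bexI[of _ "{\<rho> / 2..\<rho>}"])
    also have "\<dots> \<le> (\<integral>\<^sup>+v. ennreal (f v / g v + g v / f v - 2) \<partial>fm)"
    proof (intro nn_integral_mono)
      fix v assume "v \<in> space fm"
      thus "indicator {\<rho> / 2..\<rho>} v \<le> ennreal (f v / g v + g v / f v - 2)"
        using ge[of v] \<rho> by (auto simp: indicator_def ennreal_1[symmetric] simp del: ennreal_1 intro!: ennreal_leI)
    qed
    finally have "ennreal (1 / (2 * pi)) * ennreal (\<rho> / 2) \<le> h_disc f g"
      unfolding h_disc_fm[OF f g] by (intro mult_left_mono) auto
    also have "\<dots> \<le> ennreal (\<rho> / (8 * pi))" by (rule h)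
    finally have "ennreal (\<rho> / (4 * pi)) \<le> ennreal (\<rho> / (8 * pi))"
      using \<rho> by (simp add: ennreal_mult[symmetric])
    hence "\<rho> / (4 * pi) \<le> \<rho> / (8 * pi)"
      using \<rho> by (subst (asm) ennreal_le_iff) auto
    thus False using \<rho> by (simp add: field_simps)
  qed
  moreover have "0 < \<rho> / (8 * pi)" using \<rho> by simp
  ultimately show ?thesis by blast
qed

text \<open>Markov's inequality for the power s of the likelihood ratio, with s as large as
  \<open>qf_tp_le_sqrt\<close> permits under the requirement that s times the form of
  \<open>f0\<close> is at most \<kappa> times that of f. The moment costs at most
  \<open>3 / 2 * \<epsilon> * n * s\<close> in the exponent and the threshold gains
  \<open>3 * \<epsilon> * n * s\<close>; the difference is \<open>c * sqrt n\<close>.\<close>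

lemma likelihood_ratio_tail:
  assumes f0: "reg m0 M0 d0 f0" and f: "reg m M d f" and close: "\<bar>d0 - d\<bar> \<le> (1 - 2 * d0) / 16"
    and \<epsilon>: "0 < \<epsilon>" "\<epsilon> \<le> 1"
    and ab: "(\<integral>v. f0 v / f v \<partial>fm) / (2 * pi) + (\<integral>v. f v / f0 v \<partial>fm) / (2 * pi) - 2 \<le> \<epsilon>"
  shows "\<exists>c>0. \<forall>\<^sub>F n in sequentially.
    (\<integral>\<^sup>+x. ennreal (gdens n (tp f0) x) * indicator {x. exp (3 * \<epsilon> * real n) * gdens n (tp f) x \<le> gdens n (tp f0) x} x
      \<partial>Ln n) \<le> ennreal (exp (- (c * sqrt (real n))))"
proof -
  obtain \<Lambda> where \<Lambda>: "0 < \<Lambda>" "\<And>n x. 0 < n \<Longrightarrow> qf n (tp f0) x \<le> \<Lambda> * sqrt (real n) * qf n (tp f) x"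
    using qf_tp_le_sqrt[OF f0 f close] by blast
  define a b where "a = (\<integral>v. f0 v / f v \<partial>fm) / (2 * pi)" and "b = (\<integral>v. f v / f0 v \<partial>fm) / (2 * pi)"
  have b0: "0 \<le> b"
    unfolding b_def using reg_pos[OF f] reg_pos[OF f0]
    by (intro divide_nonneg_nonneg integral_nonneg_AE AE_I2) (auto simp: less_imp_le)
  \<comment> \<open>Small enough that dividing by \<open>1 - \<kappa>\<close> costs at most
    \<open>8 * \<kappa> = \<epsilon> / 2\<close>; here the divided quantity
    \<open>a + \<epsilon> / 4\<close> is at most 4 because \<open>ab\<close> bounds
    \<open>a + b\<close> by 3.\<close>
  define \<kappa> where "\<kappa> = \<epsilon> / 16"
  have \<kappa>: "0 < \<kappa>" "\<kappa> \<le> 1 / 16" using \<epsilon> by (auto simp: \<kappa>_def)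
  define c where "c = 3 / 2 * \<epsilon> * (\<kappa> / \<Lambda>)"
  have c: "0 < c" using \<epsilon> \<kappa> \<Lambda> by (simp add: c_def)
  have dd: "-1/2 < d0" "d0 < 1/2" using f0 by (auto simp: reg_def)
  have "d0 - d < 1/2" "d - d0 < 1/2" using abs_le_D1[OF close] abs_le_D2[OF close] dd by (auto simp: field_simps)
  hence ev: "\<forall>\<^sub>F n in sequentially. mtr n (tp f0) (finv n (tp f)) \<le> real n * (a + \<epsilon> / 4)"
     "\<forall>\<^sub>F n in sequentially. mtr n (tp f) (finv n (tp f0)) \<le> real n * (b + \<epsilon> / 4)"
    unfolding a_def b_def using \<epsilon>
    by (auto intro!: mtr_finv_limsup[OF f0 f] mtr_finv_limsup[OF f f0])
  have "(\<lambda>n. \<kappa> / (\<Lambda> * sqrt (real n))) \<longlonglongrightarrow> 0"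
    using \<Lambda>(1) by real_asymp
  hence "\<forall>\<^sub>F n in sequentially. \<kappa> / (\<Lambda> * sqrt (real n)) < \<epsilon> / 2"
    using \<epsilon> by (intro order_tendstoD) auto
  with ev eventually_gt_at_top[of 0]
  have "\<forall>\<^sub>F n in sequentially.
    (\<integral>\<^sup>+x. ennreal (gdens n (tp f0) x) * indicator {x. exp (3 * \<epsilon> * real n) * gdens n (tp f) x \<le> gdens n (tp f0) x} x
      \<partial>Ln n) \<le> ennreal (exp (- (c * sqrt (real n))))"
  proof eventually_elim
    case (elim n)
    define s where "s = \<kappa> / (\<Lambda> * sqrt (real n))"
    have s: "0 < s" "s \<le> \<epsilon> / 2" using \<kappa> \<Lambda> elim by (auto simp: s_def)
    have T0: "pos_def n (tp f0)" and T: "pos_def n (tp f)"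
      by (auto intro!: pos_def_tp reg_integrable[OF f0] reg_pos[OF f0] reg_integrable[OF f] reg_pos[OF f])
    have le: "s * qf n (tp f0) z \<le> \<kappa> * qf n (tp f) z" for z
    proof -
      have "s * qf n (tp f0) z \<le> s * (\<Lambda> * sqrt (real n) * qf n (tp f) z)"
        using s elim by (intro mult_left_mono \<Lambda>) auto
      also have "\<dots> = \<kappa> * qf n (tp f) z" using \<Lambda> elim by (simp add: s_def)
      finally show ?thesis .
    qed
    have "(\<integral>\<^sup>+x. ennreal (gdens n (tp f0) x) * indicator {x. exp (3 * \<epsilon> * real n) * gdens n (tp f) x \<le> gdens n (tp f0) x} x
      \<partial>Ln n)
      \<le> (\<integral>\<^sup>+x. ennreal (exp (- (3 * \<epsilon> * real n * s))) * ennreal (gdens n (tp f0) x * (gdens n (tp f0) x / gdens n (tp f) x) powr s) \<partial>Ln n)"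
    proof (intro nn_integral_mono)
      fix x
      note p = gdens_pos[OF T0, of x] gdens_pos[OF T, of x]
      show "ennreal (gdens n (tp f0) x) * indicator {x. exp (3 * \<epsilon> * real n) * gdens n (tp f) x \<le> gdens n (tp f0) x} x
        \<le> ennreal (exp (- (3 * \<epsilon> * real n * s))) * ennreal (gdens n (tp f0) x * (gdens n (tp f0) x / gdens n (tp f) x) powr s)"
      proof (cases "exp (3 * \<epsilon> * real n) * gdens n (tp f) x \<le> gdens n (tp f0) x")
        case True
        hence "exp (3 * \<epsilon> * real n) powr s \<le> (gdens n (tp f0) x / gdens n (tp f) x) powr s"
          using p s by (intro powr_mono2) (auto simp: field_simps)
        hence "1 \<le> exp (- (3 * \<epsilon> * real n * s)) * (gdens n (tp f0) x / gdens n (tp f) x) powr s"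
          by (simp add: powr_def exp_minus field_simps)
        hence "gdens n (tp f0) x * 1 \<le> gdens n (tp f0) x * (exp (- (3 * \<epsilon> * real n * s)) * (gdens n (tp f0) x / gdens n (tp f) x) powr s)"
          using p by (intro mult_left_mono) auto
        thus ?thesis
          using p True by (simp add: ennreal_mult[symmetric] mult_ac ennreal_leI)
      qed simp
    qed
    also have "\<dots> = ennreal (exp (- (3 * \<epsilon> * real n * s))) * (\<integral>\<^sup>+x. ennreal (gdens n (tp f0) x * (gdens n (tp f0) x / gdens n (tp f) x) powr s) \<partial>Ln n)"
      by (rule nn_integral_cmult) measurable
    also have "\<dots> \<le> ennreal (exp (- (3 * \<epsilon> * real n * s))) *
        ennreal (exp (s / 2 * (mtr n (tp f0) (finv n (tp f)) / (1 - \<kappa>) - real n / (1 + s) + mtr n (tp f) (finv n (tp f0)) - real n)))"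
      using \<kappa> by (intro mult_left_mono nn_integral_gdens_ratio_powr T0 T s le) auto
    also have "\<dots> = ennreal (exp (- (3 * \<epsilon> * real n * s) +
        s / 2 * (mtr n (tp f0) (finv n (tp f)) / (1 - \<kappa>) - real n / (1 + s) + mtr n (tp f) (finv n (tp f0)) - real n)))"
      by (simp only: exp_add ennreal_mult[symmetric] exp_ge_zero)
    also have "\<dots> \<le> ennreal (exp (- (c * sqrt (real n))))"
    proof (intro ennreal_leI iffD2[OF exp_le_cancel_iff])
      have k: "(a + \<epsilon> / 4) / (1 - \<kappa>) \<le> a + \<epsilon> / 4 + 8 * \<kappa>"
      proof -
        have "a + \<epsilon> / 4 \<le> 4" using ab b0 \<epsilon> by (simp add: a_def[symmetric] b_def[symmetric])
        hence k1: "(a + \<epsilon> / 4) * \<kappa> \<le> 4 * \<kappa>" using \<kappa> by (intro mult_right_mono) auto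
        have "\<kappa> * \<kappa> \<le> 1 / 16 * \<kappa>" using \<kappa> by (intro mult_right_mono) auto
        moreover have "(y + 8 * \<kappa>) * (1 - \<kappa>) = y + 8 * \<kappa> - y * \<kappa> - 8 * (\<kappa> * \<kappa>)" for y
          by (simp add: algebra_simps)
        note this[of "a + \<epsilon> / 4"]
        ultimately have "a + \<epsilon> / 4 \<le> (a + \<epsilon> / 4 + 8 * \<kappa>) * (1 - \<kappa>)" using k1 \<kappa> by linarith
        thus ?thesis using \<kappa> by (simp add: field_simps)
      qed
      have "mtr n (tp f0) (finv n (tp f)) / (1 - \<kappa>) \<le> real n * (a + \<epsilon> / 4) / (1 - \<kappa>)"
        using elim \<kappa> by (intro divide_right_mono) auto
      also have "\<dots> \<le> real n * (a + \<epsilon> / 4 + 8 * \<kappa>)"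
        using mult_left_mono[OF k, of "real n"] by simp
      finally have t1: "mtr n (tp f0) (finv n (tp f)) / (1 - \<kappa>) \<le> real n * (a + \<epsilon> / 4 + 8 * \<kappa>)" .
      have "1 - s \<le> 1 / (1 + s)" using s by (simp add: field_simps)
      hence t2: "real n * (1 - s) \<le> real n / (1 + s)"
        using mult_left_mono[of "1 - s" "1 / (1 + s)" "real n"] by simp
      have "mtr n (tp f0) (finv n (tp f)) / (1 - \<kappa>) - real n / (1 + s) + mtr n (tp f) (finv n (tp f0)) - real n
          \<le> real n * (a + \<epsilon> / 4 + 8 * \<kappa>) - real n * (1 - s) + real n * (b + \<epsilon> / 4) - real n"
        using t1 t2 elim by linarith
      also have "\<dots> = real n * (a + b - 2 + \<epsilon> / 2 + 8 * \<kappa> + s)" by (simp add: algebra_simps)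
      also have "\<dots> \<le> real n * (3 * \<epsilon>)"
        using ab s by (intro mult_left_mono) (auto simp: a_def[symmetric] b_def[symmetric] \<kappa>_def)
      finally have "s / 2 * (mtr n (tp f0) (finv n (tp f)) / (1 - \<kappa>) - real n / (1 + s) + mtr n (tp f) (finv n (tp f0)) - real n)
          \<le> s / 2 * (real n * (3 * \<epsilon>))"
        using s by (intro mult_left_mono) auto
      moreover have "s / 2 * (real n * (3 * \<epsilon>)) - 3 * \<epsilon> * real n * s = - (c * sqrt (real n))"
      proof -
        have "real n / sqrt (real n) = sqrt (real n)" by (rule real_div_sqrt) simp
        hence "s * real n = \<kappa> / \<Lambda> * sqrt (real n)"
          by (simp add: s_def) (metis times_divide_eq_right times_divide_times_eq mult.commute)
        hence "3 / 2 * \<epsilon> * (s * real n) = c * sqrt (real n)" by (simp add: c_def)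
        thus ?thesis by (simp add: algebra_simps)
      qed
      ultimately show "- (3 * \<epsilon> * real n * s) + s / 2 * (mtr n (tp f0) (finv n (tp f)) / (1 - \<kappa>) - real n / (1 + s) + mtr n (tp f) (finv n (tp f0)) - real n)
        \<le> - (c * sqrt (real n))" by linarith
    qed
    finally show ?case .
  qed
  thus ?thesis using c by blast
qed

lemma summable_exp_sqrt:
  assumes "0 < c"
  shows "summable (\<lambda>n. exp (- (c * sqrt (real n))))"
proof (rule summable_comparison_test_ev)
  show "summable (\<lambda>n. 1 / real n ^ 2)" using inverse_power_summable[of 2] by (simp add: inverse_eq_divide)
  show "\<forall>\<^sub>F n in sequentially. norm (exp (- (c * sqrt (real n)))) \<le> 1 / real n ^ 2"
    using assms unfolding real_norm_def abs_exp_cancel by real_asymp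
qed

section \<open>Concentration of filtered second moments\<close>

text \<open>The filter w of length W moved to start at time j; its product with the sample is one
  value of the filtered series.\<close>

definition shiftv :: "nat \<Rightarrow> (nat \<Rightarrow> real) \<Rightarrow> nat \<Rightarrow> nat \<Rightarrow> real" where
  "shiftv W w j i = (if j \<le> i \<and> i < j + W then w (i - j) else 0)"

definition fstat :: "nat \<Rightarrow> (nat \<Rightarrow> real) \<Rightarrow> nat \<Rightarrow> (nat \<Rightarrow> real) \<Rightarrow> real" where
  "fstat W w n x = (\<Sum>j<n - W. (ip n (shiftv W w j) x)\<^sup>2)"

lemma measurable_fstat [measurable]: "fstat W w n \<in> borel_measurable (Ln n)"
proof -
  have "fstat W w n = qf n (\<lambda>i j. \<Sum>k<n - W. shiftv W w k i * shiftv W w k j)"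
    by (simp add: fun_eq_iff fstat_def qf_squares)
  thus ?thesis by simp
qed

lemma shift_poly:
  assumes "j + W \<le> n"
  shows "(\<Sum>i<n. of_real (shiftv W w j i) * cis (real i * v)) = cis (real j * v) * (\<Sum>l<W. of_real (w l) * cis (real l * v))"
proof -
  have "(\<Sum>i<n. of_real (shiftv W w j i) * cis (real i * v)) = (\<Sum>i\<in>{j..<j + W}. of_real (w (i - j)) * cis (real i * v))"
    using assms by (intro sum.mono_neutral_cong_right) (auto simp: shiftv_def)
  also have "\<dots> = (\<Sum>l<W. of_real (w l) * cis (real (l + j) * v))"
    by (rule sum.reindex_bij_witness[of _ "\<lambda>l. l + j" "\<lambda>i. i - j"]) auto
  also have "\<dots> = cis (real j * v) * (\<Sum>l<W. of_real (w l) * cis (real l * v))"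
    by (simp add: sum_distrib_left cis_mult algebra_simps)
  finally show ?thesis .
qed

lemma pw_shift: "j + W \<le> n \<Longrightarrow> pw n (shiftv W w j) v = pw W w v"
  unfolding pw_def by (simp add: shift_poly norm_mult)

text \<open>A combination of shifts of one filter corresponds to the product of two trigonometric
  polynomials.\<close>

lemma pw_shift_sum:
  assumes "N + W \<le> n"
  shows "pw n (\<lambda>i. \<Sum>j<N. c j * shiftv W w j i) v = pw N c v * pw W w v"
proof -
  have "(\<Sum>i<n. of_real (\<Sum>j<N. c j * shiftv W w j i) * cis (real i * v))
      = (\<Sum>j<N. of_real (c j) * (\<Sum>i<n. of_real (shiftv W w j i) * cis (real i * v)))"
    by (simp add: sum_distrib_left sum_distrib_right mult_ac) (rule sum.swap)
  also have "\<dots> = (\<Sum>j<N. of_real (c j) * (cis (real j * v) * (\<Sum>l<W. of_real (w l) * cis (real l * v))))"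
    using assms by (intro sum.cong refl arg_cong2[where f = "(*)"] shift_poly) auto
  also have "\<dots> = (\<Sum>j<N. of_real (c j) * cis (real j * v)) * (\<Sum>l<W. of_real (w l) * cis (real l * v))"
    by (simp only: sum_distrib_right mult.assoc)
  finally show ?thesis
    unfolding pw_def by (simp add: norm_mult power_mult_distrib)
qed

lemma ip_sum_left: "ip n (\<lambda>i. \<Sum>j<N. c j * a j i) x = (\<Sum>j<N. c j * ip n (a j) x)"
  unfolding ip_def sum_distrib_left sum_distrib_right by (subst sum.swap) (simp add: mult_ac)

text \<open>Supplies the constant of the Chernoff bounds by duality. The combination z of the
  shifted filters, weighted by their own outputs, has product \<open>fstat W w n x\<close> with x,
  and its Toeplitz form is at most \<open>2 * pi * K\<close> times that same number since
  \<open>pw W w v * f v \<le> K\<close>. Cauchy-Schwarz for the Toeplitz matrix and its inverse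
  concludes.\<close>

lemma fstat_le:
  assumes f: "integrable fm f" "\<And>v. v \<in> freqs \<Longrightarrow> 0 < f v" and K: "\<And>v. v \<in> freqs \<Longrightarrow> pw W w v * f v \<le> K"
    and W: "W \<le> n"
  shows "fstat W w n x \<le> (2 * pi * K) * qf n (finv n (tp f)) x"
proof (cases "fstat W w n x = 0")
  case True
  have "0 \<le> K" using K[OF pi_freqs] f(2)[OF pi_freqs] pw_nonneg[of W w pi]
    by (meson less_imp_le mult_nonneg_nonneg order_trans)
  thus ?thesis using True qf_nonneg[OF pos_def_finv[OF pos_def_tp[OF f]]] by simp
next
  case False
  define q where "q = fstat W w n x"
  have q: "0 < q" using False unfolding q_def fstat_def by (intro less_le[THEN iffD2] conjI sum_nonneg) auto
  define N where "N = n - W"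
  define c where "c = (\<lambda>j. ip n (shiftv W w j) x)"
  define z where "z = (\<lambda>i. \<Sum>j<N. c j * shiftv W w j i)"
  note T = pos_def_tp[OF f, of n]
  have zx: "ip n z x = q"
    unfolding z_def ip_sum_left by (simp add: q_def fstat_def c_def N_def power2_eq_square)
  have "qf n (tp f) z = (\<integral>v. f v * (pw N c v * pw W w v) \<partial>fm)"
    unfolding qf_tp[OF f(1)] z_def using W by (subst pw_shift_sum) (auto simp: N_def)
  also have "\<dots> \<le> (\<integral>v. K * pw N c v \<partial>fm)"
  proof (rule integral_mono)
    show "integrable fm (\<lambda>v. f v * (pw N c v * pw W w v))"
      using integrable_fm_pw[OF f(1), of n z] pw_shift_sum[of N W n c w] W by (simp add: z_def N_def)
    show "integrable fm (\<lambda>v. K * pw N c v)" using integrable_pw[of N c] by auto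
  next
    fix v assume "v \<in> space fm"
    hence "pw N c v * (pw W w v * f v) \<le> pw N c v * K"
      using K pw_nonneg by (intro mult_left_mono) auto
    thus "f v * (pw N c v * pw W w v) \<le> K * pw N c v" by (simp add: mult_ac)
  qed
  also have "\<dots> = (2 * pi * K) * q"
    by (simp add: integral_pw q_def fstat_def c_def N_def)
  finally have Tz: "qf n (tp f) z \<le> (2 * pi * K) * q" .
  have "q\<^sup>2 \<le> qf n (tp f) z * qf n (finv n (tp f)) x"
    using ip_sq_le[OF T inv_pair_finv(1)[OF T], of z x] by (simp add: zx)
  also have "\<dots> \<le> ((2 * pi * K) * q) * qf n (finv n (tp f)) x"
    by (intro mult_right_mono Tz qf_nonneg pos_def_finv T)
  finally show ?thesis using q by (simp add: power2_eq_square q_def[symmetric])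
qed

lemma fstat_mean:
  assumes "integrable fm f" "W \<le> n"
  shows "(\<Sum>j<n - W. qf n (tp f) (shiftv W w j)) = real (n - W) * (\<integral>v. f v * pw W w v \<partial>fm)"
proof -
  have "qf n (tp f) (shiftv W w j) = (\<integral>v. f v * pw W w v \<partial>fm)" if "j < n - W" for j
    using that assms(2) unfolding qf_tp[OF assms(1)] by (subst pw_shift) auto
  thus ?thesis by simp
qed

lemma nn_integral_markov_exp:
  assumes [measurable]: "p \<in> borel_measurable M" "Y \<in> borel_measurable M" and "\<And>x. 0 \<le> p x"
    and "(\<integral>\<^sup>+x. ennreal (p x * exp (Y x)) \<partial>M) \<le> ennreal (exp b)"
  shows "(\<integral>\<^sup>+x. ennreal (p x) * indicator {x. a \<le> Y x} x \<partial>M) \<le> ennreal (exp (b - a))"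
proof -
  have "(\<integral>\<^sup>+x. ennreal (p x) * indicator {x. a \<le> Y x} x \<partial>M) \<le> (\<integral>\<^sup>+x. ennreal (exp (- a)) * ennreal (p x * exp (Y x)) \<partial>M)"
  proof (intro nn_integral_mono)
    fix x
    show "ennreal (p x) * indicator {x. a \<le> Y x} x \<le> ennreal (exp (- a)) * ennreal (p x * exp (Y x))"
    proof (cases "a \<le> Y x")
      case True
      hence "p x * 1 \<le> p x * exp (Y x - a)" using assms(3) by (intro mult_left_mono) auto
      also have "\<dots> = exp (- a) * (p x * exp (Y x))" by (simp add: exp_diff exp_minus field_simps)
      finally show ?thesis using True assms(3) by (simp add: ennreal_mult[symmetric] ennreal_leI)
    qed simp
  qed
  also have "\<dots> = ennreal (exp (- a)) * (\<integral>\<^sup>+x. ennreal (p x * exp (Y x)) \<partial>M)"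
    by (rule nn_integral_cmult) measurable
  also have "\<dots> \<le> ennreal (exp (- a)) * ennreal (exp b)"
    by (intro mult_left_mono assms) auto
  also have "\<dots> = ennreal (exp (b - a))"
    by (simp add: ennreal_mult[symmetric] exp_add[symmetric])
  finally show ?thesis .
qed

text \<open>The rate s precedes the quantifiers over f and n: the density influences it only through
  the bound K after filtering, so a pole of f is harmless once the filter cancels it.\<close>

lemma fstat_concentration:
  assumes K: "0 < K" and \<delta>: "0 < \<delta>"
  shows "\<exists>s>0. \<forall>f n. integrable fm f \<longrightarrow> (\<forall>v\<in>freqs. 0 < f v \<and> pw W w v * f v \<le> K) \<longrightarrow> W \<le> n \<longrightarrow>
    (\<integral>\<^sup>+x. ennreal (gdens n (tp f) x) *
        indicator {x. real (n - W) * \<delta> \<le> \<bar>fstat W w n x - real (n - W) * (\<integral>v. f v * pw W w v \<partial>fm)\<bar>} x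
      \<partial>Ln n) \<le> ennreal (2 * exp (- (s * real (n - W))))"
proof -
  define s where "s = min (1 / (8 * pi * K)) (\<delta> / (32 * pi\<^sup>2 * K\<^sup>2))"
  have s: "0 < s" using K \<delta> by (simp add: s_def)
  have s1: "s * (8 * pi * K) \<le> 1"
  proof -
    have "s \<le> 1 / (8 * pi * K)" by (simp add: s_def)
    thus ?thesis using K by (simp add: field_simps)
  qed
  have s2: "s * (32 * pi\<^sup>2 * K\<^sup>2) \<le> \<delta>"
  proof -
    have "s \<le> \<delta> / (32 * pi\<^sup>2 * K\<^sup>2)" by (simp add: s_def)
    thus ?thesis using K by (simp add: field_simps)
  qed
  \<comment> \<open>The relative change of the mean under the tilt. The two terms in the minimum
    defining s give \<open>u \<le> 1 / 2\<close> and make u times the mean at most a quarter of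
    \<delta>, so that half of \<delta> survives in the exponent of either tail.\<close>
  define u where "u = 2 * s * (2 * pi * K)"
  have u: "0 < u" "u \<le> 1 / 2" "2 * (2 * pi * K) * u \<le> \<delta> / 2"
    using s s1 s2 K by (auto simp: u_def power2_eq_square algebra_simps)
  have "(\<integral>\<^sup>+x. ennreal (gdens n (tp f) x) * indicator {x. real (n - W) * \<delta> \<le> \<bar>fstat W w n x - real (n - W) * (\<integral>v. f v * pw W w v \<partial>fm)\<bar>} x
      \<partial>Ln n) \<le> ennreal (2 * exp (- (s * \<delta> / 2 * real (n - W))))"
    if f: "integrable fm f" and fK: "\<forall>v\<in>freqs. 0 < f v \<and> pw W w v * f v \<le> K" and W: "W \<le> n" for f n
  proof -
    define N where "N = real (n - W)"
    define V where "V = (\<integral>v. f v * pw W w v \<partial>fm)"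
    have fp: "0 < f v" "pw W w v * f v \<le> K" if "v \<in> freqs" for v using fK that by auto
    have V0: "0 \<le> V" unfolding V_def using fp(1) pw_nonneg by (intro integral_nonneg_AE AE_I2) (auto simp: less_imp_le)
    have "V \<le> (\<integral>v. K \<partial>fm)"
      unfolding V_def using fp(2) integrable_fm_pw[OF f] by (intro integral_mono) (auto simp: mult.commute)
    hence V1: "V \<le> 2 * pi * K" by (simp add: measure_fm)
    have uV: "2 * V * u \<le> \<delta> / 2"
    proof -
      have "2 * V * u \<le> 2 * (2 * pi * K) * u" using V1 u by (intro mult_right_mono mult_left_mono) auto
      thus ?thesis using u by linarith
    qed
    note T = pos_def_tp[OF f fp(1), of n]
    have Q: "(\<Sum>k<n - W. (ip n (shiftv W w k) x)\<^sup>2) \<le> (2 * pi * K) * qf n (finv n (tp f)) x" for x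
      using fstat_le[OF f fp W, of x] by (simp add: fstat_def)
    have N: "0 \<le> N" by (simp add: N_def)
    have up: "(\<integral>\<^sup>+x. ennreal (gdens n (tp f) x * exp (s * fstat W w n x)) \<partial>Ln n)
        \<le> ennreal (exp (s * (N * V) / (1 - u)))"
      using chernoff_upper[OF T s _ Q] u
      by (simp add: fstat_def[symmetric] fstat_mean[OF f W] N_def V_def u_def)
    have lo: "(\<integral>\<^sup>+x. ennreal (gdens n (tp f) x * exp (- s * fstat W w n x)) \<partial>Ln n)
        \<le> ennreal (exp (- s * (N * V) / (1 + u)))"
      using chernoff_lower[OF T s _ Q] K
      by (simp add: fstat_def[symmetric] fstat_mean[OF f W] N_def V_def u_def)
    let ?p = "\<lambda>x. ennreal (gdens n (tp f) x)"
    have g0: "0 \<le> gdens n (tp f) x" for x using gdens_pos[OF T] by (simp add: less_imp_le)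
    have U: "(\<integral>\<^sup>+x. ?p x * indicator {x. s * (N * (V + \<delta>)) \<le> s * fstat W w n x} x \<partial>Ln n)
        \<le> ennreal (exp (- (s * \<delta> / 2 * N)))"
    proof -
      have "(\<integral>\<^sup>+x. ?p x * indicator {x. s * (N * (V + \<delta>)) \<le> s * fstat W w n x} x \<partial>Ln n)
        \<le> ennreal (exp (s * (N * V) / (1 - u) - s * (N * (V + \<delta>))))"
        by (rule nn_integral_markov_exp[OF _ _ g0 up]) measurable
      also have "\<dots> \<le> ennreal (exp (- (s * \<delta> / 2 * N)))"
      proof (intro ennreal_leI iffD2[OF exp_le_cancel_iff])
        have "V \<le> (V + \<delta> / 2) * (1 - u)"
        proof -
          have "(V + y) * (1 - u) = V + y - V * u - y * u" for y by (simp add: algebra_simps)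
          note this[of "\<delta> / 2"]
          moreover have "\<delta> / 2 * u \<le> \<delta> / 2 * (1 / 2)" using u \<delta> by (intro mult_left_mono) auto
          ultimately show ?thesis using uV by linarith
        qed
        hence "V / (1 - u) \<le> V + \<delta> / 2" using u by (simp add: field_simps)
        hence "s * N * (V / (1 - u)) \<le> s * N * (V + \<delta> / 2)" using s N by (intro mult_left_mono) auto
        thus "s * (N * V) / (1 - u) - s * (N * (V + \<delta>)) \<le> - (s * \<delta> / 2 * N)" by (simp add: algebra_simps)
      qed
      finally show ?thesis .
    qed
    have L: "(\<integral>\<^sup>+x. ?p x * indicator {x. - s * (N * (V - \<delta>)) \<le> - s * fstat W w n x} x \<partial>Ln n)
        \<le> ennreal (exp (- (s * \<delta> / 2 * N)))"
    proof -
      have "(\<integral>\<^sup>+x. ?p x * indicator {x. - s * (N * (V - \<delta>)) \<le> - s * fstat W w n x} x \<partial>Ln n)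
        \<le> ennreal (exp (- s * (N * V) / (1 + u) - - s * (N * (V - \<delta>))))"
        by (rule nn_integral_markov_exp[OF _ _ g0 lo]) measurable
      also have "\<dots> \<le> ennreal (exp (- (s * \<delta> / 2 * N)))"
      proof (intro ennreal_leI iffD2[OF exp_le_cancel_iff])
        have "(V - \<delta> / 2) * (1 + u) \<le> V"
        proof -
          have "(V - y) * (1 + u) = V - y + V * u - y * u" for y by (simp add: algebra_simps)
          note this[of "\<delta> / 2"]
          moreover have "0 \<le> \<delta> / 2 * u" using u \<delta> by simp
          moreover have "0 \<le> V * u" using u V0 by simp
          ultimately show ?thesis using uV by linarith
        qed
        hence "V - \<delta> / 2 \<le> V / (1 + u)" using u by (simp add: field_simps)
        hence "s * N * (V - \<delta> / 2) \<le> s * N * (V / (1 + u))" using s N by (intro mult_left_mono) auto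
        thus "- s * (N * V) / (1 + u) - - s * (N * (V - \<delta>)) \<le> - (s * \<delta> / 2 * N)" by (simp add: algebra_simps)
      qed
      finally show ?thesis .
    qed
    have "(\<integral>\<^sup>+x. ?p x * indicator {x. N * \<delta> \<le> \<bar>fstat W w n x - N * V\<bar>} x \<partial>Ln n)
      \<le> (\<integral>\<^sup>+x. ?p x * indicator {x. s * (N * (V + \<delta>)) \<le> s * fstat W w n x} x
          + ?p x * indicator {x. - s * (N * (V - \<delta>)) \<le> - s * fstat W w n x} x \<partial>Ln n)"
    proof (intro nn_integral_mono)
      fix x
      have "N * (V + \<delta>) \<le> fstat W w n x \<or> fstat W w n x \<le> N * (V - \<delta>)" if "N * \<delta> \<le> \<bar>fstat W w n x - N * V\<bar>"
        using that by (simp add: algebra_simps) linarith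
      hence "x \<in> {x. s * (N * (V + \<delta>)) \<le> s * fstat W w n x} \<or> x \<in> {x. - s * (N * (V - \<delta>)) \<le> - s * fstat W w n x}"
        if "N * \<delta> \<le> \<bar>fstat W w n x - N * V\<bar>"
        using that s by auto
      thus "?p x * indicator {x. N * \<delta> \<le> \<bar>fstat W w n x - N * V\<bar>} x
        \<le> ?p x * indicator {x. s * (N * (V + \<delta>)) \<le> s * fstat W w n x} x
          + ?p x * indicator {x. - s * (N * (V - \<delta>)) \<le> - s * fstat W w n x} x"
        by (auto simp: indicator_def)
    qed
    also have "\<dots> = (\<integral>\<^sup>+x. ?p x * indicator {x. s * (N * (V + \<delta>)) \<le> s * fstat W w n x} x \<partial>Ln n)
        + (\<integral>\<^sup>+x. ?p x * indicator {x. - s * (N * (V - \<delta>)) \<le> - s * fstat W w n x} x \<partial>Ln n)"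
      by (rule nn_integral_add) measurable
    also have "\<dots> \<le> ennreal (exp (- (s * \<delta> / 2 * N))) + ennreal (exp (- (s * \<delta> / 2 * N)))"
      by (rule add_mono[OF U L])
    also have "\<dots> = ennreal (2 * exp (- (s * \<delta> / 2 * N)))"
      by (simp add: ennreal_plus[symmetric] del: ennreal_plus)
    finally show ?thesis by (simp add: N_def V_def)
  qed
  moreover have "0 < s * \<delta> / 2" using s \<delta> by simp
  ultimately show ?thesis by blast
qed

section \<open>Measurability in the density\<close>

text \<open>Only evaluations at fixed frequencies are known to be measurable; continuity yields
  joint measurability. Frequencies are rounded upwards in absolute value to a grid in (0, pi], so
  that the grid point is never the excluded origin.\<close>

lemma measurable_ev:
  assumes cont: "\<And>f. f \<in> space P \<Longrightarrow> continuous_on freqs f \<and> (\<forall>v\<in>freqs. f (- v) = f v)"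
    and ev: "\<And>v. v \<in> freqs \<Longrightarrow> (\<lambda>f. f v) \<in> borel_measurable P"
  shows "(\<lambda>(f, v). f v :: real) \<in> borel_measurable (P \<Otimes>\<^sub>M fm)"
proof -
  define g where "g = (\<lambda>(n::nat) (i::int) (z::(real \<Rightarrow> real) \<times> real).
    if pi * of_int i / real (Suc n) \<in> freqs then fst z (pi * of_int i / real (Suc n)) else 0)"
  define k where "k = (\<lambda>(n::nat) (z::(real \<Rightarrow> real) \<times> real). \<lceil>\<bar>snd z\<bar> * real (Suc n) / pi\<rceil>)"
  have sm: "(\<lambda>z. snd z) \<in> borel_measurable (P \<Otimes>\<^sub>M fm)"
    by (rule measurable_compose[OF measurable_snd measurable_fm]) simp
  have gm: "g n i \<in> borel_measurable (P \<Otimes>\<^sub>M fm)" for n i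
  proof (cases "pi * of_int i / real (Suc n) \<in> freqs")
    case True
    thus ?thesis unfolding g_def using measurable_compose[OF measurable_fst ev[OF True]] by simp
  qed (simp add: g_def)
  have km: "k n \<in> measurable (P \<Otimes>\<^sub>M fm) (count_space UNIV)" for n
    unfolding k_def using sm by measurable
  have m: "(\<lambda>z. g n (k n z) z) \<in> borel_measurable (P \<Otimes>\<^sub>M fm)" for n
    by (rule measurable_compose_countable[OF gm km])
  show ?thesis
  proof (rule borel_measurable_LIMSEQ_real[OF _ m])
    fix z assume "z \<in> space (P \<Otimes>\<^sub>M fm)"
    then obtain f v where z: "z = (f, v)" "f \<in> space P" "v \<in> freqs"
      by (auto simp: space_pair_measure)
    define r where "r = (\<lambda>n. pi * of_int \<lceil>\<bar>v\<bar> * real (Suc n) / pi\<rceil> / real (Suc n))"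
    note v = freqs_abs[OF z(3)]
    have low: "a \<le> pi * c / N" if "a * N / pi \<le> c" "0 < N" for a c N :: real
      using that by (simp add: field_simps)
    have upp: "pi * c / N \<le> a + pi / N" if "c \<le> a * N / pi + 1" "0 < N" for a c N :: real
      using that by (simp add: field_simps)
    have r1: "\<bar>v\<bar> \<le> r n" for n
      unfolding r_def by (rule low[OF le_of_int_ceiling]) simp
    have r2: "r n \<le> \<bar>v\<bar> + pi / real (Suc n)" for n
      unfolding r_def by (rule upp[OF of_int_ceiling_le_add_one]) simp
    have r3: "r n \<in> freqs" for n
    proof -
      have "a * N / pi \<le> N" if "a \<le> pi" "0 < N" for a N :: real
        using that by (simp add: field_simps)
      hence "\<bar>v\<bar> * real (Suc n) / pi \<le> of_int (int (Suc n))"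
        using v by simp
      hence "of_int \<lceil>\<bar>v\<bar> * real (Suc n) / pi\<rceil> \<le> real (Suc n)"
        by (metis ceiling_le_iff of_int_le_iff of_int_of_nat_eq)
      hence "pi * of_int \<lceil>\<bar>v\<bar> * real (Suc n) / pi\<rceil> / real (Suc n) \<le> pi * real (Suc n) / real (Suc n)"
        by (intro divide_right_mono mult_left_mono) auto
      hence "r n \<le> pi" unfolding r_def by simp
      thus ?thesis using r1[of n] v by (auto simp: freqs_def)
    qed
    have "(\<lambda>n. \<bar>v\<bar> + pi / real (Suc n)) \<longlonglongrightarrow> \<bar>v\<bar> + 0"
      by (intro tendsto_add tendsto_const LIMSEQ_Suc[OF lim_const_over_n])
    hence "r \<longlonglongrightarrow> \<bar>v\<bar>"
      using r1 r2 by (intro tendsto_sandwich[of "\<lambda>_. \<bar>v\<bar>" r sequentially "\<lambda>n. \<bar>v\<bar> + pi / real (Suc n)"]) auto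
    moreover have "\<bar>v\<bar> \<in> freqs" using z by (auto simp: freqs_def)
    ultimately have "(\<lambda>n. f (r n)) \<longlonglongrightarrow> f \<bar>v\<bar>"
      using cont[OF z(2)] r3 by (intro continuous_on_tendsto_compose[of freqs f]) auto
    moreover have "f \<bar>v\<bar> = f v" using cont[OF z(2)] z(3) by (auto simp: abs_if)
    moreover have "g n (k n z) z = f (r n)" for n
      using r3[of n] by (simp add: g_def k_def z r_def)
    ultimately show "(\<lambda>n. g n (k n z) z) \<longlonglongrightarrow> (case z of (f, v) \<Rightarrow> f v)"
      by (simp add: z)
  qed
qed

lemma measurable_det:
  assumes "\<And>i j. i < n \<Longrightarrow> j < n \<Longrightarrow> (\<lambda>w. A w i j) \<in> borel_measurable N"
  shows "(\<lambda>w. Determinant.det (Matrix.mat n n (\<lambda>(i, j). A w i j)) :: real) \<in> borel_measurable N"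
proof -
  have "(\<lambda>w. Determinant.det (Matrix.mat n n (\<lambda>(i, j). A w i j)))
      = (\<lambda>w. \<Sum>p | p permutes {0..<n}. signof p * (\<Prod>i = 0..<n. A w i (p i)))"
  proof
    fix w
    show "Determinant.det (Matrix.mat n n (\<lambda>(i, j). A w i j))
      = (\<Sum>p | p permutes {0..<n}. signof p * (\<Prod>i = 0..<n. A w i (p i)))"
      by (subst det_def'[of _ n])
         (auto intro!: sum.cong prod.cong simp: permutes_in_image[of _ "{0..<n}", simplified])
  qed
  thus ?thesis
    using assms
    by (auto intro!: borel_measurable_sum borel_measurable_times borel_measurable_prod
        simp: permutes_in_image[of _ "{0..<n}", simplified])
qed

text \<open>Cofactors are determinants of submatrices, hence polynomials in the entries;
  \<open>mat_delete\<close> is spelled out with shifted indices to make this visible.\<close>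

lemma measurable_finv:
  assumes A: "\<And>i j. (\<lambda>w. A w i j) \<in> borel_measurable N" and ij: "i < n" "j < n"
  shows "(\<lambda>w. finv n (A w) i j) \<in> borel_measurable N"
proof -
  have "finv n (A w) i j = (- 1) ^ (j + i) * Determinant.det (Matrix.mat (n - 1) (n - 1)
      (\<lambda>(a, b). A w (if a < j then a else Suc a) (if b < i then b else Suc b))) / fdet n (A w)" for w
  proof -
    have "mat_delete (Matrix.mat n n (\<lambda>(i, j). A w i j)) j i = Matrix.mat (n - 1) (n - 1)
      (\<lambda>(a, b). A w (if a < j then a else Suc a) (if b < i then b else Suc b))"
      using ij by (intro eq_matI) (auto simp: mat_delete_def)
    thus ?thesis using ij by (simp add: finv_def adj_mat_def cofactor_def)
  qed
  thus ?thesis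
    unfolding fdet_def by (auto intro!: borel_measurable_divide borel_measurable_times measurable_det A)
qed

lemma measurable_gdens_pair:
  assumes A: "\<And>i j. (\<lambda>w. A w i j) \<in> borel_measurable N"
    and x: "\<And>i. i < n \<Longrightarrow> (\<lambda>w. x w i) \<in> borel_measurable N"
  shows "(\<lambda>w. gdens n (A w) (x w)) \<in> borel_measurable N"
proof -
  have "(\<lambda>w. qf n (finv n (A w)) (x w)) \<in> borel_measurable N"
    unfolding qf_def bf_def using x
    by (intro borel_measurable_sum borel_measurable_times measurable_finv A) auto
  moreover have "(\<lambda>w. fdet n (A w)) \<in> borel_measurable N"
    unfolding fdet_def by (rule measurable_det[OF A])
  ultimately show ?thesis unfolding gdens_def by measurable
qed

text \<open>The posterior is evaluated at the whole sequence of observations, the sampling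
  distribution lives on its restriction to the first n; the likelihood does not see the
  difference.\<close>

lemma gdens_cong: "(\<And>i. i < n \<Longrightarrow> x i = y i) \<Longrightarrow> gdens n T x = gdens n T y"
  using qf_cong[of n x y] by (simp add: gdens_def)

section \<open>The posterior\<close>

text \<open>The constants m and M are common to the model, while each member has its own exponent d;
  \<open>d0\<close> is the exponent of the true density. Equicontinuity is added as a separate
  hypothesis where the loss is controlled.\<close>

locale gaussian_bayes =
  fixes \<Omega> :: "'w measure" and X :: "nat \<Rightarrow> 'w \<Rightarrow> real" and f0 :: "real \<Rightarrow> real" and m0 M0 d0 m M :: real
    and P :: "(real \<Rightarrow> real) measure"
  assumes process: "gaussian_process \<Omega> X f0"
    and reg0: "reg m0 M0 d0 f0"
    and P_prob: "prob_space P"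
    and P_ev: "\<And>v. v \<in> freqs \<Longrightarrow> (\<lambda>f. f v) \<in> borel_measurable P"
    and P_reg: "\<And>f. f \<in> space P \<Longrightarrow> \<exists>d. reg m M d f"
begin

sublocale P: prob_space P by (rule P_prob)

sublocale \<Omega>: prob_space \<Omega> using process by (simp add: gaussian_process_def)

definition smp :: "nat \<Rightarrow> 'w \<Rightarrow> nat \<Rightarrow> real" where
  "smp n \<omega> = (\<lambda>i\<in>{..<n}. X i \<omega>)"

abbreviation lik :: "nat \<Rightarrow> (real \<Rightarrow> real) \<Rightarrow> (nat \<Rightarrow> real) \<Rightarrow> real" where
  "lik n f x \<equiv> gdens n (tp f) x"

lemma P_dens:
  assumes "f \<in> space P"
  shows "integrable fm f" "v \<in> freqs \<Longrightarrow> 0 < f v" "pos_def n (tp f)"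
proof -
  obtain d where d: "reg m M d f" using P_reg[OF assms] by blast
  show "integrable fm f" by (rule reg_integrable[OF d])
  show "v \<in> freqs \<Longrightarrow> 0 < f v" by (rule reg_pos[OF d])
  show "pos_def n (tp f)" by (rule pos_def_tp[OF reg_integrable[OF d] reg_pos[OF d]])
qed

lemma f0_dens: "integrable fm f0" "v \<in> freqs \<Longrightarrow> 0 < f0 v" "pos_def n (tp f0)"
  by (rule reg_integrable[OF reg0], rule reg_pos[OF reg0], assumption,
      rule pos_def_tp[OF reg_integrable[OF reg0] reg_pos[OF reg0]])

lemma ev_measurable [measurable]: "(\<lambda>(f, v). f v) \<in> borel_measurable (P \<Otimes>\<^sub>M fm)"
proof (rule measurable_ev)
  show "continuous_on freqs f \<and> (\<forall>v\<in>freqs. f (- v) = f v)" if "f \<in> space P" for f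
    using P_reg[OF that] by (auto simp: reg_def)
qed (rule P_ev)

lemma measurable_P_integral:
  assumes [measurable]: "g \<in> borel_measurable fm"
  shows "(\<lambda>f. \<integral>v. f v * g v \<partial>fm) \<in> borel_measurable P"
  using ev_measurable by (intro fm.borel_measurable_lebesgue_integral) (simp add: split_beta')

lemma tp_measurable [measurable]: "(\<lambda>f. tp f j k) \<in> borel_measurable P"
  unfolding tp_def
  by (rule measurable_P_integral, intro measurable_fm borel_measurable_continuous_onI continuous_intros)

lemma lik_measurable [measurable]:
  "(\<lambda>(f, x). lik n f x) \<in> borel_measurable (P \<Otimes>\<^sub>M Ln n)"
  unfolding split_beta'
  by (intro measurable_gdens_pair measurable_compose[OF measurable_fst tp_measurable]
      measurable_compose[OF measurable_snd measurable_component_singleton[of _ _ "\<lambda>_. lborel", simplified]]) auto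

lemma lik_measurable_P: "x \<in> space (Ln n) \<Longrightarrow> (\<lambda>f. lik n f x) \<in> borel_measurable P"
  using measurable_compose[OF measurable_Pair2'[of x "Ln n" P] lik_measurable[of n]] by simp

lemma smp_distributed: "distributed \<Omega> (Ln n) (smp n) (\<lambda>x. ennreal (lik n f0 x))"
proof -
  have "distributed \<Omega> (Ln n) (\<lambda>\<omega>. \<lambda>i\<in>{..<n}. X i \<omega>) (\<lambda>x. ennreal (gauss_lik n f0 x))"
    using process by (simp add: gaussian_process_def)
  moreover have "gauss_lik n f0 = lik n f0"
    using gauss_lik_eq[OF f0_dens(1,2)] by auto
  ultimately show ?thesis unfolding smp_def[abs_def] by simp
qed

lemma smp_measurable [measurable]: "smp n \<in> measurable \<Omega> (Ln n)"
  using smp_distributed[of n] by (simp add: distributed_def)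

lemma smp_space: "\<omega> \<in> space \<Omega> \<Longrightarrow> smp n \<omega> \<in> space (Ln n)"
  by (rule measurable_space[OF smp_measurable])

lemma lik_pos: "f \<in> space P \<Longrightarrow> 0 < lik n f x"
  by (rule gdens_pos[OF P_dens(3)])

lemma lik0_pos: "0 < lik n f0 x"
  by (rule gdens_pos[OF f0_dens(3)])

text \<open>First Borel-Cantelli lemma: the probability of \<open>E n\<close> is the integral of the
  true likelihood over it, and the bound may start at any index.\<close>

lemma AE_eventually_smp:
  assumes E: "\<And>n. E n \<in> sets (Ln n)" and b: "summable b" "\<And>n. 0 \<le> b n"
    and ev: "\<forall>\<^sub>F n in sequentially. (\<integral>\<^sup>+x. ennreal (lik n f0 x) * indicator (E n) x \<partial>Ln n) \<le> ennreal (b n)"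
  shows "AE \<omega> in \<Omega>. \<forall>\<^sub>F n in sequentially. smp n \<omega> \<notin> E n"
proof -
  obtain n0 where n0: "\<And>n. n0 \<le> n \<Longrightarrow> (\<integral>\<^sup>+x. ennreal (lik n f0 x) * indicator (E n) x \<partial>Ln n) \<le> ennreal (b n)"
    using ev unfolding eventually_sequentially by blast
  define A where "A = (\<lambda>n. smp n -` E n \<inter> space \<Omega>)"
  have A: "A n \<in> sets \<Omega>" for n
    unfolding A_def using E by measurable
  have le: "measure \<Omega> (A n) \<le> \<bar>b n\<bar>" if "n0 \<le> n" for n
  proof -
    have "emeasure \<Omega> (A n) = (\<integral>\<^sup>+x. ennreal (lik n f0 x) * indicator (E n) x \<partial>Ln n)"
      unfolding A_def by (rule distributed_emeasure[OF smp_distributed E])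
    also have "\<dots> \<le> ennreal (b n)" by (rule n0[OF that])
    also have "\<dots> \<le> ennreal \<bar>b n\<bar>" by (intro ennreal_leI) simp
    finally show ?thesis by (simp add: \<Omega>.emeasure_eq_measure)
  qed
  have "summable (\<lambda>n. measure \<Omega> (A n))"
  proof (rule summable_comparison_test_ev)
    show "\<forall>\<^sub>F n in sequentially. norm (measure \<Omega> (A n)) \<le> \<bar>b n\<bar>"
      unfolding eventually_sequentially using le by auto

    show "summable (\<lambda>n. \<bar>b n\<bar>)" using b by simp
  qed
  hence "AE \<omega> in \<Omega>. \<forall>\<^sub>F n in sequentially. \<omega> \<in> space \<Omega> - A n"
    by (intro borel_cantelli_AE1 A) (auto simp: \<Omega>.emeasure_eq_measure)
  thus ?thesis
    by (rule AE_mp) (auto intro!: AE_I2 elim!: eventually_mono simp: A_def)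
qed

lemma sigma_finite_Ln: "sigma_finite_measure (Ln n)"
proof -
  interpret product_sigma_finite "\<lambda>_::nat. lborel :: real measure" by standard
  show ?thesis by (rule sigma_finite) simp
qed

section \<open>Lower bound for the evidence\<close>

lemma lik_pair_measurable:
  "(\<lambda>z. lik n (fst z) (smp n (snd z))) \<in> borel_measurable (P \<Otimes>\<^sub>M \<Omega>)"
proof -
  have "(\<lambda>z. (fst z, smp n (snd z))) \<in> measurable (P \<Otimes>\<^sub>M \<Omega>) (P \<Otimes>\<^sub>M Ln n)"
    by measurable
  from measurable_compose[OF this lik_measurable[of n]] show ?thesis by simp
qed

lemma lik0_smp_measurable: "(\<lambda>\<omega>. lik n f0 (smp n \<omega>)) \<in> borel_measurable \<Omega>"
  by (rule measurable_compose[OF smp_measurable measurable_gdens])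

text \<open>For each f in B the tail bound holds almost surely from some index on, with exceptional
  set and index depending on f. Fubini exchanges the quantifiers, so that almost every path is good
  for almost every f, and Fatou's lemma on B removes the dependence of the index on f.\<close>

lemma lik_ratio_lower:
  assumes B: "B \<in> sets P" "0 < measure P B" and \<epsilon>: "0 < \<epsilon>" "\<epsilon> \<le> 1"
    and h: "\<And>f. f \<in> B \<Longrightarrow> h_disc f0 f \<le> ennreal \<epsilon>"
    and close: "\<And>f d. f \<in> B \<Longrightarrow> reg m M d f \<Longrightarrow> \<bar>d0 - d\<bar> \<le> (1 - 2 * d0) / 16"
  shows "AE \<omega> in \<Omega>. \<forall>\<^sub>F n in sequentially.
    ennreal (measure P B / 2 * exp (- (3 * \<epsilon> * real n)) * lik n f0 (smp n \<omega>)) \<le> (\<integral>\<^sup>+f. ennreal (lik n f (smp n \<omega>)) \<partial>P)"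
proof -
  interpret PO: pair_sigma_finite P \<Omega> ..
  define G where "G = (\<lambda>f \<omega>. f \<in> B \<longrightarrow> (\<forall>\<^sub>F n in sequentially. lik n f0 (smp n \<omega>) \<le> exp (3 * \<epsilon> * real n) * lik n f (smp n \<omega>)))"
  have "AE \<omega> in \<Omega>. G f \<omega>" for f
  proof (cases "f \<in> B")
    case True
    hence fP: "f \<in> space P" using sets.sets_into_space[OF B(1)] by auto
    then obtain d where d: "reg m M d f" using P_reg by blast
    have dd: "-1/2 < d0" "d0 < 1/2" using reg0 by (auto simp: reg_def)
    note cl = close[OF True d]
    have cl2: "\<bar>d0 - d\<bar> < 1/2" using cl dd by (simp add: field_simps)
    obtain c where c: "0 < c" and ev: "\<forall>\<^sub>F n in sequentially.
      (\<integral>\<^sup>+x. ennreal (lik n f0 x) * indicator {x. exp (3 * \<epsilon> * real n) * lik n f x \<le> lik n f0 x} x \<partial>Ln n) \<le> ennreal (exp (- (c * sqrt (real n))))"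
      using likelihood_ratio_tail[OF reg0 d cl \<epsilon> h_disc_le_real[OF reg0 d cl2 h[OF True]]] \<epsilon> by auto
    define E where "E = (\<lambda>n. {x \<in> space (Ln n). exp (3 * \<epsilon> * real n) * lik n f x \<le> lik n f0 x})"
    have "AE \<omega> in \<Omega>. \<forall>\<^sub>F n in sequentially. smp n \<omega> \<notin> E n"
    proof (rule AE_eventually_smp)
      show "E n \<in> sets (Ln n)" for n unfolding E_def by measurable
      show "summable (\<lambda>n. exp (- (c * sqrt (real n))))" by (rule summable_exp_sqrt[OF c])
      show "\<forall>\<^sub>F n in sequentially. (\<integral>\<^sup>+x. ennreal (lik n f0 x) * indicator (E n) x \<partial>Ln n) \<le> ennreal (exp (- (c * sqrt (real n))))"
        using ev
      proof eventually_elim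
        case (elim n)
        have "(\<integral>\<^sup>+x. ennreal (lik n f0 x) * indicator (E n) x \<partial>Ln n)
            = (\<integral>\<^sup>+x. ennreal (lik n f0 x) * indicator {x. exp (3 * \<epsilon> * real n) * lik n f x \<le> lik n f0 x} x \<partial>Ln n)"
          by (intro nn_integral_cong) (auto simp: E_def indicator_def)
        thus ?case using elim by simp
      qed
    qed simp
    thus ?thesis
    proof (rule AE_mp, intro AE_I2 impI)
      fix \<omega> assume \<omega>: "\<omega> \<in> space \<Omega>" and "\<forall>\<^sub>F n in sequentially. smp n \<omega> \<notin> E n"
      from this(2) have "\<forall>\<^sub>F n in sequentially. lik n f0 (smp n \<omega>) \<le> exp (3 * \<epsilon> * real n) * lik n f (smp n \<omega>)"
        by eventually_elim (use smp_space[OF \<omega>] in \<open>auto simp: E_def not_le intro: less_imp_le\<close>)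
      thus "G f \<omega>" by (simp add: G_def)
    qed
  qed (simp add: G_def)
  hence "AE f in P. AE \<omega> in \<Omega>. G f \<omega>" by auto
  moreover have "{z \<in> space (P \<Otimes>\<^sub>M \<Omega>). G (fst z) (snd z)} \<in> sets (P \<Otimes>\<^sub>M \<Omega>)"
  proof -
    have [measurable]: "(\<lambda>z. lik n f0 (smp n (snd z))) \<in> borel_measurable (P \<Otimes>\<^sub>M \<Omega>)" for n
      by (rule measurable_compose[OF measurable_snd lik0_smp_measurable])
    note lik_pair_measurable[measurable]
    show ?thesis unfolding G_def using B(1) by measurable
  qed
  ultimately have "AE \<omega> in \<Omega>. AE f in P. G f \<omega>"
    by (subst (asm) PO.AE_commute)
  thus ?thesis
  proof (rule AE_mp, intro AE_I2 impI)
    fix \<omega> assume \<omega>: "\<omega> \<in> space \<Omega>" and good: "AE f in P. G f \<omega>"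
    define x where "x = (\<lambda>n. smp n \<omega>)"
    have x: "x n \<in> space (Ln n)" for n unfolding x_def by (rule smp_space[OF \<omega>])
    define p where "p = measure P B"
    have p: "0 < p" using B by (simp add: p_def)
    have [measurable]: "(\<lambda>f. lik n f (x n)) \<in> borel_measurable P" for n
      by (rule lik_measurable_P[OF x])
    \<comment> \<open>Normalized so that its limit inferior is at least 1 for almost every f in B.
      Fatou then bounds the limit inferior of the integrals below by p, and the smaller number
      \<open>p / 2\<close> is eventually exceeded.\<close>
    define g where "g = (\<lambda>n f. ennreal (exp (3 * \<epsilon> * real n) / lik n f0 (x n) * lik n f (x n)) * indicator B f)"
    have [measurable]: "g n \<in> borel_measurable P" for n
      unfolding g_def using B(1) by measurable
    have "ennreal p = (\<integral>\<^sup>+f. indicator B f \<partial>P)"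
      using B(1) by (simp add: p_def P.emeasure_eq_measure)
    also have "\<dots> \<le> (\<integral>\<^sup>+f. liminf (\<lambda>n. g n f) \<partial>P)"
    proof (rule nn_integral_mono_AE)
      show "AE f in P. indicator B f \<le> liminf (\<lambda>n. g n f)"
        using good
      proof eventually_elim
        case (elim f)
        show ?case
        proof (cases "f \<in> B")
          case True
          hence "\<forall>\<^sub>F n in sequentially. lik n f0 (x n) \<le> exp (3 * \<epsilon> * real n) * lik n f (x n)"
            using elim by (simp add: G_def x_def)
          hence "\<forall>\<^sub>F n in sequentially. indicator B f \<le> g n f"
          proof eventually_elim
            case (elim n)
            hence "1 \<le> exp (3 * \<epsilon> * real n) / lik n f0 (x n) * lik n f (x n)"
              using lik0_pos[of n "x n"] by (simp add: field_simps)
            thus ?case using True by (simp add: g_def)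
          qed
          thus ?thesis by (rule Liminf_bounded)
        qed simp
      qed
    qed
    also have "\<dots> \<le> liminf (\<lambda>n. \<integral>\<^sup>+f. g n f \<partial>P)"
      by (rule nn_integral_liminf) measurable
    finally have "ennreal p \<le> liminf (\<lambda>n. \<integral>\<^sup>+f. g n f \<partial>P)" .
    moreover have "ennreal (p / 2) < ennreal p" using p by (simp add: ennreal_less_iff)
    ultimately have "\<forall>\<^sub>F n in sequentially. ennreal (p / 2) < (\<integral>\<^sup>+f. g n f \<partial>P)"
      by (intro less_LiminfD) (auto intro: less_le_trans)
    hence "\<forall>\<^sub>F n in sequentially. ennreal (p / 2 * exp (- (3 * \<epsilon> * real n)) * lik n f0 (x n)) \<le> (\<integral>\<^sup>+f. ennreal (lik n f (x n)) \<partial>P)"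
    proof eventually_elim
      case (elim n)
      define a where "a = exp (3 * \<epsilon> * real n) / lik n f0 (x n)"
      have a: "0 < a" using lik0_pos[of n "x n"] by (simp add: a_def)
      have "(\<integral>\<^sup>+f. g n f \<partial>P) \<le> (\<integral>\<^sup>+f. ennreal a * ennreal (lik n f (x n)) \<partial>P)"
        unfolding g_def a_def[symmetric] using a lik_pos
        by (intro nn_integral_mono) (auto simp: indicator_def ennreal_mult[symmetric] less_imp_le)
      also have "\<dots> = ennreal a * (\<integral>\<^sup>+f. ennreal (lik n f (x n)) \<partial>P)"
        by (rule nn_integral_cmult) measurable
      finally have "ennreal (p / 2) \<le> ennreal a * (\<integral>\<^sup>+f. ennreal (lik n f (x n)) \<partial>P)" using elim by simp
      hence "ennreal (1 / a) * ennreal (p / 2) \<le> ennreal (1 / a) * (ennreal a * (\<integral>\<^sup>+f. ennreal (lik n f (x n)) \<partial>P))"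
        by (intro mult_left_mono) auto
      also have "\<dots> = (\<integral>\<^sup>+f. ennreal (lik n f (x n)) \<partial>P)"
        using a by (simp add: mult.assoc[symmetric] ennreal_mult[symmetric])
      also have "ennreal (1 / a) * ennreal (p / 2) = ennreal (p / 2 * exp (- (3 * \<epsilon> * real n)) * lik n f0 (x n))"
      proof -
        have "1 / a * (p / 2) = p / 2 * exp (- (3 * \<epsilon> * real n)) * lik n f0 (x n)"
          by (simp add: a_def exp_minus field_simps)
        moreover have "ennreal (1 / a) * ennreal (p / 2) = ennreal (1 / a * (p / 2))"
          using a p by (subst ennreal_mult) auto
        ultimately show ?thesis by simp
      qed
      finally show ?case .
    qed
    thus "\<forall>\<^sub>F n in sequentially. ennreal (measure P B / 2 * exp (- (3 * \<epsilon> * real n)) * lik n f0 (smp n \<omega>)) \<le> (\<integral>\<^sup>+f. ennreal (lik n f (smp n \<omega>)) \<partial>P)"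
      by (simp add: x_def p_def)
  qed
qed

text \<open>A small neighbourhood serves two purposes: \<open>h_disc\<close> below \<epsilon> bounds
  the loss per observation, and below \<tau> it forces the exponents close enough for the tail
  bound. Half of \<beta> pays for \<open>3 * \<epsilon>\<close>, the other half for the prior mass
  of the neighbourhood.\<close>

lemma evidence_lower:
  assumes B: "\<And>\<epsilon>. 0 < \<epsilon> \<Longrightarrow> 0 < measure P (B \<epsilon>)" and h: "\<And>\<epsilon> f. f \<in> B \<epsilon> \<Longrightarrow> h_disc f0 f \<le> ennreal \<epsilon>"
    and \<beta>: "0 < \<beta>"
  shows "AE \<omega> in \<Omega>. \<forall>\<^sub>F n in sequentially.
    ennreal (exp (- (\<beta> * real n)) * lik n f0 (smp n \<omega>)) \<le> (\<integral>\<^sup>+f. ennreal (lik n f (smp n \<omega>)) \<partial>P)"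
proof -
  \<comment> \<open>A set outside the sigma-algebra has \<open>measure\<close> 0, so positive mass
    implies measurability.\<close>
  have sB: "B e \<in> sets P" if "0 < e" for e
    using B[OF that] measure_notin_sets[of "B e" P] by fastforce
  have "space P \<noteq> {}" by (rule P.not_empty)
  then obtain g where "g \<in> space P" by blast
  then obtain d where g: "reg m M d g" using P_reg by blast
  note c1 = reg_const[OF g] reg_const[OF reg0]
  define c where "c = min (m0 / M) (m / M0)"
  have c: "0 < c" using c1 by (simp add: c_def)
  have dd: "-1/2 < d0" "d0 < 1/2" using reg0 by (auto simp: reg_def)
  have \<eta>: "0 < (1 - 2 * d0) / 16" using dd by simp
  obtain \<tau> where \<tau>: "0 < \<tau>" "\<And>f g m1 M1 d1 m2 M2 d2. reg m1 M1 d1 f \<Longrightarrow> reg m2 M2 d2 g \<Longrightarrow> c \<le> m1 / M2 \<Longrightarrow> c \<le> m2 / M1 \<Longrightarrow>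
    h_disc f g \<le> ennreal \<tau> \<Longrightarrow> \<bar>d1 - d2\<bar> < (1 - 2 * d0) / 16"
    using exponent_close[OF c \<eta>] by metis
  define \<epsilon> where "\<epsilon> = min 1 (\<beta> / 6)"
  have \<epsilon>: "0 < \<epsilon>" "\<epsilon> \<le> 1" "3 * \<epsilon> \<le> \<beta> / 2" using \<beta> by (auto simp: \<epsilon>_def)
  define e where "e = min \<epsilon> \<tau>"
  have e: "0 < e" using \<epsilon> \<tau> by (simp add: e_def)
  have "AE \<omega> in \<Omega>. \<forall>\<^sub>F n in sequentially.
    ennreal (measure P (B e) / 2 * exp (- (3 * \<epsilon> * real n)) * lik n f0 (smp n \<omega>)) \<le> (\<integral>\<^sup>+f. ennreal (lik n f (smp n \<omega>)) \<partial>P)"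
  proof (rule lik_ratio_lower[OF sB[OF e] B[OF e] \<epsilon>(1,2)])
    fix f assume f: "f \<in> B e"
    show "h_disc f0 f \<le> ennreal \<epsilon>"
      using h[OF f] by (rule order_trans) (auto simp: e_def intro: ennreal_leI)
    fix d assume d: "reg m M d f"
    have "h_disc f0 f \<le> ennreal \<tau>"
      using h[OF f] by (rule order_trans) (auto simp: e_def intro: ennreal_leI)
    thus "\<bar>d0 - d\<bar> \<le> (1 - 2 * d0) / 16"
      using \<tau>(2)[OF reg0 d] by (simp add: c_def less_imp_le)
  qed
  moreover have "\<forall>\<^sub>F n in sequentially. exp (- (\<beta> / 2 * real n)) < measure P (B e) / 2"
  proof -
    have "(\<lambda>n. exp (- (\<beta> / 2 * real n))) \<longlonglongrightarrow> 0" using \<beta> by real_asymp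
    thus ?thesis using B[OF e] by (intro order_tendstoD) auto
  qed
  ultimately show ?thesis
  proof (elim AE_mp, intro AE_I2 impI)
    fix \<omega>
    assume "\<forall>\<^sub>F n in sequentially.
      ennreal (measure P (B e) / 2 * exp (- (3 * \<epsilon> * real n)) * lik n f0 (smp n \<omega>)) \<le> (\<integral>\<^sup>+f. ennreal (lik n f (smp n \<omega>)) \<partial>P)"
     and "\<forall>\<^sub>F n in sequentially. exp (- (\<beta> / 2 * real n)) < measure P (B e) / 2"
    thus "\<forall>\<^sub>F n in sequentially.
      ennreal (exp (- (\<beta> * real n)) * lik n f0 (smp n \<omega>)) \<le> (\<integral>\<^sup>+f. ennreal (lik n f (smp n \<omega>)) \<partial>P)"
    proof eventually_elim
      case (elim n)
      have "exp (- (\<beta> * real n)) = exp (- (\<beta> / 2 * real n)) * exp (- (\<beta> / 2 * real n))"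
        by (simp add: exp_add[symmetric])
      also have "\<dots> \<le> measure P (B e) / 2 * exp (- (3 * \<epsilon> * real n))"
        using elim(2) mult_right_mono[OF \<epsilon>(3), of "real n"] by (intro mult_mono) auto
      finally have "exp (- (\<beta> * real n)) * lik n f0 (smp n \<omega>) \<le> measure P (B e) / 2 * exp (- (3 * \<epsilon> * real n)) * lik n f0 (smp n \<omega>)"
        using lik0_pos by (intro mult_right_mono) (auto simp: less_imp_le)
      thus ?case using elim(1) by (meson ennreal_leI order_trans)
    qed
  qed
qed

section \<open>Tests based on filtered variances\<close>

definition vfil :: "nat \<Rightarrow> (nat \<Rightarrow> real) \<Rightarrow> (real \<Rightarrow> real) \<Rightarrow> real" where
  "vfil W w f = (\<integral>v. f v * pw W w v \<partial>fm)"

definition bad :: "nat \<Rightarrow> (nat \<Rightarrow> real) \<Rightarrow> real \<Rightarrow> (real \<Rightarrow> real) set" where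
  "bad W w \<delta> = {f \<in> space P. \<delta> \<le> \<bar>vfil W w f - vfil W w f0\<bar>}"

lemma bad_sets [measurable]: "bad W w \<delta> \<in> sets P"
proof -
  have [measurable]: "vfil W w \<in> borel_measurable P"
    unfolding vfil_def by (rule measurable_P_integral) measurable
  show ?thesis unfolding bad_def by measurable
qed

text \<open>The test rejects on \<open>E n\<close>, where the filtered second moment is far from its
  mean under \<open>f0\<close>. Off \<open>E n\<close> it is far from its mean under every bad f, an
  event of exponentially small probability uniformly in f; averaging over the prior by Fubini
  controls the numerator.\<close>

lemma bad_numerator:
  assumes K: "0 < K" "\<And>f v. f \<in> insert f0 (space P) \<Longrightarrow> v \<in> freqs \<Longrightarrow> pw W w v * f v \<le> K" and \<delta>: "0 < \<delta>"
  shows "\<exists>c>0. AE \<omega> in \<Omega>. \<forall>\<^sub>F n in sequentially.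
    (\<integral>\<^sup>+f. ennreal (lik n f (smp n \<omega>)) * indicator (bad W w \<delta>) f \<partial>P) \<le> ennreal (exp (- (c * real n)) * lik n f0 (smp n \<omega>))"
proof -
  let ?N = "\<lambda>n. real (n - W)" and ?V = "vfil W w" and ?B = "bad W w \<delta>"
  obtain s where s: "0 < s" and conc: "\<And>f n. integrable fm f \<Longrightarrow> (\<forall>v\<in>freqs. 0 < f v \<and> pw W w v * f v \<le> K) \<Longrightarrow> W \<le> n \<Longrightarrow>
    (\<integral>\<^sup>+x. ennreal (lik n f x) * indicator {x. ?N n * (\<delta> / 2) \<le> \<bar>fstat W w n x - ?N n * ?V f\<bar>} x \<partial>Ln n)
      \<le> ennreal (2 * exp (- (s * ?N n)))"
    using fstat_concentration[OF K(1), of "\<delta> / 2" W w] \<delta> unfolding vfil_def by auto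
  define E where "E = (\<lambda>n. {x \<in> space (Ln n). ?N n * (\<delta> / 2) \<le> \<bar>fstat W w n x - ?N n * ?V f0\<bar>})"
  define I where "I = (\<lambda>n x. \<integral>\<^sup>+f. ennreal (lik n f x) * indicator ?B f \<partial>P)"
  have likm: "(\<lambda>(x, f). ennreal (lik n f x) * indicator ?B f) \<in> borel_measurable (Ln n \<Otimes>\<^sub>M P)" for n
  proof -
    have "(\<lambda>z. lik n (snd z) (fst z)) \<in> borel_measurable (Ln n \<Otimes>\<^sub>M P)"
      using measurable_pair_swap[OF lik_measurable[of n]] by (simp add: split_beta')
    thus ?thesis by (simp add: split_beta')
  qed
  have [measurable]: "I n \<in> borel_measurable (Ln n)" for n
    unfolding I_def using P.borel_measurable_nn_integral[OF likm] by simp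
  have [measurable]: "E n \<in> sets (Ln n)" for n unfolding E_def by measurable
  \<comment> \<open>Where the test accepts although the numerator is large relative to the true
    likelihood. On \<open>F n\<close> the latter is at most \<open>exp (s / 2 * N)\<close> times the
    numerator, N being \<open>n - W\<close>, and the integral of the numerator off
    \<open>E n\<close> is at most \<open>2 * exp (- s * N)\<close>; half of the rate remains and is
    summable.\<close>
  define F where "F = (\<lambda>n. {x \<in> space (Ln n). x \<notin> E n \<and> ennreal (exp (- (s / 2 * ?N n)) * lik n f0 x) \<le> I n x})"
  have [measurable]: "F n \<in> sets (Ln n)" for n
  proof -
    have "{x \<in> space (Ln n). ennreal (exp (- (s / 2 * ?N n)) * lik n f0 x) \<le> I n x} \<in> sets (Ln n)"
      by (rule borel_measurable_le) auto
    moreover have "F n = {x \<in> space (Ln n). ennreal (exp (- (s / 2 * ?N n)) * lik n f0 x) \<le> I n x} - E n"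
      by (auto simp: F_def)
    ultimately show ?thesis by auto
  qed
  have sumN: "summable (\<lambda>n. 2 * exp (- (a * ?N n)))" if a: "0 < a" for a
  proof -
    have "summable (\<lambda>n. exp (- a) ^ n)" using a by (intro summable_geometric) auto
    hence "summable (\<lambda>n. 2 * exp (- (a * ?N (n + W))))"
      by (intro summable_mult) (simp add: exp_of_nat_mult[symmetric] mult.commute)
    thus ?thesis by (subst (asm) summable_iff_shift)
  qed
  have "AE \<omega> in \<Omega>. \<forall>\<^sub>F n in sequentially. smp n \<omega> \<notin> E n"
  proof (rule AE_eventually_smp)
    show "summable (\<lambda>n. 2 * exp (- (s * ?N n)))" by (rule sumN[OF s])
    show "\<forall>\<^sub>F n in sequentially. (\<integral>\<^sup>+x. ennreal (lik n f0 x) * indicator (E n) x \<partial>Ln n) \<le> ennreal (2 * exp (- (s * ?N n)))"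
      using eventually_ge_at_top[of W]
    proof eventually_elim
      case (elim n)
      have "(\<integral>\<^sup>+x. ennreal (lik n f0 x) * indicator (E n) x \<partial>Ln n)
        = (\<integral>\<^sup>+x. ennreal (lik n f0 x) * indicator {x. ?N n * (\<delta> / 2) \<le> \<bar>fstat W w n x - ?N n * ?V f0\<bar>} x \<partial>Ln n)"
        by (intro nn_integral_cong) (auto simp: E_def indicator_def)
      also have "\<dots> \<le> ennreal (2 * exp (- (s * ?N n)))"
        using elim K(2)[of f0] f0_dens by (intro conc) auto
      finally show ?case .
    qed
  qed auto
  moreover have "AE \<omega> in \<Omega>. \<forall>\<^sub>F n in sequentially. smp n \<omega> \<notin> F n"
  proof (rule AE_eventually_smp)
    show "summable (\<lambda>n. 2 * exp (- (s / 2 * ?N n)))" using s by (intro sumN) auto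
    show "\<forall>\<^sub>F n in sequentially. (\<integral>\<^sup>+x. ennreal (lik n f0 x) * indicator (F n) x \<partial>Ln n) \<le> ennreal (2 * exp (- (s / 2 * ?N n)))"
      using eventually_ge_at_top[of W]
    proof eventually_elim
      case (elim n)
      interpret Ln: sigma_finite_measure "Ln n" by (rule sigma_finite_Ln)
      interpret LP: pair_sigma_finite "Ln n" P ..
      let ?C = "\<lambda>x. indicator (space (Ln n) - E n) x :: ennreal"
      have "(\<integral>\<^sup>+x. ennreal (lik n f0 x) * indicator (F n) x \<partial>Ln n) \<le> (\<integral>\<^sup>+x. ennreal (exp (s / 2 * ?N n)) * (I n x * ?C x) \<partial>Ln n)"
      proof (intro nn_integral_mono)
        fix x
        show "ennreal (lik n f0 x) * indicator (F n) x \<le> ennreal (exp (s / 2 * ?N n)) * (I n x * ?C x)"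
        proof (cases "x \<in> F n")
          case True
          have "ennreal (lik n f0 x) = ennreal (exp (s / 2 * ?N n)) * ennreal (exp (- (s / 2 * ?N n)) * lik n f0 x)"
            using lik0_pos[of n x] by (simp add: ennreal_mult[symmetric] mult.assoc[symmetric] exp_add[symmetric] less_imp_le)
          also have "\<dots> \<le> ennreal (exp (s / 2 * ?N n)) * I n x"
            using True by (intro mult_left_mono) (auto simp: F_def)
          finally show ?thesis using True by (simp add: F_def)
        qed simp
      qed
      also have "\<dots> = ennreal (exp (s / 2 * ?N n)) * (\<integral>\<^sup>+x. I n x * ?C x \<partial>Ln n)"
        by (rule nn_integral_cmult) measurable
      also have "(\<integral>\<^sup>+x. I n x * ?C x \<partial>Ln n) = (\<integral>\<^sup>+x. \<integral>\<^sup>+f. ennreal (lik n f x) * indicator ?B f * ?C x \<partial>P \<partial>Ln n)"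
      proof (intro nn_integral_cong)
        fix x assume "x \<in> space (Ln n)"
        from measurable_compose[OF measurable_Pair1'[OF this] likm]
        show "I n x * ?C x = (\<integral>\<^sup>+f. ennreal (lik n f x) * indicator ?B f * ?C x \<partial>P)"
          unfolding I_def by (subst nn_integral_multc) auto
      qed
      also have "\<dots> = (\<integral>\<^sup>+f. \<integral>\<^sup>+x. ennreal (lik n f x) * indicator ?B f * ?C x \<partial>Ln n \<partial>P)"
      proof (rule LP.Fubini'[symmetric])
        have "(\<lambda>z. (\<lambda>(x, f). ennreal (lik n f x) * indicator ?B f) z * ?C (fst z)) \<in> borel_measurable (Ln n \<Otimes>\<^sub>M P)"
          using likm[of n] by measurable
        thus "(\<lambda>(x, f). ennreal (lik n f x) * indicator ?B f * ?C x) \<in> borel_measurable (Ln n \<Otimes>\<^sub>M P)"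
          by (simp add: split_beta')
      qed
      also have "\<dots> \<le> (\<integral>\<^sup>+f. ennreal (2 * exp (- (s * ?N n))) \<partial>P)"
      proof (intro nn_integral_mono)
        fix f assume f: "f \<in> space P"
        show "(\<integral>\<^sup>+x. ennreal (lik n f x) * indicator ?B f * ?C x \<partial>Ln n) \<le> ennreal (2 * exp (- (s * ?N n)))"
        proof (cases "f \<in> ?B")
          case True
          have far: "?N n * (\<delta> / 2) \<le> \<bar>q - ?N n * ?V f\<bar>" if "\<not> ?N n * (\<delta> / 2) \<le> \<bar>q - ?N n * ?V f0\<bar>" for q
          proof -
            have "?N n * \<delta> \<le> ?N n * \<bar>?V f - ?V f0\<bar>" using True by (intro mult_left_mono) (auto simp: bad_def)
            also have "\<dots> = \<bar>?N n * ?V f - ?N n * ?V f0\<bar>" unfolding right_diff_distrib[symmetric] abs_mult by simp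
            finally have "2 * (?N n * (\<delta> / 2)) \<le> \<bar>?N n * ?V f - ?N n * ?V f0\<bar>" by simp
            moreover have "a \<le> \<bar>q - y\<bar>" if "\<not> a \<le> \<bar>q - z\<bar>" "2 * a \<le> \<bar>y - z\<bar>" for a y z :: real
              using that by linarith
            ultimately show ?thesis using that by blast
          qed
          have "(\<integral>\<^sup>+x. ennreal (lik n f x) * indicator ?B f * ?C x \<partial>Ln n)
            \<le> (\<integral>\<^sup>+x. ennreal (lik n f x) * indicator {x. ?N n * (\<delta> / 2) \<le> \<bar>fstat W w n x - ?N n * ?V f\<bar>} x \<partial>Ln n)"
            using True far by (intro nn_integral_mono) (auto simp: E_def indicator_def)
          also have "\<dots> \<le> ennreal (2 * exp (- (s * ?N n)))"
            using elim K(2)[of f] P_dens[OF f] f by (intro conc) auto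
          finally show ?thesis .
        qed simp
      qed
      also have "\<dots> = ennreal (2 * exp (- (s * ?N n)))" by (simp add: P.emeasure_space_1)
      finally have "(\<integral>\<^sup>+x. ennreal (lik n f0 x) * indicator (F n) x \<partial>Ln n)
        \<le> ennreal (exp (s / 2 * ?N n)) * ennreal (2 * exp (- (s * ?N n)))"
        by (simp add: mult_left_mono)
      also have "\<dots> = ennreal (2 * exp (- (s / 2 * ?N n)))"
      proof -
        have "exp (s / 2 * ?N n) * exp (- (s * ?N n)) = exp (- (s / 2 * ?N n))"
          unfolding exp_add[symmetric] by (simp add: field_simps)
        thus ?thesis by (simp add: ennreal_mult[symmetric] mult.left_commute)
      qed
      finally show ?case .
    qed
  qed auto
  ultimately have "AE \<omega> in \<Omega>. \<forall>\<^sub>F n in sequentially. I n (smp n \<omega>) \<le> ennreal (exp (- (s / 4 * real n)) * lik n f0 (smp n \<omega>))"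
  proof (elim AE_mp, intro AE_I2 impI)
    fix \<omega> assume \<omega>: "\<omega> \<in> space \<Omega>" and EF: "\<forall>\<^sub>F n in sequentially. smp n \<omega> \<notin> E n"
      "\<forall>\<^sub>F n in sequentially. smp n \<omega> \<notin> F n"
    from EF show "\<forall>\<^sub>F n in sequentially. I n (smp n \<omega>) \<le> ennreal (exp (- (s / 4 * real n)) * lik n f0 (smp n \<omega>))"
      using eventually_ge_at_top[of "2 * W"]
    proof eventually_elim
      case (elim n)
      have "I n (smp n \<omega>) \<le> ennreal (exp (- (s / 2 * ?N n)) * lik n f0 (smp n \<omega>))"
        using elim smp_space[OF \<omega>, of n] by (auto simp: F_def)
      also have "\<dots> \<le> ennreal (exp (- (s / 4 * real n)) * lik n f0 (smp n \<omega>))"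
      proof (intro ennreal_leI mult_right_mono)
        \<comment> \<open>From \<open>2 * W\<close> on the filtered series has at least
          \<open>n / 2\<close> values, so a rate in \<open>n - W\<close> becomes half that rate in
          n.\<close>
        have "real n \<le> 2 * ?N n" using elim(3) by linarith
        hence "s / 4 * real n \<le> s / 4 * (2 * ?N n)" using s by (intro mult_left_mono) auto
        thus "exp (- (s / 2 * ?N n)) \<le> exp (- (s / 4 * real n))" by simp
      qed (use lik0_pos in \<open>simp add: less_imp_le\<close>)
      finally show ?case .
    qed
  qed
  thus ?thesis using s unfolding I_def by (intro exI[of _ "s / 4"]) auto
qed

text \<open>The evidence is a mixture of probability densities, so its Lebesgue integral is 1 and it
  is finite almost everywhere. This has to be secured because \<open>posterior\<close> divides by a
  Bochner integral, which would be 0 for an infinite evidence.\<close>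

lemma evidence_finite:
  "AE \<omega> in \<Omega>. \<forall>n. (\<integral>\<^sup>+f. ennreal (lik n f (smp n \<omega>)) \<partial>P) < \<infinity>"
proof (subst AE_all_countable, intro allI)
  fix n
  interpret Ln: sigma_finite_measure "Ln n" by (rule sigma_finite_Ln)
  interpret LP: pair_sigma_finite "Ln n" P ..
  have likm: "(\<lambda>(x, f). ennreal (lik n f x)) \<in> borel_measurable (Ln n \<Otimes>\<^sub>M P)"
  proof -
    have "(\<lambda>z. lik n (snd z) (fst z)) \<in> borel_measurable (Ln n \<Otimes>\<^sub>M P)"
      using measurable_pair_swap[OF lik_measurable[of n]] by (simp add: split_beta')
    thus ?thesis by (simp add: split_beta')
  qed
  define I where "I = (\<lambda>x. \<integral>\<^sup>+f. ennreal (lik n f x) \<partial>P)"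
  have [measurable]: "I \<in> borel_measurable (Ln n)"
    unfolding I_def using P.borel_measurable_nn_integral[OF likm] by simp
  have "(\<integral>\<^sup>+x. I x \<partial>Ln n) = (\<integral>\<^sup>+f. \<integral>\<^sup>+x. ennreal (lik n f x) \<partial>Ln n \<partial>P)"
    unfolding I_def by (rule LP.Fubini'[OF likm, symmetric])
  also have "\<dots> = (\<integral>\<^sup>+f. 1 \<partial>P)"
    by (intro nn_integral_cong nn_integral_gdens P_dens(3))
  finally have "(\<integral>\<^sup>+x. I x \<partial>Ln n) \<noteq> \<infinity>" by (simp add: P.emeasure_space_1)
  hence ae: "AE x in Ln n. I x < \<infinity>"
    using nn_integral_PInf_AE[of I "Ln n"] by (auto simp: less_top)
  have "Measurable.pred (Ln n) (\<lambda>x. I x < \<infinity>)" by measurable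
  hence "AE \<omega> in \<Omega>. I (smp n \<omega>) < \<infinity>"
    by (subst \<Omega>.distributed_AE2[OF smp_distributed]) (use ae in auto)
  thus "AE \<omega> in \<Omega>. (\<integral>\<^sup>+f. ennreal (lik n f (smp n \<omega>)) \<partial>P) < \<infinity>"
    unfolding I_def .
qed

section \<open>Bayes' formula and posterior concentration\<close>

abbreviation post :: "nat \<Rightarrow> 'w \<Rightarrow> (real \<Rightarrow> real) measure" where
  "post n \<omega> \<equiv> posterior P n (\<lambda>i. X i \<omega>)"

text \<open>The evidence is positive because every likelihood is, and finite by hypothesis, so the
  normalization is genuine. Bayes' formula is stated as a product, which avoids a quotient in
  \<open>ennreal\<close>.\<close>

lemma posterior_density:
  assumes \<omega>: "\<omega> \<in> space \<Omega>" and fin: "(\<integral>\<^sup>+f. ennreal (lik n f (smp n \<omega>)) \<partial>P) < \<infinity>"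
  shows "sets (post n \<omega>) = sets P" and "prob_space (post n \<omega>)"
    and "A \<in> sets P \<Longrightarrow> (\<integral>\<^sup>+f. ennreal (lik n f (smp n \<omega>)) * indicator A f \<partial>P)
      = emeasure (post n \<omega>) A * (\<integral>\<^sup>+f. ennreal (lik n f (smp n \<omega>)) \<partial>P)"
proof -
  define x where "x = smp n \<omega>"
  define I where "I = (\<integral>\<^sup>+f. ennreal (lik n f x) \<partial>P)"
  have xs: "x \<in> space (Ln n)" unfolding x_def by (rule smp_space[OF \<omega>])
  have [measurable]: "(\<lambda>f. lik n f x) \<in> borel_measurable P" by (rule lik_measurable_P[OF xs])
  have gl: "gauss_lik n f (\<lambda>i. X i \<omega>) = lik n f x" if "f \<in> space P" for f
  proof -
    have "gauss_lik n f (\<lambda>i. X i \<omega>) = lik n f (\<lambda>i. X i \<omega>)"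
      by (rule gauss_lik_eq) (use P_dens[OF that] in auto)
    also have "\<dots> = lik n f x"
      by (rule gdens_cong) (simp add: x_def smp_def)
    finally show ?thesis .
  qed
  have "(\<integral>f. gauss_lik n f (\<lambda>i. X i \<omega>) \<partial>P) = (\<integral>f. lik n f x \<partial>P)"
    by (intro Bochner_Integration.integral_cong refl gl)
  also have "\<dots> = enn2real I"
    unfolding I_def using lik_pos by (intro integral_eq_nn_integral AE_I2) (auto simp: less_imp_le)
  finally have Z: "(\<integral>f. gauss_lik n f (\<lambda>i. X i \<omega>) \<partial>P) = enn2real I" .
  have "I \<noteq> 0"
  proof
    assume "I = 0"
    hence "AE f in P. ennreal (lik n f x) = 0"
      unfolding I_def by (subst (asm) nn_integral_0_iff_AE) auto
    hence "AE f in P. False"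
      using AE_space[of P]
    proof eventually_elim
      case (elim f)
      thus ?case using lik_pos[of f n x] by (simp add: ennreal_eq_0_iff)
    qed
    thus False by simp
  qed
  moreover have If: "I < \<infinity>" using fin by (simp add: I_def x_def)
  ultimately obtain z where z: "I = ennreal z" "0 < z"
    by (cases I) (auto simp: less_top[symmetric] ennreal_eq_0_iff)
  have p: "post n \<omega> = density P (\<lambda>f. ennreal (1 / z) * ennreal (lik n f x))"
    unfolding posterior_def Z
  proof (intro density_cong)
    show "(\<lambda>f. ennreal (gauss_lik n f (\<lambda>i. X i \<omega>) / enn2real I)) \<in> borel_measurable P"
      by (subst measurable_cong[where g = "\<lambda>f. ennreal (lik n f x / enn2real I)"]) (auto simp: gl)
    show "AE f in P. ennreal (gauss_lik n f (\<lambda>i. X i \<omega>) / enn2real I) = ennreal (1 / z) * ennreal (lik n f x)"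
      using lik_pos z by (intro AE_I2) (auto simp: gl ennreal_mult[symmetric] less_imp_le)
  qed auto
  show "sets (post n \<omega>) = sets P" by (simp add: p)
  have em: "emeasure (post n \<omega>) A = ennreal (1 / z) * (\<integral>\<^sup>+f. ennreal (lik n f x) * indicator A f \<partial>P)" if [measurable]: "A \<in> sets P" for A
    unfolding p by (simp add: emeasure_density mult.assoc nn_integral_cmult)
  have one: "ennreal (1 / z) * ennreal z = 1"
    using z by (simp add: ennreal_mult[symmetric])
  show "prob_space (post n \<omega>)"
  proof
    have "(\<integral>\<^sup>+f. ennreal (lik n f x) * indicator (space P) f \<partial>P) = I"
      unfolding I_def by (intro nn_integral_cong) simp
    moreover have "space (post n \<omega>) = space P" by (simp add: p)
    ultimately show "emeasure (post n \<omega>) (space (post n \<omega>)) = 1"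
      using em[of "space P"] one z by simp
  qed
  show "(\<integral>\<^sup>+f. ennreal (lik n f (smp n \<omega>)) * indicator A f \<partial>P)
      = emeasure (post n \<omega>) A * (\<integral>\<^sup>+f. ennreal (lik n f (smp n \<omega>)) \<partial>P)" if "A \<in> sets P"
  proof -
    have "emeasure (post n \<omega>) A * I = (ennreal (1 / z) * ennreal z) * (\<integral>\<^sup>+f. ennreal (lik n f x) * indicator A f \<partial>P)"
      by (simp add: em[OF that] z(1) mult_ac)
    thus ?thesis unfolding one by (simp add: I_def x_def)
  qed
qed

text \<open>The numerator decays at rate c and the evidence is eventually above the rate
  \<open>c / 2\<close>, both relative to the true likelihood, which cancels.\<close>

lemma posterior_bad:
  assumes B: "\<And>\<epsilon>. 0 < \<epsilon> \<Longrightarrow> 0 < measure P (B \<epsilon>)" and h: "\<And>\<epsilon> f. f \<in> B \<epsilon> \<Longrightarrow> h_disc f0 f \<le> ennreal \<epsilon>"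
    and K: "0 < K" "\<And>f v. f \<in> insert f0 (space P) \<Longrightarrow> v \<in> freqs \<Longrightarrow> pw W w v * f v \<le> K" and \<delta>: "0 < \<delta>"
  shows "AE \<omega> in \<Omega>. (\<lambda>n. measure (post n \<omega>) (bad W w \<delta>)) \<longlonglongrightarrow> 0"
proof -
  obtain c where c: "0 < c" and num: "AE \<omega> in \<Omega>. \<forall>\<^sub>F n in sequentially.
    (\<integral>\<^sup>+f. ennreal (lik n f (smp n \<omega>)) * indicator (bad W w \<delta>) f \<partial>P) \<le> ennreal (exp (- (c * real n)) * lik n f0 (smp n \<omega>))"
    using bad_numerator[where K = K and W = W and w = w and \<delta> = \<delta>] K \<delta> by blast
  have c2: "0 < c / 2" using c by simp
  have ev: "AE \<omega> in \<Omega>. \<forall>\<^sub>F n in sequentially.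
    ennreal (exp (- (c / 2 * real n)) * lik n f0 (smp n \<omega>)) \<le> (\<integral>\<^sup>+f. ennreal (lik n f (smp n \<omega>)) \<partial>P)"
    by (rule evidence_lower[where B = B, OF _ _ c2]) (fact B h)+
  from num ev evidence_finite AE_space
  show ?thesis
  proof eventually_elim
    case (elim \<omega>)
    have "(\<lambda>n. exp (- (c / 2 * real n))) \<longlonglongrightarrow> 0" using c by real_asymp
    moreover have "\<forall>\<^sub>F n in sequentially. norm (measure (post n \<omega>) (bad W w \<delta>)) \<le> exp (- (c / 2 * real n))"
      using elim(1,2)
    proof eventually_elim
      case (elim n)
      have fin: "(\<integral>\<^sup>+f. ennreal (lik n f (smp n \<omega>)) \<partial>P) < \<infinity>" using \<open>\<forall>n. _ n < \<infinity>\<close> by blast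
      note pd = posterior_density[OF \<open>\<omega> \<in> space \<Omega>\<close> fin]
      interpret po: prob_space "post n \<omega>" by (rule pd(2))
      define q where "q = measure (post n \<omega>) (bad W w \<delta>)"
      let ?l = "lik n f0 (smp n \<omega>)"
      have "ennreal q * ennreal (exp (- (c / 2 * real n)) * ?l) \<le> emeasure (post n \<omega>) (bad W w \<delta>) * (\<integral>\<^sup>+f. ennreal (lik n f (smp n \<omega>)) \<partial>P)"
        using elim(2) by (intro mult_mono) (auto simp: q_def po.emeasure_eq_measure)
      also have "\<dots> \<le> ennreal (exp (- (c * real n)) * ?l)"
        using elim(1) pd(3)[OF bad_sets] by simp
      finally have "q * (exp (- (c / 2 * real n)) * ?l) \<le> exp (- (c * real n)) * ?l"
        using lik0_pos[of n "smp n \<omega>"] by (subst (asm) ennreal_mult[symmetric]) (auto simp: q_def less_imp_le)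
      also have "\<dots> = exp (- (c / 2 * real n)) * (exp (- (c / 2 * real n)) * ?l)"
        by (simp add: mult.assoc[symmetric] exp_add[symmetric])
      finally show ?case using lik0_pos[of n "smp n \<omega>"] by (simp add: q_def)
    qed
    ultimately show ?case by (rule Lim_null_comparison[rotated])
  qed
qed

end

section \<open>Fourier coefficients of the differenced density\<close>

text \<open>Covariance at lag k of the differenced process: differencing multiplies the spectral
  density by \<open>2 - 2 * cos v\<close>.\<close>

definition dco :: "nat \<Rightarrow> (real \<Rightarrow> real) \<Rightarrow> real" where
  "dco k f = (\<integral>v. (2 - 2 * cos v) * f v * cos (real k * v) \<partial>fm)"

text \<open>Coefficients of the polynomial \<open>(1 - z) * (1 + \<sigma> * z^k)\<close>: a
  difference combined with \<sigma> times the difference at lag k. Written as a sum of indicators,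
  so that coinciding positions for small k add up correctly. As the concentration bound is about
  sums of squares, a covariance is recovered by polarization from the signs 1 and -1.\<close>

definition dfil :: "nat \<Rightarrow> real \<Rightarrow> nat \<Rightarrow> real" where
  "dfil k \<sigma> l = (if l = 0 then 1 else 0) - (if l = 1 then 1 else 0)
     + \<sigma> * ((if l = k then 1 else 0) - (if l = Suc k then 1 else 0))"

lemma pw_dfil:
  assumes "\<sigma>\<^sup>2 = 1"
  shows "pw (k + 2) (dfil k \<sigma>) v = (2 - 2 * cos v) * (2 + 2 * \<sigma> * cos (real k * v))"
proof -
  have "(\<Sum>l<k + 2. of_real (dfil k \<sigma> l) * cis (real l * v))
      = (\<Sum>l<k + 2. (if l = 0 then 1 else 0)) - (\<Sum>l<k + 2. (if l = 1 then cis v else 0))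
        + of_real \<sigma> * ((\<Sum>l<k + 2. (if l = k then cis (real k * v) else 0)) - (\<Sum>l<k + 2. (if l = Suc k then cis (real (Suc k) * v) else 0)))"
    unfolding sum_subtractf[symmetric] sum_distrib_left sum.distrib[symmetric]
    by (intro sum.cong refl) (auto simp: dfil_def algebra_simps)
  also have "\<dots> = (1 - cis v) * (1 + of_real \<sigma> * cis (real k * v))"
    by (simp add: algebra_simps cis_mult)
  finally have "pw (k + 2) (dfil k \<sigma>) v = (cmod (1 - cis v))\<^sup>2 * (cmod (1 + of_real \<sigma> * cis (real k * v)))\<^sup>2"
    unfolding pw_def by (simp add: norm_mult power_mult_distrib)
  also have "(cmod (1 - cis v))\<^sup>2 = 2 - 2 * cos v"
    unfolding cmod_power2 using sin_cos_squared_add[of v] by (simp add: power2_eq_square algebra_simps)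
  also have "(cmod (1 + of_real \<sigma> * cis (real k * v)))\<^sup>2 = 1 + 2 * \<sigma> * cos (real k * v) + \<sigma>\<^sup>2 * ((cos (real k * v))\<^sup>2 + (sin (real k * v))\<^sup>2)"
  proof -
    have "(1 + \<sigma> * c)\<^sup>2 + (\<sigma> * s)\<^sup>2 = 1 + 2 * \<sigma> * c + \<sigma>\<^sup>2 * (c\<^sup>2 + s\<^sup>2)" for c s :: real
      by (simp add: power2_eq_square algebra_simps)
    thus ?thesis unfolding cmod_power2 by simp
  qed
  finally show ?thesis using assms by simp
qed

lemma two_minus_cos: "0 \<le> 2 - 2 * cos v" "2 - 2 * cos v \<le> 4" "2 - 2 * cos v \<le> (v::real)\<^sup>2"
proof -
  show "0 \<le> 2 - 2 * cos v" "2 - 2 * cos v \<le> 4" using cos_le_one[of v] cos_ge_minus_one[of v] by linarith+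
  have "cos v = 1 - 2 * (sin (v / 2))\<^sup>2" using cos_double_sin[of "v / 2"] by simp
  moreover have "(sin (v / 2))\<^sup>2 \<le> (v / 2)\<^sup>2"
    by (rule abs_le_square_iff[THEN iffD1, OF abs_sin_x_le_abs_x])
  ultimately show "2 - 2 * cos v \<le> v\<^sup>2" by (simp add: power_divide)
qed

text \<open>The factor is at most \<open>v^2\<close>, which more than cancels the pole because
  \<open>2 * d < 1\<close>; the bound is free of d. Of the two factors 16 in 256, one comes from
  \<open>reg_upper\<close>, the other from \<open>abs_powr_le\<close>.\<close>

lemma reg_diff_le:
  assumes f: "reg m M d f" and v: "v \<in> freqs"
  shows "0 \<le> (2 - 2 * cos v) * f v" "(2 - 2 * cos v) * f v \<le> 256 * M"
proof -
  note p = reg_pos[OF f v] freqs_abs[OF v] reg_const[OF f]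
  show "0 \<le> (2 - 2 * cos v) * f v" using p two_minus_cos(1) by simp
  have "(2 - 2 * cos v) * f v \<le> v\<^sup>2 * (16 * M * \<bar>v\<bar> powr (- (max (2 * d) 0)))"
    using p reg_upper[OF f v] two_minus_cos by (intro mult_mono) auto
  also have "\<dots> = 16 * M * (\<bar>v\<bar> powr 2 * \<bar>v\<bar> powr (- (max (2 * d) 0)))"
    using p by (simp add: powr_numeral)
  also have "\<bar>v\<bar> powr 2 * \<bar>v\<bar> powr (- (max (2 * d) 0)) = \<bar>v\<bar> powr (2 - max (2 * d) 0)"
    using powr_add[of "\<bar>v\<bar>" 2 "- max (2 * d) 0"] by simp
  also have "\<dots> \<le> 16 * \<bar>v\<bar> powr 0" using f by (intro abs_powr_le v) (auto simp: reg_def max_def)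
  finally show "(2 - 2 * cos v) * f v \<le> 256 * M" using p by (simp add: mult_left_mono)
qed

text \<open>Free of the exponent because \<open>\<bar>2 * d\<bar> < 1\<close>. It provides a square
  integrable envelope for the logarithms of all members of the model.\<close>

lemma reg_ln_bound:
  assumes f: "reg m M d f" and v: "v \<in> freqs"
  shows "\<bar>ln (f v)\<bar> \<le> \<bar>ln m\<bar> + \<bar>ln M\<bar> + \<bar>ln \<bar>v\<bar>\<bar>"
proof -
  note p = reg_pos[OF f v] freqs_abs[OF v] reg_const[OF f]
  have d: "\<bar>2 * d * ln \<bar>v\<bar>\<bar> \<le> 1 * \<bar>ln \<bar>v\<bar>\<bar>"
    unfolding abs_mult using f by (intro mult_right_mono) (auto simp: reg_def)
  have "ln (f v) \<le> ln (M * \<bar>v\<bar> powr (- 2 * d))" using p reg_le[OF f v] by (subst ln_le_cancel_iff) auto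
  hence u: "ln (f v) \<le> ln M - 2 * d * ln \<bar>v\<bar>" using p by (simp add: ln_mult ln_powr)
  have "ln (m * \<bar>v\<bar> powr (- 2 * d)) \<le> ln (f v)" using p reg_ge[OF f v] by (subst ln_le_cancel_iff) auto
  hence l: "ln m - 2 * d * ln \<bar>v\<bar> \<le> ln (f v)" using p by (simp add: ln_mult ln_powr)
  show ?thesis using u l d by linarith
qed

lemma dco_tp: "tp (\<lambda>v. (2 - 2 * cos v) * f v) j k = dco (if k \<le> j then j - k else k - j) f"
proof (cases "k \<le> j")
  case False
  have "cos ((real j - real k) * v) = cos (real (k - j) * v)" for v
    using False cos_minus[of "(real j - real k) * v"] by (simp add: of_nat_diff left_diff_distrib)
  thus ?thesis using False by (simp add: tp_def dco_def)
qed (simp add: tp_def dco_def of_nat_diff)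

lemma integrable_diff:
  assumes f: "reg m M d f"
  shows "integrable fm (\<lambda>v. (2 - 2 * cos v) * f v)"
proof (rule integrable_fm_bounded)
  have "(\<lambda>v::real. 2 - 2 * cos v) \<in> borel_measurable fm"
    by (intro measurable_fm borel_measurable_continuous_onI continuous_intros)
  thus "(\<lambda>v. (2 - 2 * cos v) * f v) \<in> borel_measurable fm"
    using reg_measurable[OF f] by (rule borel_measurable_times)
  show "\<bar>(2 - 2 * cos v) * f v\<bar> \<le> 256 * M" if "v \<in> freqs" for v
    using reg_diff_le[OF f that] by simp
qed

lemma vfil_dfil:
  assumes f: "reg m M d f"
  shows "(\<integral>v. f v * pw (k + 2) (dfil k 1) v \<partial>fm) - (\<integral>v. f v * pw (k + 2) (dfil k (-1)) v \<partial>fm) = 4 * dco k f"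
proof -
  have i: "integrable fm (\<lambda>v. f v * pw (k + 2) (dfil k s) v)" for s
    by (rule integrable_fm_pw[OF reg_integrable[OF f]])
  have "(\<integral>v. f v * pw (k + 2) (dfil k 1) v \<partial>fm) - (\<integral>v. f v * pw (k + 2) (dfil k (-1)) v \<partial>fm)
    = (\<integral>v. f v * pw (k + 2) (dfil k 1) v - f v * pw (k + 2) (dfil k (-1)) v \<partial>fm)"
    using i by simp
  also have "\<dots> = (\<integral>v. 4 * ((2 - 2 * cos v) * f v * cos (real k * v)) \<partial>fm)"
  proof (intro Bochner_Integration.integral_cong refl)
    fix v
    have p: "pw (k + 2) (dfil k 1) v = (2 - 2 * cos v) * (2 + 2 * cos (real k * v))"
      "pw (k + 2) (dfil k (-1)) v = (2 - 2 * cos v) * (2 - 2 * cos (real k * v))"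
      using pw_dfil[of 1 k v] pw_dfil[of "-1" k v] by simp_all
    show "f v * pw (k + 2) (dfil k 1) v - f v * pw (k + 2) (dfil k (-1)) v = 4 * ((2 - 2 * cos v) * f v * cos (real k * v))"
      unfolding p by (simp add: algebra_simps)
  qed
  finally show ?thesis by (simp add: dco_def)
qed

text \<open>Fejer sums of the differenced densities recover their values, uniformly over an equicontinuous
  class.\<close>

lemma local_identification:
  assumes reg: "\<And>f. f \<in> C \<Longrightarrow> \<exists>d. reg m M d f" and reg0: "reg m0 M0 d0 f0" and l: "l \<in> freqs"
    and equi: "\<And>\<theta>. 0 < \<theta> \<Longrightarrow> \<exists>\<delta>>0. \<forall>f\<in>insert f0 C. \<forall>u\<in>freqs. \<bar>\<bar>u\<bar> - \<bar>l\<bar>\<bar> < \<delta> \<longrightarrow> \<bar>ln (f u) - ln (f l)\<bar> \<le> \<theta>"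
    and \<eta>: "0 < \<eta>"
  shows "\<exists>N. \<exists>\<delta>>0. \<forall>f\<in>C. (\<forall>k<N. \<bar>dco k f - dco k f0\<bar> < \<delta>) \<longrightarrow> \<bar>ln (f l) - ln (f0 l)\<bar> \<le> \<eta>"
proof -
  define b where "b = \<bar>ln m\<bar> + \<bar>ln M\<bar> + \<bar>ln m0\<bar> + \<bar>ln M0\<bar> + \<bar>ln \<bar>l\<bar>\<bar>"
  define A where "A = exp b"
  have A: "0 < A" by (simp add: A_def)
  have reg': "\<exists>m M d. reg m M d f" if "f \<in> insert f0 C" for f using that reg reg0 by blast
  have pos: "0 < f u" if "f \<in> insert f0 C" "u \<in> freqs" for f u using reg'[OF that(1)] reg_pos that(2) by blast
  have lnb: "\<bar>ln (f l)\<bar> \<le> b" if "f \<in> insert f0 C" for f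
  proof (cases "f = f0")
    case True
    thus ?thesis using reg_ln_bound[OF reg0 l] abs_ge_zero[of "ln m"] abs_ge_zero[of "ln M"] unfolding b_def True by linarith
  next
    case False
    hence "f \<in> C" using that by simp
    then obtain d where "reg m M d f" using reg by blast
    from reg_ln_bound[OF this l] abs_ge_zero[of "ln m0"] abs_ge_zero[of "ln M0"]
    show ?thesis unfolding b_def by linarith
  qed
  have fl: "1 / A \<le> f l" "f l \<le> A" if "f \<in> insert f0 C" for f
  proof -
    have "exp (- b) \<le> exp (ln (f l))" "exp (ln (f l)) \<le> exp b" using lnb[OF that] by auto
    thus "1 / A \<le> f l" "f l \<le> A" using pos[OF that l] by (auto simp: A_def exp_minus inverse_eq_divide)
  qed
  define q where "q = (\<lambda>v::real. 2 - 2 * cos v)"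
  have ql: "0 < q l"
  proof -
    have "cos \<bar>l\<bar> < cos 0" using freqs_abs[OF l] by (intro cos_monotone_0_pi) auto
    thus ?thesis by (simp add: q_def)
  qed
  define K where "K = 256 * max M M0"
  have w_le: "\<bar>q v * f v\<bar> \<le> K" if "f \<in> insert f0 C" "v \<in> freqs" for f v
  proof (cases "f = f0")
    case True
    have "256 * M0 \<le> K" by (simp add: K_def)
    thus ?thesis using reg_diff_le[OF reg0 that(2)] True by (simp add: q_def)
  next
    case False
    hence "f \<in> C" using that by simp
    then obtain d where d: "reg m M d f" using reg by blast
    have "256 * M \<le> K" by (simp add: K_def)
    thus ?thesis using reg_diff_le[OF d that(2)] by (simp add: q_def)
  qed
  \<comment> \<open>The accuracy needed for the differenced density at l: division by
    \<open>q l\<close> leaves \<open>\<eta> / A\<close> for \<open>f l - f0 l\<close>, and values of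
    at least \<open>1 / A\<close> turn this into \<eta> for the logarithms. The budget is 3/8 for
    each of the two Fejer approximations, namely 1/4 for local oscillation and 1/8 for the tail, and
    1/8 for the coefficients.\<close>
  define \<kappa> where "\<kappa> = q l * (\<eta> / A)"
  have \<kappa>: "0 < \<kappa>" using ql \<eta> A by (simp add: \<kappa>_def)
  define \<theta> where "\<theta> = min 1 (\<kappa> / (64 * A))"
  have \<theta>: "0 < \<theta>" "\<theta> \<le> 1" "64 * A * \<theta> \<le> \<kappa>" using \<kappa> A by (auto simp: \<theta>_def min_def field_simps)
  obtain \<delta>0 where \<delta>0: "0 < \<delta>0" "\<And>f u. f \<in> insert f0 C \<Longrightarrow> u \<in> freqs \<Longrightarrow> \<bar>\<bar>u\<bar> - \<bar>l\<bar>\<bar> < \<delta>0 \<Longrightarrow> \<bar>ln (f u) - ln (f l)\<bar> \<le> \<theta>"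
    using equi[OF \<theta>(1)] by blast
  define \<delta>1 where "\<delta>1 = min (min \<delta>0 pi) (\<kappa> / (16 * A))"
  have "\<delta>1 \<le> \<kappa> / (16 * A)" by (simp add: \<delta>1_def)
  hence "16 * A * \<delta>1 \<le> \<kappa>" using A by (simp add: pos_le_divide_eq mult_ac)
  moreover have "0 < \<delta>1" "\<delta>1 \<le> pi" "\<delta>1 \<le> \<delta>0" using \<delta>0 \<kappa> A by (auto simp: \<delta>1_def)
  ultimately have \<delta>1: "0 < \<delta>1" "\<delta>1 \<le> pi" "\<delta>1 \<le> \<delta>0" "16 * A * \<delta>1 \<le> \<kappa>" by blast+
  have near: "\<bar>q u * f u - q l * f l\<bar> \<le> \<kappa> / 4" if f: "f \<in> insert f0 C" and u: "u \<in> freqs" "\<bar>\<bar>u\<bar> - \<bar>l\<bar>\<bar> < \<delta>1" for f u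
  proof -
    have ln: "\<bar>ln (f u) - ln (f l)\<bar> \<le> \<theta>" using \<delta>0(2)[OF f u(1)] u(2) \<delta>1 by simp
    define t where "t = ln (f u) - ln (f l)"
    have fu: "f u = f l * exp t" using pos[OF f u(1)] pos[OF f l] by (simp add: t_def exp_diff)
    have t: "\<bar>t\<bar> \<le> \<theta>" using ln by (simp add: t_def)
    have "exp t \<le> 1 + 2 * \<theta>"
    proof -
      have "exp t \<le> exp \<theta>" using t by simp
      also have "\<dots> \<le> 1 + \<theta> + \<theta>\<^sup>2" using \<theta> by (intro exp_bound) auto
      also have "\<theta>\<^sup>2 \<le> \<theta>" using \<theta> by (simp add: power2_eq_square mult_left_le)
      finally show ?thesis by simp
    qed
    moreover have "1 - \<theta> \<le> exp t" using exp_ge_add_one_self[of t] t by linarith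
    ultimately have et: "\<bar>exp t - 1\<bar> \<le> 2 * \<theta>" using \<theta> by linarith
    have "f u - f l = f l * (exp t - 1)" by (simp add: fu algebra_simps)
    hence "\<bar>f u - f l\<bar> = f l * \<bar>exp t - 1\<bar>" using pos[OF f l] by (simp add: abs_mult)
    also have "\<dots> \<le> A * (2 * \<theta>)" using et fl[OF f] A by (intro mult_mono) auto
    finally have d1: "\<bar>f u - f l\<bar> \<le> 2 * A * \<theta>" by simp
    have "\<bar>cos u - cos l\<bar> = \<bar>cos \<bar>u\<bar> - cos \<bar>l\<bar>\<bar>" by simp
    also have "\<dots> \<le> \<bar>\<bar>u\<bar> - \<bar>l\<bar>\<bar>"
    proof -
      have "cos \<bar>u\<bar> - cos \<bar>l\<bar> = 2 * sin ((\<bar>u\<bar> + \<bar>l\<bar>) / 2) * sin ((\<bar>l\<bar> - \<bar>u\<bar>) / 2)" by (rule cos_diff_cos)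
      hence "\<bar>cos \<bar>u\<bar> - cos \<bar>l\<bar>\<bar> = 2 * \<bar>sin ((\<bar>u\<bar> + \<bar>l\<bar>) / 2)\<bar> * \<bar>sin ((\<bar>l\<bar> - \<bar>u\<bar>) / 2)\<bar>" by (simp add: abs_mult)
      also have "\<dots> \<le> 2 * 1 * \<bar>(\<bar>l\<bar> - \<bar>u\<bar>) / 2\<bar>"
        by (intro mult_mono abs_sin_x_le_abs_x) auto
      finally show ?thesis by simp
    qed
    finally have d2: "\<bar>q u - q l\<bar> \<le> 2 * \<delta>1" using u(2) by (simp add: q_def)
    have "q u * f u - q l * f l = q u * (f u - f l) + (q u - q l) * f l" by (simp add: algebra_simps)
    hence "\<bar>q u * f u - q l * f l\<bar> \<le> \<bar>q u\<bar> * \<bar>f u - f l\<bar> + \<bar>q u - q l\<bar> * \<bar>f l\<bar>"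
      by (metis abs_mult abs_triangle_ineq)
    also have "\<dots> \<le> 4 * (2 * A * \<theta>) + 2 * \<delta>1 * A"
      using d1 d2 two_minus_cos[of u] fl[OF f] A pos[OF f l] \<delta>1 by (intro add_mono mult_mono) (auto simp: q_def)
    also have "\<dots> \<le> \<kappa> / 4" using \<theta>(3) \<delta>1(4) by (simp add: algebra_simps)
    finally show ?thesis .
  qed
  have c: "0 < 1 - cos \<delta>1" using cos_monotone_0_pi[of 0 \<delta>1] \<delta>1 by simp
  obtain N where N: "32 * K / (\<kappa> * (1 - cos \<delta>1)) < real N" using reals_Archimedean2 by blast
  have K: "0 \<le> K" using w_le[of f0 l] l by fastforce
  have N0: "0 < N"
  proof (rule ccontr)
    assume "\<not> 0 < N"
    hence "32 * K / (\<kappa> * (1 - cos \<delta>1)) < 0" using N by simp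
    thus False using K \<kappa> c by (simp add: divide_less_0_iff mult_less_0_iff)
  qed
  have tail: "4 * K / (real N * (1 - cos \<delta>1)) \<le> \<kappa> / 8"
  proof -
    have "32 * K < real N * (\<kappa> * (1 - cos \<delta>1))" using N \<kappa> c by (simp add: pos_divide_less_eq)
    thus ?thesis using N0 c by (simp add: field_simps)
  qed
  have meas: "(\<lambda>v. q v * f v) \<in> borel_measurable fm" if "f \<in> insert f0 C" for f
    using reg'[OF that] integrable_diff unfolding q_def by blast
  have ap: "\<bar>fej N (\<lambda>v. q v * f v) l - q l * f l\<bar> \<le> 3 / 8 * \<kappa>" if "f \<in> insert f0 C" for f
  proof -
    have "\<bar>fej N (\<lambda>v. q v * f v) l - q l * f l\<bar> \<le> \<kappa> / 4 + 4 * K / (real N * (1 - cos \<delta>1))"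
      using \<kappa> by (intro fej_approx[OF N0 meas[OF that] w_le[OF that] l \<delta>1(1,2)] near[OF that]) auto
    thus ?thesis using tail by linarith
  qed
  \<comment> \<open>The difference of the Fejer means is a sum of \<open>N^2\<close> coefficient
    differences divided by \<open>2 * pi * N\<close>, so a tolerance proportional to
    \<open>1 / N\<close> suffices.\<close>
  define \<delta> where "\<delta> = \<kappa> / (8 * real N)"
  have \<delta>: "0 < \<delta>" using \<kappa> N0 by (simp add: \<delta>_def)
  have "\<bar>ln (f l) - ln (f0 l)\<bar> \<le> \<eta>" if f: "f \<in> C" and cl: "\<forall>k<N. \<bar>dco k f - dco k f0\<bar> < \<delta>" for f
  proof -
    have "fej N (\<lambda>v. q v * f v) l - fej N (\<lambda>v. q v * f0 v) l
      = (\<Sum>j<N. \<Sum>k<N. cos ((real j - real k) * l) * (tp (\<lambda>v. q v * f v) j k - tp (\<lambda>v. q v * f0 v) j k)) / (2 * pi * real N)"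
      by (simp add: fej_def diff_divide_distrib right_diff_distrib sum_subtractf)
    also have "\<bar>\<dots>\<bar> \<le> (\<Sum>j<N. \<Sum>k<N. 1 * \<delta>) / (2 * pi * real N)"
    proof -
      have "\<bar>\<Sum>j<N. \<Sum>k<N. cos ((real j - real k) * l) * (tp (\<lambda>v. q v * f v) j k - tp (\<lambda>v. q v * f0 v) j k)\<bar> \<le> (\<Sum>j<N. \<Sum>k<N. 1 * \<delta>)"
      proof (intro order_trans[OF sum_abs] sum_mono)
        fix j k assume jk: "j \<in> {..<N}" "k \<in> {..<N}"
        have "\<bar>tp (\<lambda>v. q v * f v) j k - tp (\<lambda>v. q v * f0 v) j k\<bar> \<le> \<delta>"
          unfolding q_def dco_tp using cl jk by (auto intro!: less_imp_le)
        thus "\<bar>cos ((real j - real k) * l) * (tp (\<lambda>v. q v * f v) j k - tp (\<lambda>v. q v * f0 v) j k)\<bar> \<le> 1 * \<delta>"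
          unfolding abs_mult by (intro mult_mono) auto
      qed
      moreover have "\<bar>2 * pi * real N\<bar> = 2 * pi * real N" by simp
      ultimately show ?thesis
        unfolding abs_divide by (simp only:) (rule divide_right_mono, simp_all)
    qed
    also have "\<dots> \<le> \<kappa> / 8"
      using N0 \<kappa> pi_gt3 by (simp add: \<delta>_def field_simps)
    finally have "\<bar>fej N (\<lambda>v. q v * f v) l - fej N (\<lambda>v. q v * f0 v) l\<bar> \<le> \<kappa> / 8" .
    moreover have "\<bar>fej N (\<lambda>v. q v * f v) l - q l * f l\<bar> \<le> 3 / 8 * \<kappa>"
      "\<bar>fej N (\<lambda>v. q v * f0 v) l - q l * f0 l\<bar> \<le> 3 / 8 * \<kappa>"
      by (rule ap, use f in simp)+
    ultimately have "\<bar>q l * f l - q l * f0 l\<bar> \<le> \<kappa>" using \<kappa> by linarith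
    hence "q l * \<bar>f l - f0 l\<bar> \<le> q l * (\<eta> / A)" using ql by (simp add: \<kappa>_def right_diff_distrib[symmetric] abs_mult)
    hence d: "\<bar>f l - f0 l\<bar> \<le> \<eta> / A" by (rule mult_left_le_imp_le[OF _ ql])
    have lnd: "ln x - ln y \<le> \<eta>" if "1 / A \<le> y" "0 < x" "\<bar>x - y\<bar> \<le> \<eta> / A" for x y
    proof -
      have y: "0 < y" using that A by (smt (verit) divide_pos_pos)
      have "ln x - ln y = ln (x / y)" using that y by (simp add: ln_div)
      also have "\<dots> \<le> x / y - 1" using that y by (intro ln_le_minus_one) auto
      also have "\<dots> = (x - y) / y" using y by (simp add: field_simps)
      also have "\<dots> \<le> (\<eta> / A) / y" using that y by (intro divide_right_mono) auto
      also have "\<dots> \<le> (\<eta> / A) / (1 / A)" using that \<eta> A y by (intro divide_left_mono) auto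
      finally show ?thesis using A by simp
    qed
    show ?thesis
      using lnd[of "f0 l" "f l"] lnd[of "f l" "f0 l"] d fl[of f] fl[of f0] f pos[of f l] pos[of f0 l] l by (auto simp: abs_le_iff)
  qed
  thus ?thesis using \<delta> by blast
qed

section \<open>From posterior concentration to the loss\<close>

lemma integrable_ln_square:
  "integrable fm (\<lambda>v. (b + 2 * \<bar>ln \<bar>v\<bar>\<bar>)\<^sup>2)"
proof (rule Bochner_Integration.integrable_bound)
  let ?g = "\<lambda>v::real. 2 * b\<^sup>2 + 128 * (\<bar>v\<bar> powr (- (1/2)) + \<bar>v\<bar> powr (1/2))"
  show "integrable fm ?g"
    using integrable_powr[of "1/2"] integrable_powr[of "-1/2"] by auto
  show "(\<lambda>v. (b + 2 * \<bar>ln \<bar>v\<bar>\<bar>)\<^sup>2) \<in> borel_measurable fm"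
    by (intro measurable_fm) measurable
  show "AE v in fm. norm ((b + 2 * \<bar>ln \<bar>v\<bar>\<bar>)\<^sup>2) \<le> norm (?g v)"
  proof (intro AE_I2)
    fix v assume "v \<in> space fm"
    hence v: "0 < \<bar>v\<bar>" using freqs_abs[of v] by simp
    \<comment> \<open>Obtained from \<open>ln x \<le> 4 * x powr (1/4)\<close> and applied to
      \<bar>v\<bar> or its reciprocal, whichever is at least 1.\<close>
    have sq: "(ln x)\<^sup>2 \<le> 16 * x powr (1/2)" if "1 \<le> x" for x :: real
    proof -
      have "(ln x)\<^sup>2 \<le> (4 * x powr (1/4))\<^sup>2"
        using ln_powr_bound[of x "1/4"] that by (intro power_mono) auto
      also have "\<dots> = 16 * (x powr (1/4) * x powr (1/4))" by (simp add: power2_eq_square)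
      also have "x powr (1/4) * x powr (1/4) = x powr (1/2)" by (simp add: powr_add[symmetric])
      finally show ?thesis .
    qed
    have "(ln \<bar>v\<bar>)\<^sup>2 \<le> 16 * (\<bar>v\<bar> powr (- (1/2)) + \<bar>v\<bar> powr (1/2))"
    proof (cases "1 \<le> \<bar>v\<bar>")
      case True
      show ?thesis using sq[OF True] powr_ge_zero[of "\<bar>v\<bar>" "- (1/2)"] unfolding distrib_left by linarith
    next
      case False
      have "(ln (1 / \<bar>v\<bar>))\<^sup>2 \<le> 16 * (1 / \<bar>v\<bar>) powr (1/2)" using v False by (intro sq) auto
      hence "(ln \<bar>v\<bar>)\<^sup>2 \<le> 16 * \<bar>v\<bar> powr (- (1/2))"
        using v powr_minus_divide[of "\<bar>v\<bar>" "1/2"] by (simp add: ln_div powr_divide)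
      thus ?thesis using powr_ge_zero[of "\<bar>v\<bar>" "1/2"] unfolding distrib_left by linarith
    qed
    moreover have "(b + 2 * \<bar>ln \<bar>v\<bar>\<bar>)\<^sup>2 \<le> 2 * b\<^sup>2 + 8 * (ln \<bar>v\<bar>)\<^sup>2"
    proof -
      have "0 \<le> (b - 2 * \<bar>ln \<bar>v\<bar>\<bar>)\<^sup>2" by simp
      thus ?thesis by (simp add: power2_eq_square algebra_simps abs_mult_self_eq)
    qed
    ultimately show "norm ((b + 2 * \<bar>ln \<bar>v\<bar>\<bar>)\<^sup>2) \<le> norm (?g v)" by simp
  qed
qed

context gaussian_bayes
begin

text \<open>By Jensen's inequality the squared error of the averaged logarithm at v is at most the
  mean square \<open>e n v\<close>. At a fixed frequency \<open>local_identification\<close> handles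
  the densities with finitely many close coefficients, and the envelope b the others, whose mass
  vanishes; dominated convergence then integrates over frequencies. The thresholds
  \<open>1 / Suc j\<close> keep the hypothesis countable, as an almost sure statement
  requires.\<close>

lemma log_loss_limit:
  fixes \<nu> :: "nat \<Rightarrow> (real \<Rightarrow> real) measure"
  assumes \<nu>: "\<And>n. prob_space (\<nu> n)" "\<And>n. sets (\<nu> n) = sets P"
    and lim: "\<And>k j. (\<lambda>n. measure (\<nu> n) {f \<in> space P. 1 / real (Suc j) \<le> \<bar>dco k f - dco k f0\<bar>}) \<longlonglongrightarrow> 0"
    and equi: "\<And>l \<theta>. l \<in> freqs \<Longrightarrow> 0 < \<theta> \<Longrightarrow>
      \<exists>\<delta>>0. \<forall>f\<in>insert f0 (space P). \<forall>u\<in>freqs. \<bar>\<bar>u\<bar> - \<bar>l\<bar>\<bar> < \<delta> \<longrightarrow> \<bar>ln (f u) - ln (f l)\<bar> \<le> \<theta>"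
  shows "(\<lambda>n. log_loss f0 (\<lambda>v. exp (\<integral>f. ln (f v) \<partial>\<nu> n))) \<longlonglongrightarrow> 0"
proof -
  have sp: "space (\<nu> n) = space P" for n by (rule sets_eq_imp_space_eq[OF \<nu>(2)])
  define D where "D = (\<lambda>(f :: real \<Rightarrow> real) v. ln (f v) - ln (f0 v))"
  define b where "b = (\<lambda>v. (\<bar>ln m\<bar> + \<bar>ln M\<bar> + \<bar>ln m0\<bar> + \<bar>ln M0\<bar>) + 2 * \<bar>ln \<bar>v\<bar>\<bar>)"
  have b0: "0 \<le> b v" for v by (simp add: b_def)
  have Db: "\<bar>D f v\<bar> \<le> b v" if "f \<in> space P" "v \<in> freqs" for f v
  proof -
    from P_reg[OF that(1)] obtain d where "reg m M d f" by blast
    from reg_ln_bound[OF this that(2)] reg_ln_bound[OF reg0 that(2)] show ?thesis unfolding D_def b_def by linarith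
  qed
  have ev: "(\<lambda>z. (fst z) (snd z)) \<in> borel_measurable (P \<Otimes>\<^sub>M fm)"
    using ev_measurable by (simp add: split_beta')
  have f0m: "f0 \<in> borel_measurable fm" by (rule reg_measurable[OF reg0])
  have Dm: "(\<lambda>z. D (fst z) (snd z)) \<in> borel_measurable (P \<Otimes>\<^sub>M fm)"
    unfolding D_def using ev measurable_compose[OF measurable_snd f0m] by measurable
  have Dm1: "(\<lambda>f. D f v) \<in> borel_measurable (\<nu> n)" if "v \<in> freqs" for v n
    unfolding D_def measurable_cong_sets[OF \<nu>(2) refl] using P_ev[OF that] by measurable
  define e where "e = (\<lambda>n v. \<integral>\<^sup>+f. ennreal ((D f v)\<^sup>2) \<partial>\<nu> n)"
  have em: "e n \<in> borel_measurable fm" for n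
  proof -
    interpret prob_space "\<nu> n" by (rule \<nu>(1))
    have "(\<lambda>z. ennreal ((D (fst z) (snd z))\<^sup>2)) \<in> borel_measurable (P \<Otimes>\<^sub>M fm)" using Dm by measurable
    from measurable_compose[OF measurable_pair_swap'[of fm P] this]
    have "(\<lambda>z. ennreal ((D (snd z) (fst z))\<^sup>2)) \<in> borel_measurable (fm \<Otimes>\<^sub>M P)" by (simp add: split_beta')
    hence "(\<lambda>(v, f). ennreal ((D f v)\<^sup>2)) \<in> borel_measurable (fm \<Otimes>\<^sub>M \<nu> n)"
      by (subst measurable_cong_sets[OF sets_pair_measure_cong[OF refl \<nu>(2)] refl]) (simp add: split_beta')
    thus ?thesis unfolding e_def by (rule borel_measurable_nn_integral)
  qed
  have eb: "e n v \<le> ennreal ((b v)\<^sup>2)" if "v \<in> freqs" for n v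
  proof -
    interpret prob_space "\<nu> n" by (rule \<nu>(1))
    have "e n v \<le> (\<integral>\<^sup>+f. ennreal ((b v)\<^sup>2) \<partial>\<nu> n)"
      unfolding e_def
    proof (intro nn_integral_mono ennreal_leI)
      fix f assume "f \<in> space (\<nu> n)"
      hence "\<bar>D f v\<bar>\<^sup>2 \<le> (b v)\<^sup>2" using Db[OF _ that] by (intro power_mono) (auto simp: sp)
      thus "(D f v)\<^sup>2 \<le> (b v)\<^sup>2" by simp
    qed
    thus ?thesis by (simp add: emeasure_space_1)
  qed
  have pt: "(\<lambda>n. e n l) \<longlonglongrightarrow> 0" if l: "l \<in> freqs" for l
  proof (rule order_tendstoI)
    fix a :: ennreal assume "0 < a"
    then obtain c where c: "0 < c" "c < a" using dense by blast
    then obtain r where "c = ennreal r" "0 \<le> r" by (cases c) auto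
    with c have r: "0 < r" "ennreal r < a" by auto
    define \<eta> where "\<eta> = sqrt (r / 2)"
    have \<eta>: "0 < \<eta>" "\<eta>\<^sup>2 = r / 2" using r by (auto simp: \<eta>_def)
    obtain N \<delta> where \<delta>: "0 < \<delta>" and id: "\<And>f. f \<in> space P \<Longrightarrow> (\<forall>k<N. \<bar>dco k f - dco k f0\<bar> < \<delta>) \<Longrightarrow> \<bar>D f l\<bar> \<le> \<eta>"
      using local_identification[OF P_reg reg0 l equi[OF l] \<eta>(1)] unfolding D_def by blast
    obtain j where j: "1 / real (Suc j) < \<delta>" using \<delta> nat_approx_posE by blast
    define S where "S = (\<lambda>k. {f \<in> space P. 1 / real (Suc j) \<le> \<bar>dco k f - dco k f0\<bar>})"
    have Sm: "S k \<in> sets P" for k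
    proof -
      have "(\<lambda>v. (2 - 2 * cos v) * cos (real k * v)) \<in> borel_measurable fm"
        by (intro measurable_fm borel_measurable_continuous_onI continuous_intros)
      from measurable_P_integral[OF this] have [measurable]: "dco k \<in> borel_measurable P"
        unfolding dco_def by (simp add: mult_ac)
      show ?thesis unfolding S_def by measurable
    qed
    have e_le: "e n l \<le> ennreal (\<eta>\<^sup>2 + (b l)\<^sup>2 * (\<Sum>k<N. measure (\<nu> n) (S k)))" for n
    proof -
      interpret prob_space "\<nu> n" by (rule \<nu>(1))
      have "e n l \<le> (\<integral>\<^sup>+f. ennreal (\<eta>\<^sup>2) + ennreal ((b l)\<^sup>2) * (\<Sum>k<N. indicator (S k) f) \<partial>\<nu> n)"
        unfolding e_def
      proof (intro nn_integral_mono)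
        fix f assume "f \<in> space (\<nu> n)"
        hence f: "f \<in> space P" by (simp add: sp)
        show "ennreal ((D f l)\<^sup>2) \<le> ennreal (\<eta>\<^sup>2) + ennreal ((b l)\<^sup>2) * (\<Sum>k<N. indicator (S k) f)"
        proof (cases "\<exists>k<N. f \<in> S k")
          case True
          then obtain k where k: "k < N" "f \<in> S k" by blast
          have "(1::ennreal) = indicator (S k) f" using k by simp
          also have "\<dots> \<le> (\<Sum>k<N. indicator (S k) f)" using k by (intro member_le_sum) auto
          finally have "ennreal ((b l)\<^sup>2) * 1 \<le> ennreal ((b l)\<^sup>2) * (\<Sum>k<N. indicator (S k) f)"
            by (intro mult_left_mono) auto
          moreover have "ennreal ((D f l)\<^sup>2) \<le> ennreal ((b l)\<^sup>2)"
          proof (rule ennreal_leI)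
            have "\<bar>D f l\<bar>\<^sup>2 \<le> (b l)\<^sup>2" using Db[OF f l] by (intro power_mono) auto
            thus "(D f l)\<^sup>2 \<le> (b l)\<^sup>2" by simp
          qed
          ultimately have "ennreal ((D f l)\<^sup>2) \<le> ennreal ((b l)\<^sup>2) * (\<Sum>k<N. indicator (S k) f)"
            unfolding mult_1_right by (rule order_trans[rotated])
          thus ?thesis by (intro add_increasing) auto
        next
          case False
          hence "\<bar>D f l\<bar> \<le> \<eta>" using j f by (intro id[OF f]) (force simp: S_def not_le)
          hence "\<bar>D f l\<bar>\<^sup>2 \<le> \<eta>\<^sup>2" by (intro power_mono) auto
          thus ?thesis by (intro add_increasing2) (auto intro: ennreal_leI)
        qed
      qed
      also have "\<dots> = ennreal (\<eta>\<^sup>2) + ennreal ((b l)\<^sup>2) * (\<Sum>k<N. emeasure (\<nu> n) (S k))"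
      proof -
        have Sn [measurable]: "S k \<in> sets (\<nu> n)" for k using Sm by (simp add: \<nu>(2))
        have [measurable]: "(\<lambda>f. \<Sum>k<N. indicator (S k) f :: ennreal) \<in> borel_measurable (\<nu> n)" by measurable
        have "(\<integral>\<^sup>+f. (\<Sum>k<N. indicator (S k) f) \<partial>\<nu> n) = (\<Sum>k<N. emeasure (\<nu> n) (S k))"
          by (subst nn_integral_sum) auto
        thus ?thesis by (subst nn_integral_add) (auto simp: nn_integral_cmult emeasure_space_1)
      qed
      also have "\<dots> = ennreal (\<eta>\<^sup>2 + (b l)\<^sup>2 * (\<Sum>k<N. measure (\<nu> n) (S k)))"
      proof -
        have "(\<Sum>k<N. ennreal (prob (S k))) = ennreal (\<Sum>k<N. prob (S k))" by (rule sum_ennreal) auto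
        thus ?thesis by (simp add: emeasure_eq_measure sum_nonneg ennreal_mult ennreal_plus)
      qed
      finally show ?thesis .
    qed
    have "(\<lambda>n. \<eta>\<^sup>2 + (b l)\<^sup>2 * (\<Sum>k<N. measure (\<nu> n) (S k))) \<longlonglongrightarrow> \<eta>\<^sup>2 + (b l)\<^sup>2 * (\<Sum>k<N. 0)"
      unfolding S_def by (intro tendsto_intros lim)
    moreover have "\<eta>\<^sup>2 + (b l)\<^sup>2 * (\<Sum>k<N. 0) < r" using \<eta> r by simp
    ultimately have "\<forall>\<^sub>F n in sequentially. \<eta>\<^sup>2 + (b l)\<^sup>2 * (\<Sum>k<N. measure (\<nu> n) (S k)) < r"
      by (rule order_tendstoD(2))
    thus "\<forall>\<^sub>F n in sequentially. e n l < a"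
    proof eventually_elim
      case (elim n)
      have "e n l \<le> ennreal r" using e_le[of n] elim by (meson ennreal_leI less_imp_le order_trans)
      thus ?case using r(2) by (rule le_less_trans)
    qed
  qed simp
  have loss: "log_loss f0 (\<lambda>v. exp (\<integral>f. ln (f v) \<partial>\<nu> n)) \<le> (\<integral>\<^sup>+v. e n v \<partial>fm)" for n
    unfolding log_loss_def nn_integral_fm
  proof (intro nn_integral_mono)
    fix v assume "v \<in> space fm"
    hence v: "v \<in> freqs" by simp
    interpret prob_space "\<nu> n" by (rule \<nu>(1))
    have iD: "integrable (\<nu> n) (\<lambda>f. D f v)"
      using Db[OF _ v] Dm1[OF v] by (intro integrable_const_bound[of _ "b v"]) (auto simp: sp)
    have iD2: "integrable (\<nu> n) (\<lambda>f. (D f v)\<^sup>2)"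
    proof (rule integrable_const_bound[of _ "(b v)\<^sup>2"])
      show "AE f in \<nu> n. norm ((D f v)\<^sup>2) \<le> (b v)\<^sup>2"
      proof (intro AE_I2)
        fix f assume "f \<in> space (\<nu> n)"
        hence "\<bar>D f v\<bar>\<^sup>2 \<le> (b v)\<^sup>2" using Db[OF _ v] by (intro power_mono) (auto simp: sp)
        thus "norm ((D f v)\<^sup>2) \<le> (b v)\<^sup>2" by simp
      qed
      show "(\<lambda>f. (D f v)\<^sup>2) \<in> borel_measurable (\<nu> n)" using Dm1[OF v] by measurable
    qed
    have "(\<integral>f. ln (f v) \<partial>\<nu> n) = (\<integral>f. D f v + ln (f0 v) \<partial>\<nu> n)" by (simp add: D_def)
    also have "\<dots> = (\<integral>f. D f v \<partial>\<nu> n) + ln (f0 v)"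
      using iD by (simp add: prob_space)
    finally have eq: "(ln (f0 v) - ln (exp (\<integral>f. ln (f v) \<partial>\<nu> n)))\<^sup>2 = (\<integral>f. D f v \<partial>\<nu> n)\<^sup>2" by simp
    \<comment> \<open>Jensen's inequality for the square, in the form that a variance is
      nonnegative.\<close>
    have "0 \<le> variance (\<lambda>f. D f v)" by (rule variance_positive)
    hence "(\<integral>f. D f v \<partial>\<nu> n)\<^sup>2 \<le> (\<integral>f. (D f v)\<^sup>2 \<partial>\<nu> n)"
      using variance_eq[OF iD iD2] by simp
    hence "ennreal ((\<integral>f. D f v \<partial>\<nu> n)\<^sup>2) \<le> ennreal (\<integral>f. (D f v)\<^sup>2 \<partial>\<nu> n)" by (rule ennreal_leI)
    also have "\<dots> = e n v"
      unfolding e_def using iD2 by (intro nn_integral_eq_integral[symmetric]) auto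
    finally show "ennreal ((ln (f0 v) - ln (exp (\<integral>f. ln (f v) \<partial>\<nu> n)))\<^sup>2) \<le> e n v"
      unfolding eq .
  qed
  have "(\<lambda>n. \<integral>\<^sup>+v. e n v \<partial>fm) \<longlonglongrightarrow> (\<integral>\<^sup>+v. 0 \<partial>fm)"
  proof (rule nn_integral_dominated_convergence[where w = "\<lambda>v. ennreal ((b v)\<^sup>2)"])
    have i: "integrable fm (\<lambda>v. (b v)\<^sup>2)" unfolding b_def by (rule integrable_ln_square)
    show "(\<lambda>v. ennreal ((b v)\<^sup>2)) \<in> borel_measurable fm" using i by auto
    show "(\<integral>\<^sup>+v. ennreal ((b v)\<^sup>2) \<partial>fm) < \<infinity>" using i by (subst nn_integral_eq_integral) auto
    show "AE v in fm. e n v \<le> ennreal ((b v)\<^sup>2)" for n using eb by (intro AE_I2) auto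
    show "AE v in fm. (\<lambda>n. e n v) \<longlonglongrightarrow> 0" using pt by (intro AE_I2) auto
  qed (use em in auto)
  hence "(\<lambda>n. \<integral>\<^sup>+v. e n v \<partial>fm) \<longlonglongrightarrow> 0" by simp
  thus ?thesis
    by (rule tendsto_sandwich[OF _ _ tendsto_const, rotated -1]) (auto simp: loss)
qed

text \<open>Countably many filters and thresholds suffice, so the exceptional null sets can be
  united before a path is fixed.\<close>

theorem posterior_log_loss:
  assumes B: "\<And>\<epsilon>. 0 < \<epsilon> \<Longrightarrow> 0 < measure P (B \<epsilon>)" and h: "\<And>\<epsilon> f. f \<in> B \<epsilon> \<Longrightarrow> h_disc f0 f \<le> ennreal \<epsilon>"
    and equi: "\<And>l \<theta>. l \<in> freqs \<Longrightarrow> 0 < \<theta> \<Longrightarrow>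
      \<exists>\<delta>>0. \<forall>f\<in>insert f0 (space P). \<forall>u\<in>freqs. \<bar>\<bar>u\<bar> - \<bar>l\<bar>\<bar> < \<delta> \<longrightarrow> \<bar>ln (f u) - ln (f l)\<bar> \<le> \<theta>"
  shows "AE \<omega> in \<Omega>. (\<lambda>n. log_loss f0 (post_est P n (\<lambda>i. X i \<omega>))) \<longlonglongrightarrow> 0"
proof -
  \<comment> \<open>Four times the bound of \<open>reg_diff_le\<close>, the second factor in
    \<open>pw_dfil\<close> being at most 4.\<close>
  define K where "K = 1024 * max M M0"
  have K0: "0 < K" using reg_const[OF reg0] by (simp add: K_def less_max_iff_disj)
  have K: "pw (k + 2) (dfil k \<sigma>) v * f v \<le> K" if "\<sigma>\<^sup>2 = 1" "f \<in> insert f0 (space P)" "v \<in> freqs" for k \<sigma> f v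
  proof -
    have w: "0 \<le> (2 - 2 * cos v) * f v" "(2 - 2 * cos v) * f v \<le> 256 * max M M0"
    proof -
      have "\<exists>m' M' d'. reg m' M' d' f \<and> M' \<le> max M M0"
        using that(2) reg0 P_reg by (metis insert_iff max.cobounded1 max.cobounded2)
      then obtain m' M' d' where r: "reg m' M' d' f" "M' \<le> max M M0" by blast
      show "0 \<le> (2 - 2 * cos v) * f v" "(2 - 2 * cos v) * f v \<le> 256 * max M M0"
        using reg_diff_le[OF r(1) that(3)] r(2) by auto
    qed
    have "\<bar>\<sigma>\<bar> = 1" using that(1) by (auto simp: power2_eq_1_iff)
    hence "\<bar>\<sigma> * cos (real k * v)\<bar> \<le> 1" by (simp add: abs_mult)
    hence t: "2 + 2 * \<sigma> * cos (real k * v) \<le> 4" by (simp add: abs_le_iff)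
    have "pw (k + 2) (dfil k \<sigma>) v * f v = ((2 - 2 * cos v) * f v) * (2 + 2 * \<sigma> * cos (real k * v))"
      unfolding pw_dfil[OF that(1)] by simp
    also have "\<dots> \<le> ((2 - 2 * cos v) * f v) * 4" by (rule mult_left_mono[OF t w(1)])
    also have "\<dots> \<le> K" using w(2) unfolding K_def by linarith
    finally show ?thesis .
  qed
  have "AE \<omega> in \<Omega>. \<forall>k j. (\<lambda>n. measure (post n \<omega>) (bad (k + 2) (dfil k s) (1 / real (Suc j)))) \<longlonglongrightarrow> 0"
    if "s\<^sup>2 = 1" for s
    unfolding AE_all_countable using B h K0 K[OF that]
    by (intro allI posterior_bad[where B = B and K = K]) auto
  from this[of 1] this[of "-1"] have "AE \<omega> in \<Omega>. \<forall>k j. (\<lambda>n. measure (post n \<omega>) (bad (k + 2) (dfil k 1) (1 / real (Suc j)))) \<longlonglongrightarrow> 0"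
    "AE \<omega> in \<Omega>. \<forall>k j. (\<lambda>n. measure (post n \<omega>) (bad (k + 2) (dfil k (-1)) (1 / real (Suc j)))) \<longlonglongrightarrow> 0" by auto
  with evidence_finite AE_space show ?thesis
  proof eventually_elim
    case (elim \<omega>)
    have fin: "(\<integral>\<^sup>+f. ennreal (lik n f (smp n \<omega>)) \<partial>P) < \<infinity>" for n using elim by blast
    note pd = posterior_density[OF \<open>\<omega> \<in> space \<Omega>\<close> fin]
    have "(\<lambda>n. log_loss f0 (\<lambda>v. exp (\<integral>f. ln (f v) \<partial>post n \<omega>))) \<longlonglongrightarrow> 0"
    proof (rule log_loss_limit[OF pd(2) pd(1) _ equi])
      fix k j
      let ?S = "{f \<in> space P. 1 / real (Suc j) \<le> \<bar>dco k f - dco k f0\<bar>}"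
      let ?b = "\<lambda>s. bad (k + 2) (dfil k s) (1 / real (Suc j))"
      \<comment> \<open>Four times the deviation of a coefficient is the difference of the
        deviations of the two filtered variances, so at least one of these is no smaller than the
        deviation of the coefficient.\<close>
      have sub: "?S \<subseteq> ?b 1 \<union> ?b (-1)"
      proof
        fix f assume f: "f \<in> ?S"
        then obtain d where d: "reg m M d f" using P_reg by blast
        have e: "4 * (dco k f - dco k f0) = (vfil (k + 2) (dfil k 1) f - vfil (k + 2) (dfil k 1) f0)
            - (vfil (k + 2) (dfil k (-1)) f - vfil (k + 2) (dfil k (-1)) f0)"
        proof -
          have "4 * (x - y) = (a - c) - (b - e)" if "a - b = 4 * x" "c - e = 4 * y" for a b c e x y :: real
          proof -
            have "4 * (x - y) = 4 * x - 4 * y" by simp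
            thus ?thesis unfolding that[symmetric] by simp
          qed
          from this[OF vfil_dfil[OF d] vfil_dfil[OF reg0]] show ?thesis unfolding vfil_def .
        qed
        have "1 / real (Suc j) \<le> \<bar>dco k f - dco k f0\<bar>" "0 \<le> 1 / real (Suc j)" using f by auto
        hence "1 / real (Suc j) \<le> \<bar>vfil (k + 2) (dfil k 1) f - vfil (k + 2) (dfil k 1) f0\<bar>
          \<or> 1 / real (Suc j) \<le> \<bar>vfil (k + 2) (dfil k (-1)) f - vfil (k + 2) (dfil k (-1)) f0\<bar>"
        proof -
          have "r \<le> \<bar>p\<bar> \<or> r \<le> \<bar>q\<bar>" if "r \<le> \<bar>z\<bar>" "0 \<le> r" "4 * z = p - q" for r p q z :: real
            using that by (smt (verit))
          from this[OF _ _ e] show ?thesis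
            using \<open>1 / real (Suc j) \<le> \<bar>dco k f - dco k f0\<bar>\<close> \<open>0 \<le> 1 / real (Suc j)\<close> by blast
        qed
        thus "f \<in> ?b 1 \<union> ?b (-1)" using f by (auto simp: bad_def)
      qed
      have "measure (post n \<omega>) ?S \<le> measure (post n \<omega>) (?b 1) + measure (post n \<omega>) (?b (-1))" for n
      proof -
        interpret prob_space "post n \<omega>" by (rule pd(2))
        have "measure (post n \<omega>) ?S \<le> measure (post n \<omega>) (?b 1 \<union> ?b (-1))"
          using sub by (intro finite_measure_mono) (auto simp: pd(1))
        also have "\<dots> \<le> measure (post n \<omega>) (?b 1) + measure (post n \<omega>) (?b (-1))"
          by (intro measure_Un_le) (auto simp: pd(1))
        finally show ?thesis .
      qed
      note le = this
      have "(\<lambda>n. measure (post n \<omega>) (?b 1) + measure (post n \<omega>) (?b (-1))) \<longlonglongrightarrow> 0 + 0"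
        using elim by (intro tendsto_add) auto
      hence "(\<lambda>n. measure (post n \<omega>) (?b 1) + measure (post n \<omega>) (?b (-1))) \<longlonglongrightarrow> 0" by simp
      thus "(\<lambda>n. measure (post n \<omega>) ?S) \<longlonglongrightarrow> 0"
        by (rule Lim_null_comparison[rotated]) (use le in simp)
    qed
    thus ?case by (simp add: post_est_def[abs_def])
  qed
qed

end

section \<open>The function classes\<close>

text \<open>Common form of the two function classes, with \<psi> in place of the particular bound on
  increments.\<close>

definition pform :: "real \<Rightarrow> real \<Rightarrow> (real \<Rightarrow> real \<Rightarrow> real) \<Rightarrow> real \<Rightarrow> (real \<Rightarrow> real) \<Rightarrow> bool" where
  "pform m M \<psi> d f \<longleftrightarrow> (\<exists>g. long_mem_form f d g \<and> (\<forall>v\<in>freqs. f (- v) = f v) \<and>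
     (\<forall>x\<in>{-pi..pi}. m \<le> g x \<and> g x \<le> M) \<and> (\<forall>x\<in>freqs. \<forall>y\<in>freqs. \<bar>g x - g y\<bar> \<le> \<psi> x y))"

text \<open>Pointwise in l and away from the origin only: this admits the bound with
  \<open>min \<bar>x\<bar> \<bar>y\<bar>\<close> in the denominator, which degenerates at 0.\<close>

definition modulus :: "(real \<Rightarrow> real \<Rightarrow> real) \<Rightarrow> bool" where
  "modulus \<psi> \<longleftrightarrow> (\<forall>l\<in>freqs. ((\<lambda>u. \<psi> u l) \<longlongrightarrow> 0) (at l))"

lemma G_class_pform: "f \<in> G_class d M m L \<rho> \<Longrightarrow> pform m M (\<lambda>x y. L * \<bar>x - y\<bar> powr \<rho>) d f"
proof -
  assume f: "f \<in> G_class d M m L \<rho>"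
  then obtain g where g: "long_mem_form f d g" "\<forall>x\<in>{-pi..pi}. m \<le> g x \<and> g x \<le> M"
    "\<forall>x\<in>{-pi..pi}. \<forall>y\<in>{-pi..pi}. \<bar>g x - g y\<bar> \<le> L * \<bar>x - y\<bar> powr \<rho>"
    unfolding G_class_def by blast
  have "\<forall>v\<in>freqs. f (- v) = f v"
    using f by (simp add: G_class_def sdens_tilde_plus_def sdens_tilde_def sdens_def)
  moreover have "freqs \<subseteq> {-pi..pi}" by (auto simp: freqs_def)
  ultimately show ?thesis
    unfolding pform_def using g by (intro exI[of _ g] conjI) (blast | simp)+
qed

lemma L_class_pform: "f \<in> L_class d M m L \<Longrightarrow> pform m M (\<lambda>x y. L * \<bar>x - y\<bar> / min \<bar>x\<bar> \<bar>y\<bar>) d f"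
proof -
  assume f: "f \<in> L_class d M m L"
  then obtain g where g: "long_mem_form f d g" "g \<in> L_star M m L"
    unfolding L_class_def by blast
  have "\<forall>v\<in>freqs. f (- v) = f v"
    using f by (simp add: L_class_def sdens_plus_def sdens_def)
  thus ?thesis
    unfolding pform_def using g by (intro exI[of _ g]) (simp add: L_star_def)
qed

lemma modulus_G:
  assumes "0 < \<rho>"
  shows "modulus (\<lambda>x y. L * \<bar>x - y\<bar> powr \<rho>)"
  unfolding modulus_def
proof
  fix l :: real
  have "((\<lambda>u. L * \<bar>u - l\<bar> powr \<rho>) \<longlongrightarrow> L * \<bar>l - l\<bar> powr \<rho>) (at l)"
    using assms by (intro tendsto_intros tendsto_powr') auto
  thus "((\<lambda>u. L * \<bar>u - l\<bar> powr \<rho>) \<longlongrightarrow> 0) (at l)" by simp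
qed

lemma modulus_L: "modulus (\<lambda>x y. L * \<bar>x - y\<bar> / min \<bar>x\<bar> \<bar>y\<bar>)"
  unfolding modulus_def
proof
  fix l :: real assume l: "l \<in> freqs"
  have "((\<lambda>u. L * \<bar>u - l\<bar> / min \<bar>u\<bar> \<bar>l\<bar>) \<longlongrightarrow> L * \<bar>l - l\<bar> / min \<bar>l\<bar> \<bar>l\<bar>) (at l)"
    using l by (intro tendsto_intros) (auto simp: freqs_def)
  thus "((\<lambda>u. L * \<bar>u - l\<bar> / min \<bar>u\<bar> \<bar>l\<bar>) \<longlongrightarrow> 0) (at l)" by simp
qed

lemma abs_ln_diff_le:
  assumes "0 < m" "m \<le> x" "m \<le> y"
  shows "\<bar>ln x - ln y\<bar> \<le> \<bar>x - y\<bar> / (m::real)"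
proof -
  have *: "ln x - ln y \<le> \<bar>x - y\<bar> / m" if "m \<le> x" "m \<le> y" for x y
  proof -
    have xy: "0 < x" "0 < y" using that assms by auto
    have "ln x - ln y = ln (x / y)" using xy by (simp add: ln_div)
    also have "\<dots> \<le> x / y - 1" using xy by (intro ln_le_minus_one) auto
    also have "\<dots> = (x - y) / y" using xy by (simp add: field_simps)
    also have "\<dots> \<le> \<bar>x - y\<bar> / y" using xy by (intro divide_right_mono) auto
    also have "\<dots> \<le> \<bar>x - y\<bar> / m" using xy that assms by (intro divide_left_mono) auto
    finally show ?thesis .
  qed
  show ?thesis using *[of x y] *[of y x] assms by (simp add: abs_le_iff abs_minus_commute)
qed

text \<open>The logarithm splits into \<open>- 2 * d * ln \<bar>v\<bar>\<close>, which oscillates no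
  more than \<open>ln \<bar>v\<bar>\<close> since \<open>\<bar>2 * d\<bar> < 1\<close>, and
  \<open>ln (g v)\<close>, controlled by \<psi> divided by m. Hence \<delta> can be chosen before f
  and d. Evenness reduces to positive frequencies and matches the symmetrized Fejer kernel.\<close>

lemma pform_ln_equicontinuous:
  assumes \<psi>: "modulus \<psi>" and m: "0 < m" and l: "l \<in> freqs" and \<theta>: "0 < \<theta>"
  shows "\<exists>\<delta>>0. \<forall>f d u. pform m M \<psi> d f \<longrightarrow> u \<in> freqs \<longrightarrow> \<bar>\<bar>u\<bar> - \<bar>l\<bar>\<bar> < \<delta> \<longrightarrow> \<bar>ln (f u) - ln (f l)\<bar> \<le> \<theta>"
proof -
  define a where "a = \<bar>l\<bar>"
  have a: "a \<in> freqs" "0 < a" using l by (auto simp: a_def freqs_def)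
  have "((\<lambda>u. \<psi> u a) \<longlongrightarrow> 0) (at a)" using \<psi> a by (simp add: modulus_def)
  hence "\<forall>\<^sub>F u in at a. dist (\<psi> u a) 0 < m * \<theta> / 2" using m \<theta> by (intro tendstoD) auto
  moreover have "(ln \<longlongrightarrow> ln a) (at a)" using a by (intro tendsto_intros) auto
  hence "\<forall>\<^sub>F u in at a. dist (ln u) (ln a) < \<theta> / 2" using \<theta> by (intro tendstoD) auto
  ultimately have "\<forall>\<^sub>F u in at a. \<psi> u a < m * \<theta> / 2 \<and> \<bar>ln u - ln a\<bar> < \<theta> / 2"
    by eventually_elim (auto simp: dist_real_def)
  then obtain \<delta> where \<delta>: "0 < \<delta>" "\<And>u. u \<noteq> a \<Longrightarrow> dist u a < \<delta> \<Longrightarrow> \<psi> u a < m * \<theta> / 2 \<and> \<bar>ln u - ln a\<bar> < \<theta> / 2"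
    unfolding eventually_at by blast
  have "\<bar>ln (f u) - ln (f l)\<bar> \<le> \<theta>" if f: "pform m M \<psi> d f" and u: "u \<in> freqs" "\<bar>\<bar>u\<bar> - \<bar>l\<bar>\<bar> < \<delta>" for f d u
  proof -
    obtain g where d: "-1/2 < d" "d < 1/2" and fg: "\<And>v. v \<in> freqs \<Longrightarrow> f v = \<bar>v\<bar> powr (- 2 * d) * g v"
      and sym: "\<And>v. v \<in> freqs \<Longrightarrow> f (- v) = f v" and g: "\<And>x. x \<in> freqs \<Longrightarrow> m \<le> g x"
      and mod: "\<And>x y. x \<in> freqs \<Longrightarrow> y \<in> freqs \<Longrightarrow> \<bar>g x - g y\<bar> \<le> \<psi> x y"
      using f unfolding pform_def long_mem_form_def freqs_def by auto
    define b where "b = \<bar>u\<bar>"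
    have b: "b \<in> freqs" "0 < b" using u by (auto simp: b_def freqs_def)
    have fa: "f l = f a" "f u = f b" using sym[OF l] sym[OF u(1)] by (auto simp: a_def b_def abs_if)
    have lnf: "ln (f v) = - 2 * d * ln v + ln (g v)" if "v \<in> freqs" "0 < v" for v
      using fg[OF that(1)] g[OF that(1)] m that(2) by (simp add: ln_mult ln_powr)
    show ?thesis
    proof (cases "b = a")
      case False
      hence s: "\<psi> b a < m * \<theta> / 2" "\<bar>ln b - ln a\<bar> < \<theta> / 2"
        using \<delta>(2)[of b] u(2) by (auto simp: a_def b_def dist_real_def)
      have "\<bar>ln (g b) - ln (g a)\<bar> \<le> \<bar>g b - g a\<bar> / m" using g[OF b(1)] g[OF a(1)] m by (intro abs_ln_diff_le)
      also have "\<dots> \<le> (m * \<theta> / 2) / m" using mod[OF b(1) a(1)] s m by (intro divide_right_mono) auto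
      also have "\<dots> = \<theta> / 2" using m by simp
      finally have 1: "\<bar>ln (g b) - ln (g a)\<bar> \<le> \<theta> / 2" .
      have "\<bar>- 2 * d * (ln b - ln a)\<bar> \<le> 1 * \<bar>ln b - ln a\<bar>"
        unfolding abs_mult using d by (intro mult_right_mono) auto
      hence 2: "\<bar>- 2 * d * (ln b - ln a)\<bar> \<le> \<theta> / 2"
        unfolding mult_1 by (rule order_trans) (use s in simp)
      have "ln (f b) - ln (f a) = - 2 * d * (ln b - ln a) + (ln (g b) - ln (g a))"
        unfolding lnf[OF a] lnf[OF b] by (simp add: algebra_simps)
      thus ?thesis unfolding fa using 1 2 abs_triangle_ineq[of "- 2 * d * (ln b - ln a)" "ln (g b) - ln (g a)"]
        by simp
    qed (use \<theta> fa in simp)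
  qed
  thus ?thesis using \<delta>(1) by blast
qed

text \<open>Continuity off the origin is read off the modulus of the logarithm.\<close>

lemma pform_reg:
  assumes f: "pform m M \<psi> d f" and \<psi>: "modulus \<psi>" and m: "0 < m"
  shows "reg m M d f"
proof -
  obtain g where d: "-1/2 < d" "d < 1/2" and fg: "\<And>v. v \<in> freqs \<Longrightarrow> f v = \<bar>v\<bar> powr (- 2 * d) * g v"
    and sym: "\<And>v. v \<in> freqs \<Longrightarrow> f (- v) = f v" and g: "\<And>x. x \<in> freqs \<Longrightarrow> m \<le> g x \<and> g x \<le> M"
    using f unfolding pform_def long_mem_form_def freqs_def by auto
  have pos: "0 < f v" if "v \<in> freqs" for v
    using fg[OF that] g[OF that] m freqs_abs[OF that] by simp
  have "continuous_on freqs (\<lambda>v. ln (f v))"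
    unfolding continuous_on_iff
  proof (intro ballI allI impI)
    fix l e :: real assume l: "l \<in> freqs" and e: "0 < e"
    obtain \<delta> where \<delta>: "0 < \<delta>" "\<And>u. u \<in> freqs \<Longrightarrow> \<bar>\<bar>u\<bar> - \<bar>l\<bar>\<bar> < \<delta> \<Longrightarrow> \<bar>ln (f u) - ln (f l)\<bar> \<le> e / 2"
      using pform_ln_equicontinuous[OF \<psi> m l, of "e / 2" M] e f by auto
    have "dist (ln (f u)) (ln (f l)) < e" if "u \<in> freqs" "dist u l < \<delta>" for u
    proof -
      have "\<bar>\<bar>u\<bar> - \<bar>l\<bar>\<bar> < \<delta>" using that(2) by (simp add: dist_real_def)
      thus ?thesis using \<delta>(2)[OF that(1)] e by (simp add: dist_real_def)
    qed
    thus "\<exists>d>0. \<forall>x'\<in>freqs. dist x' l < d \<longrightarrow> dist (ln (f x')) (ln (f l)) < e" using \<delta>(1) by blast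
  qed
  hence "continuous_on freqs (\<lambda>v. exp (ln (f v)))" by (rule continuous_on_exp)
  hence "continuous_on freqs f"
    by (rule continuous_on_eq) (use pos in simp)
  moreover have "m * \<bar>v\<bar> powr (- 2 * d) \<le> f v" "f v \<le> M * \<bar>v\<bar> powr (- 2 * d)" if "v \<in> freqs" for v
    unfolding fg[OF that] mult.commute[of "\<bar>v\<bar> powr (- 2 * d)"]
    using g[OF that] by (auto intro!: mult_right_mono)
  ultimately show ?thesis
    unfolding reg_def using m d sym by blast
qed

section \<open>Specialization to the two function classes\<close>

theorem corollary3:
  fixes \<Omega> :: "'w measure" and X :: "nat \<Rightarrow> 'w \<Rightarrow> real"
    and f0 :: "real \<Rightarrow> real" and d0 t0 M0 m0 L0 \<rho>0 t M m L \<rho> \<gamma> :: real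
    and \<C> :: "(real \<Rightarrow> real) set" and P :: "(real \<Rightarrow> real) measure"
  assumes process: "gaussian_process \<Omega> X f0"
    and pos0: "t0 > 0" "M0 > 0" "m0 > 0" "L0 > 0"
    and true_density: "(0 < \<rho>0 \<and> \<rho>0 \<le> 1 \<and> f0 \<in> G_bar t0 M0 m0 L0 \<rho>0) \<or>
                       (\<rho>0 = 1 \<and> f0 \<in> L_bar t0 M0 m0 L0)"
    and d0: "mem_exponent f0 d0"
    and pos: "t > 0" "m > 0" "M > 0" "L > 0"
    and model: "(0 < \<rho> \<and> \<C> = G_bar t M m L \<rho>) \<or> (\<rho> = 1 \<and> \<C> = L_bar t M m L)"
    and prior: "prior_on P \<C>"
    and t_less: "t < min \<rho> \<rho>0 / 4"
    and gamma: "\<gamma> = min (min \<rho> \<rho>0) (1/2)"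
    and i: "\<And>\<epsilon>. \<epsilon> > 0 \<Longrightarrow> measure P (B_set f0 d0 t M m \<gamma> \<epsilon> \<inter> space P) > 0"
    and ii: "\<forall>\<^sub>F \<epsilon> in at_right 0. \<exists>r F H c1.
        r > 0 \<and> c1 \<le> \<epsilon> * \<bar>ln \<epsilon>\<bar> powr (-2) \<and>
        (\<forall>n::nat. F n \<subseteq> sdens_tilde_plus \<and> space P - F n \<in> sets P \<and>
                  measure P (space P - F n) \<le> exp (- real n * r)) \<and>
        (\<forall>\<^sub>F n in sequentially.
            is_smallest_net \<C> f0 d0 t \<rho> \<gamma> \<epsilon> (F n) (H n) \<and>
            ln (real (card (H n))) \<le> real n * c1)"
  shows "AE \<omega> in \<Omega>. (\<lambda>n. log_loss f0 (post_est P n (\<lambda>i. X i \<omega>))) \<longlonglongrightarrow> 0"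
proof -
  \<comment> \<open>One modulus serves the whole class, whatever the exponents; this makes the
    equicontinuity below uniform over the model.\<close>
  have model': "\<exists>\<psi>. modulus \<psi> \<and> (\<forall>f\<in>\<C>. \<exists>d. pform m M \<psi> d f)"
    using model
  proof
    assume A: "0 < \<rho> \<and> \<C> = G_bar t M m L \<rho>"
    show ?thesis
      using A by (intro exI[of _ "\<lambda>x y. L * \<bar>x - y\<bar> powr \<rho>"]) (auto simp: G_bar_def modulus_G dest: G_class_pform)
  next
    assume "\<rho> = 1 \<and> \<C> = L_bar t M m L"
    thus ?thesis
      by (intro exI[of _ "\<lambda>x y. L * \<bar>x - y\<bar> / min \<bar>x\<bar> \<bar>y\<bar>"]) (auto simp: L_bar_def modulus_L dest: L_class_pform)
  qed
  then obtain \<psi> where \<psi>: "modulus \<psi>" "\<And>f. f \<in> \<C> \<Longrightarrow> \<exists>d. pform m M \<psi> d f" by blast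
  have "\<exists>\<psi>0 d. modulus \<psi>0 \<and> pform m0 M0 \<psi>0 d f0"
    using true_density
  proof
    assume A: "0 < \<rho>0 \<and> \<rho>0 \<le> 1 \<and> f0 \<in> G_bar t0 M0 m0 L0 \<rho>0"
    then obtain d where "f0 \<in> G_class d M0 m0 L0 \<rho>0" by (auto simp: G_bar_def)
    from G_class_pform[OF this] modulus_G[of \<rho>0 L0] A show ?thesis by blast
  next
    assume "\<rho>0 = 1 \<and> f0 \<in> L_bar t0 M0 m0 L0"
    then obtain d where "f0 \<in> L_class d M0 m0 L0" by (auto simp: L_bar_def)
    from L_class_pform[OF this] modulus_L[of L0] show ?thesis by blast
  qed
  then obtain \<psi>0 e0 where \<psi>0: "modulus \<psi>0" "pform m0 M0 \<psi>0 e0 f0" by blast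
  have P: "prob_space P" "space P = \<C>" "\<And>v. v \<in> freqs \<Longrightarrow> (\<lambda>f. f v) \<in> borel_measurable P"
    using prior by (auto simp: prior_on_def)
  \<comment> \<open>\<open>e0\<close> is the exponent in the representation that class membership
    provides; it agrees with \<open>d0\<close> by \<open>mem_exponent_unique\<close>.\<close>
  interpret gaussian_bayes \<Omega> X f0 m0 M0 e0 m M P
  proof (rule gaussian_bayes.intro)
    show "gaussian_process \<Omega> X f0" by (rule process)
    show "reg m0 M0 e0 f0" by (rule pform_reg[OF \<psi>0(2,1) pos0(3)])
    show "\<exists>d. reg m M d f" if "f \<in> space P" for f
      using \<psi>(2)[of f] that pform_reg[OF _ \<psi>(1) pos(2)] by (auto simp: P(2))
    show "prob_space P" by (rule P(1))
    show "(\<lambda>f. f v) \<in> borel_measurable P" if "v \<in> freqs" for v by (rule P(3)[OF that])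
  qed
  show ?thesis
  proof (rule posterior_log_loss[where B = "\<lambda>\<epsilon>. B_set f0 d0 t M m \<gamma> \<epsilon> \<inter> space P"])
    show "0 < measure P (B_set f0 d0 t M m \<gamma> \<epsilon> \<inter> space P)" if "0 < \<epsilon>" for \<epsilon>
      by (rule i[OF that])
    show "h_disc f0 f \<le> ennreal \<epsilon>" if "f \<in> B_set f0 d0 t M m \<gamma> \<epsilon> \<inter> space P" for \<epsilon> f
      using that by (auto simp: B_set_def)
    fix l \<theta> :: real assume l: "l \<in> freqs" and \<theta>: "0 < \<theta>"
    obtain \<delta>1 where \<delta>1: "0 < \<delta>1" "\<And>f d u. pform m M \<psi> d f \<Longrightarrow> u \<in> freqs \<Longrightarrow> \<bar>\<bar>u\<bar> - \<bar>l\<bar>\<bar> < \<delta>1 \<Longrightarrow> \<bar>ln (f u) - ln (f l)\<bar> \<le> \<theta>"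
      using pform_ln_equicontinuous[OF \<psi>(1) pos(2) l \<theta>, of M] by blast
    obtain \<delta>2 where \<delta>2: "0 < \<delta>2" "\<And>u. u \<in> freqs \<Longrightarrow> \<bar>\<bar>u\<bar> - \<bar>l\<bar>\<bar> < \<delta>2 \<Longrightarrow> \<bar>ln (f0 u) - ln (f0 l)\<bar> \<le> \<theta>"
      using pform_ln_equicontinuous[OF \<psi>0(1) pos0(3) l \<theta>, of M0] \<psi>0(2) by blast
    have "\<forall>f\<in>insert f0 (space P). \<forall>u\<in>freqs. \<bar>\<bar>u\<bar> - \<bar>l\<bar>\<bar> < min \<delta>1 \<delta>2 \<longrightarrow> \<bar>ln (f u) - ln (f l)\<bar> \<le> \<theta>"
    proof (intro ballI impI)
      fix f u assume f: "f \<in> insert f0 (space P)" and u: "u \<in> freqs" "\<bar>\<bar>u\<bar> - \<bar>l\<bar>\<bar> < min \<delta>1 \<delta>2"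
      show "\<bar>ln (f u) - ln (f l)\<bar> \<le> \<theta>"
      proof (cases "f = f0")
        case True
        thus ?thesis using \<delta>2(2) u by simp
      next
        case False
        then obtain d where "pform m M \<psi> d f" using f \<psi>(2) P(2) by blast
        thus ?thesis using \<delta>1(2) u by simp
      qed
    qed
    thus "\<exists>\<delta>>0. \<forall>f\<in>insert f0 (space P). \<forall>u\<in>freqs. \<bar>\<bar>u\<bar> - \<bar>l\<bar>\<bar> < \<delta> \<longrightarrow> \<bar>ln (f u) - ln (f l)\<bar> \<le> \<theta>"
      using \<delta>1(1) \<delta>2(1) by (intro exI[of _ "min \<delta>1 \<delta>2"]) auto
  qed
qed

end
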